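(* Let $1<p<\infty$, $\gamma_p=(1-\frac1p)^{\frac1p-1}$, and let $\mathcal C$ be either $\mathcal C_p$ (then set $K_{\mathcal C}=2^{1-\frac1p}$) or $\mathcal C_{p,\infty}$ (then set $K_{\mathcal C}=2^{1-\frac1p}\gamma_p$). Let $X_0,X_1,X_2\in\mathcal C$, let $T_1:X_0\to X_1$ be a lattice homomorphism with $\|T_1\|\le1$, let $T_2:X_0\to X_2$ be a lattice isometric embedding, and let $(PO,\widetilde T_1,\widetilde T_2)$ be an isometric push-out of $(T_1,T_2)$ in $\mathcal C$ (i.e. $PO\in\mathcal C$, $\widetilde T_i:X_i\to PO$ lattice homomorphisms of norm $\le1$ with $\widetilde T_1T_1=\widetilde T_2T_2$, and for all $Z\in\mathcal C$ and lattice homomorphisms $R_i:X_i\to Z$ with $R_1T_1=R_2T_2$ there is a unique lattice homomorphism $\gamma:PO\to Z$ with $\gamma\widetilde T_i=R_i$ and $\|\gamma\|\le\max\|R_i\|$). Then $\widetilde T_1$ is a $K_{\mathcal C}$-embedding: $K_{\mathcal C}^{-1}\|x\|\le\|\widetilde T_1x\|\le\|x\|$ for all $x\in X_1$.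
   Context: $\mathcal C_p$ is the class of Banach lattices with $p$-convexity constant $1$ ($\|(\sum|x_k|^p)^{1/p}\|\le(\sum\|x_k\|^p)^{1/p}$ for all finite families), and $\mathcal C_{p,\infty}$ is the class of Banach lattices satisfying an upper $p$-estimate with constant $1$ (the same inequality for pairwise disjoint families). Both classes are closed under closed sublattices, $\ell^\infty$-direct sums and lattice quotients, so isometric push-outs exist in them. *)

theory Defs
  imports Complex_Main
begin

record 'a blat =
  bl_carrier :: "'a set"
  bl_zero :: 'a
  bl_add :: "'a \<Rightarrow> 'a \<Rightarrow> 'a"
  bl_scal :: "real \<Rightarrow> 'a \<Rightarrow> 'a"
  bl_leq :: "'a \<Rightarrow> 'a \<Rightarrow> bool"
  bl_nrm :: "'a \<Rightarrow> real"

definition bl_neg :: "'a blat \<Rightarrow> 'a \<Rightarrow> 'a" where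
  "bl_neg X x = bl_scal X (-1) x"

definition bl_diff :: "'a blat \<Rightarrow> 'a \<Rightarrow> 'a \<Rightarrow> 'a" where
  "bl_diff X x y = bl_add X x (bl_neg X y)"

definition bl_lub :: "'a blat \<Rightarrow> 'a set \<Rightarrow> 'a \<Rightarrow> bool" where
  "bl_lub X S z \<longleftrightarrow> z \<in> bl_carrier X \<and> (\<forall>s\<in>S. bl_leq X s z) \<and>
     (\<forall>w\<in>bl_carrier X. (\<forall>s\<in>S. bl_leq X s w) \<longrightarrow> bl_leq X z w)"

definition bl_glb :: "'a blat \<Rightarrow> 'a set \<Rightarrow> 'a \<Rightarrow> bool" where
  "bl_glb X S z \<longleftrightarrow> z \<in> bl_carrier X \<and> (\<forall>s\<in>S. bl_leq X z s) \<and>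
     (\<forall>w\<in>bl_carrier X. (\<forall>s\<in>S. bl_leq X w s) \<longrightarrow> bl_leq X w z)"

definition bl_sup :: "'a blat \<Rightarrow> 'a \<Rightarrow> 'a \<Rightarrow> 'a" where
  "bl_sup X x y = (THE z. bl_lub X {x, y} z)"

definition bl_inf :: "'a blat \<Rightarrow> 'a \<Rightarrow> 'a \<Rightarrow> 'a" where
  "bl_inf X x y = (THE z. bl_glb X {x, y} z)"

definition bl_abs :: "'a blat \<Rightarrow> 'a \<Rightarrow> 'a" where
  "bl_abs X x = bl_sup X x (bl_neg X x)"

primrec bl_sum :: "'a blat \<Rightarrow> (nat \<Rightarrow> 'a) \<Rightarrow> nat \<Rightarrow> 'a" where
  "bl_sum X f 0 = bl_zero X"
| "bl_sum X f (Suc n) = bl_add X (bl_sum X f n) (f n)"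

definition banach_lattice :: "'a blat \<Rightarrow> bool" where
  "banach_lattice X \<longleftrightarrow>
    (let C = bl_carrier X; z = bl_zero X; add = bl_add X; sc = bl_scal X;
         le = bl_leq X; nr = bl_nrm X in
     \<comment> \<open>real vector space\<close>
     z \<in> C \<and> (\<forall>x\<in>C. \<forall>y\<in>C. add x y \<in> C) \<and> (\<forall>a. \<forall>x\<in>C. sc a x \<in> C) \<and>
     (\<forall>x\<in>C. \<forall>y\<in>C. \<forall>w\<in>C. add (add x y) w = add x (add y w)) \<and>
     (\<forall>x\<in>C. \<forall>y\<in>C. add x y = add y x) \<and>
     (\<forall>x\<in>C. add z x = x) \<and>
     (\<forall>x\<in>C. add x (sc (-1) x) = z) \<and>
     (\<forall>a. \<forall>x\<in>C. \<forall>y\<in>C. sc a (add x y) = add (sc a x) (sc a y)) \<and>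
     (\<forall>a b. \<forall>x\<in>C. sc (a + b) x = add (sc a x) (sc b x)) \<and>
     (\<forall>a b. \<forall>x\<in>C. sc a (sc b x) = sc (a * b) x) \<and>
     (\<forall>x\<in>C. sc 1 x = x) \<and>
     \<comment> \<open>compatible partial order\<close>
     (\<forall>x\<in>C. le x x) \<and>
     (\<forall>x\<in>C. \<forall>y\<in>C. le x y \<and> le y x \<longrightarrow> x = y) \<and>
     (\<forall>x\<in>C. \<forall>y\<in>C. \<forall>w\<in>C. le x y \<and> le y w \<longrightarrow> le x w) \<and>
     (\<forall>x\<in>C. \<forall>y\<in>C. \<forall>w\<in>C. le x y \<longrightarrow> le (add x w) (add y w)) \<and>
     (\<forall>a. \<forall>x\<in>C. \<forall>y\<in>C. le x y \<and> 0 \<le> a \<longrightarrow> le (sc a x) (sc a y)) \<and>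
     \<comment> \<open>lattice\<close>
     (\<forall>x\<in>C. \<forall>y\<in>C. \<exists>w. bl_lub X {x, y} w) \<and>
     \<comment> \<open>norm\<close>
     (\<forall>x\<in>C. nr x = 0 \<longleftrightarrow> x = z) \<and>
     (\<forall>a. \<forall>x\<in>C. nr (sc a x) = \<bar>a\<bar> * nr x) \<and>
     (\<forall>x\<in>C. \<forall>y\<in>C. nr (add x y) \<le> nr x + nr y) \<and>
     \<comment> \<open>lattice norm\<close>
     (\<forall>x\<in>C. \<forall>y\<in>C. le (bl_abs X x) (bl_abs X y) \<longrightarrow> nr x \<le> nr y) \<and>
     \<comment> \<open>completeness\<close>
     (\<forall>s. (\<forall>n. s n \<in> C) \<and>
          (\<forall>e>0. \<exists>N. \<forall>m\<ge>N. \<forall>n\<ge>N. nr (bl_diff X (s m) (s n)) < e) \<longrightarrow>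
          (\<exists>x\<in>C. (\<lambda>n. nr (bl_diff X (s n) x)) \<longlonglongrightarrow> 0)))"

definition lattice_hom :: "'a blat \<Rightarrow> 'b blat \<Rightarrow> ('a \<Rightarrow> 'b) \<Rightarrow> bool" where
  "lattice_hom X Y T \<longleftrightarrow>
     (\<forall>x\<in>bl_carrier X. T x \<in> bl_carrier Y) \<and>
     (\<forall>x\<in>bl_carrier X. \<forall>y\<in>bl_carrier X. T (bl_add X x y) = bl_add Y (T x) (T y)) \<and>
     (\<forall>a. \<forall>x\<in>bl_carrier X. T (bl_scal X a x) = bl_scal Y a (T x)) \<and>
     (\<forall>x\<in>bl_carrier X. \<forall>y\<in>bl_carrier X. T (bl_sup X x y) = bl_sup Y (T x) (T y)) \<and>
     (\<exists>c. \<forall>x\<in>bl_carrier X. bl_nrm Y (T x) \<le> c * bl_nrm X x)"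

definition op_norm :: "'a blat \<Rightarrow> 'b blat \<Rightarrow> ('a \<Rightarrow> 'b) \<Rightarrow> real" where
  "op_norm X Y T = Sup {bl_nrm Y (T x) | x. x \<in> bl_carrier X \<and> bl_nrm X x \<le> 1}"

definition lattice_isometric_embedding :: "'a blat \<Rightarrow> 'b blat \<Rightarrow> ('a \<Rightarrow> 'b) \<Rightarrow> bool" where
  "lattice_isometric_embedding X Y T \<longleftrightarrow>
     lattice_hom X Y T \<and> (\<forall>x\<in>bl_carrier X. bl_nrm Y (T x) = bl_nrm X x)"

text \<open>The element (sum_k |x_k|^p)^(1/p) of a Banach lattice, defined (as usual, e.g.
  Lindenstrauss--Tzafriri 1.d) as the lattice supremum of
  sum_k a_k x_k over all real a with sum_k |a_k|^q \<le> 1, where 1/p + 1/q = 1.\<close>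

definition p_sum :: "'a blat \<Rightarrow> real \<Rightarrow> (nat \<Rightarrow> 'a) \<Rightarrow> nat \<Rightarrow> 'a" where
  "p_sum X p x n = (THE z. bl_lub X
      {bl_sum X (\<lambda>k. bl_scal X (a k) (x k)) n | a.
         (\<Sum>k<n. \<bar>a k\<bar> powr (p / (p - 1))) \<le> 1} z)"

definition p_convex1 :: "real \<Rightarrow> 'a blat \<Rightarrow> bool" where
  "p_convex1 p X \<longleftrightarrow> (\<forall>n x. (\<forall>k<n. x k \<in> bl_carrier X) \<longrightarrow>
      bl_nrm X (p_sum X p x n) \<le> (\<Sum>k<n. bl_nrm X (x k) powr p) powr (1 / p))"

definition pairwise_disjoint :: "'a blat \<Rightarrow> (nat \<Rightarrow> 'a) \<Rightarrow> nat \<Rightarrow> bool" where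
  "pairwise_disjoint X x n \<longleftrightarrow> (\<forall>i<n. \<forall>j<n. i \<noteq> j \<longrightarrow>
      bl_inf X (bl_abs X (x i)) (bl_abs X (x j)) = bl_zero X)"

definition upper_p_est1 :: "real \<Rightarrow> 'a blat \<Rightarrow> bool" where
  "upper_p_est1 p X \<longleftrightarrow> (\<forall>n x. (\<forall>k<n. x k \<in> bl_carrier X) \<and> pairwise_disjoint X x n \<longrightarrow>
      bl_nrm X (p_sum X p x n) \<le> (\<Sum>k<n. bl_nrm X (x k) powr p) powr (1 / p))"

datatype lattice_class = Cp | Cp_inf

fun in_class :: "lattice_class \<Rightarrow> real \<Rightarrow> 'a blat \<Rightarrow> bool" where
  "in_class Cp p X \<longleftrightarrow> banach_lattice X \<and> p_convex1 p X"
| "in_class Cp_inf p X \<longleftrightarrow> banach_lattice X \<and> upper_p_est1 p X"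

definition gamma_p :: "real \<Rightarrow> real" where
  "gamma_p p = (1 - 1 / p) powr (1 / p - 1)"

fun K_const :: "lattice_class \<Rightarrow> real \<Rightarrow> real" where
  "K_const Cp p = 2 powr (1 - 1 / p)"
| "K_const Cp_inf p = 2 powr (1 - 1 / p) * gamma_p p"

definition isometric_pushout ::
  "lattice_class \<Rightarrow> real \<Rightarrow> 'x0 blat \<Rightarrow> 'x1 blat \<Rightarrow> 'x2 blat \<Rightarrow>
   ('x0 \<Rightarrow> 'x1) \<Rightarrow> ('x0 \<Rightarrow> 'x2) \<Rightarrow> 'po blat \<Rightarrow> ('x1 \<Rightarrow> 'po) \<Rightarrow> ('x2 \<Rightarrow> 'po) \<Rightarrow>
   'z itself \<Rightarrow> bool" where
  "isometric_pushout c p X0 X1 X2 T1 T2 PO S1 S2 (_ :: 'z itself) \<longleftrightarrow>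
     in_class c p PO \<and>
     lattice_hom X1 PO S1 \<and> op_norm X1 PO S1 \<le> 1 \<and>
     lattice_hom X2 PO S2 \<and> op_norm X2 PO S2 \<le> 1 \<and>
     (\<forall>x\<in>bl_carrier X0. S1 (T1 x) = S2 (T2 x)) \<and>
     (\<forall>(Z :: 'z blat) R1 R2.
        in_class c p Z \<and> lattice_hom X1 Z R1 \<and> lattice_hom X2 Z R2 \<and>
        (\<forall>x\<in>bl_carrier X0. R1 (T1 x) = R2 (T2 x)) \<longrightarrow>
        (\<exists>g. lattice_hom PO Z g \<and>
             (\<forall>x\<in>bl_carrier X1. g (S1 x) = R1 x) \<and>
             (\<forall>x\<in>bl_carrier X2. g (S2 x) = R2 x) \<and>
             op_norm PO Z g \<le> max (op_norm X1 Z R1) (op_norm X2 Z R2) \<and>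
             (\<forall>g'. lattice_hom PO Z g' \<and>
                (\<forall>x\<in>bl_carrier X1. g' (S1 x) = R1 x) \<and>
                (\<forall>x\<in>bl_carrier X2. g' (S2 x) = R2 x) \<and>
                op_norm PO Z g' \<le> max (op_norm X1 Z R1) (op_norm X2 Z R2) \<longrightarrow>
                (\<forall>y\<in>bl_carrier PO. g' y = g y))))"

end

theory Submission
  imports Defs "HOL-Analysis.Analysis" "HOL-Analysis.Finite_Function_Topology" "HOL-Algebra.FiniteProduct"
begin

text \<open>
  The universal property reduces the lower estimate to finding one lattice in the class receiving both
  \<open>X1\<close> and \<open>X2\<close> compatibly and contractively, on which \<open>X1\<close> keeps its norm up to the factor \<open>2 powr (1 - 1/p)\<close>;
  this factor serves both classes, since \<open>gamma_p p\<close> is at least 1.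
  On \<open>X1 \<times> X2\<close> put \<open>(x, y) \<le> 0\<close> iff, up to norm-small errors, \<open>x \<le> T1 z\<close> and \<open>T2 z \<le> - y\<close> for some \<open>z\<close> in \<open>X0\<close>.
  Finite suprema taken in \<open>X1\<close> or \<open>X2\<close> remain suprema for this order (replace two witnesses \<open>z\<close>, \<open>z'\<close> by
  their supremum or infimum in \<open>X0\<close>), so both spaces are mapped by lattice homomorphisms into its Dedekind
  completion. The norm of the completion is the gauge of the smallest unit ball
  allowed by the class that contains the images of both unit balls.
  An element below \<open>x + y\<close> with \<open>norm x ^ p + norm y ^ p \<le> 1\<close> is moved by a witness \<open>z\<close> into \<open>X1\<close> at the cost
  \<open>norm x + norm y \<le> 2 powr (1 - 1/p)\<close>, because \<open>T2\<close> is isometric and \<open>T1\<close> is a contraction.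
\<close>

section \<open>Dedekind cuts of a preordered vector space\<close>

text \<open>The push-out is known only through the maps out of it, so a lower bound for
  \<open>S1\<close> needs a test lattice, and the sum of \<open>X1\<close> and \<open>X2\<close>
  modulo the relations from \<open>X0\<close> is merely a preordered vector space in which mixed
  suprema are missing. Cuts supply all of them at once, and they form a group under addition because
  the order is Archimedean; allowing norm-small errors in the order secures this and also makes the
  final norm vanish only at 0. A bound in the completion is recorded not by an element but by a
  family of pairs \<open>(a x, b y)\<close> with \<open>a powr r + b powr r <= 1\<close>: for
  positive \<open>x\<close>, \<open>y\<close> the supremum of this family plays the part of their
  p-sum if \<open>r = p / (p - 1)\<close> and of their join if \<open>r = 1\<close>, so one exponent
  treats both classes. The factor \<open>2 powr (1 - 1/p)\<close> is the largest ratio between the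
  sum of two norms and their p-norm; as a bound on a sum of norms it survives convex combinations.
  Norm completeness combines order completeness of the cuts with norm completeness of
  \<open>X1\<close> and \<open>X2\<close>.\<close>

locale preordered_space =
  fixes le :: "'v::real_vector \<Rightarrow> 'v \<Rightarrow> bool" (infix \<open>\<sqsubseteq>\<close> 50)
  assumes le_refl [simp, intro]: "x \<sqsubseteq> x"
    and le_trans [trans]: "x \<sqsubseteq> y \<Longrightarrow> y \<sqsubseteq> z \<Longrightarrow> x \<sqsubseteq> z"
    and le_add_right: "x \<sqsubseteq> y \<Longrightarrow> x + z \<sqsubseteq> y + z"
    and le_scaleR: "0 \<le> c \<Longrightarrow> x \<sqsubseteq> y \<Longrightarrow> c *\<^sub>R x \<sqsubseteq> c *\<^sub>R y"
begin

lemma le_iff_diff: "x \<sqsubseteq> y \<longleftrightarrow> 0 \<sqsubseteq> y - x"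
proof
  show "x \<sqsubseteq> y \<Longrightarrow> 0 \<sqsubseteq> y - x" using le_add_right[of x y "- x"] by simp
  show "0 \<sqsubseteq> y - x \<Longrightarrow> x \<sqsubseteq> y" using le_add_right[of 0 "y - x" x] by simp
qed

text \<open>A compatible order depends only on the difference of the two sides, so one inequality
  turns into another by checking a linear identity. The variants below add two inequalities or
  rescale one; most order arguments run through them.\<close>

lemma le_cong_diff: "a \<sqsubseteq> b \<Longrightarrow> y - x = b - a \<Longrightarrow> x \<sqsubseteq> y"
  by (metis le_iff_diff)

lemma le_add: "a \<sqsubseteq> b \<Longrightarrow> c \<sqsubseteq> d \<Longrightarrow> a + c \<sqsubseteq> b + d"
  using le_trans[OF le_add_right[of a b c]] le_add_right[of c d b] by (simp add: add.commute)

lemma le_cong_diff2: "a \<sqsubseteq> b \<Longrightarrow> c \<sqsubseteq> d \<Longrightarrow> y - x = (b - a) + (d - c) \<Longrightarrow> x \<sqsubseteq> y"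
  using le_add[of a b c d] by (rule le_cong_diff) (auto simp: algebra_simps)

lemma le_cong_scaleR: "a \<sqsubseteq> b \<Longrightarrow> 0 \<le> t \<Longrightarrow> y - x = t *\<^sub>R (b - a) \<Longrightarrow> x \<sqsubseteq> y"
  using le_scaleR[of t a b] by (rule le_cong_diff) (auto simp: algebra_simps)

lemma le_minus_iff: "- a \<sqsubseteq> - b \<longleftrightarrow> b \<sqsubseteq> a"
  by (metis le_iff_diff minus_diff_minus minus_diff_eq)

lemma le_scaleR_iff: "0 < c \<Longrightarrow> c *\<^sub>R x \<sqsubseteq> c *\<^sub>R y \<longleftrightarrow> x \<sqsubseteq> y"
  using le_scaleR[of c x y] le_scaleR[of "1/c" "c *\<^sub>R x" "c *\<^sub>R y"] by auto

definition ub :: "'v set \<Rightarrow> 'v set" where "ub A = {u. \<forall>a\<in>A. a \<sqsubseteq> u}"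
definition lb :: "'v set \<Rightarrow> 'v set" where "lb A = {u. \<forall>a\<in>A. u \<sqsubseteq> a}"
definition cl :: "'v set \<Rightarrow> 'v set" where "cl A = lb (ub A)"
text \<open>These are the elements of the Dedekind-MacNeille completion; excluding empty and
  unbounded sets removes its improper least and greatest elements.\<close>

definition cut :: "'v set \<Rightarrow> bool" where "cut A \<longleftrightarrow> cl A = A \<and> A \<noteq> {} \<and> ub A \<noteq> {}"
text \<open>Principal cuts are the image of the space in its completion. The order need not be
  antisymmetric, and \<open>dn\<close> identifies vectors that lie below each other.\<close>

definition dn :: "'v \<Rightarrow> 'v set" where "dn v = {w. w \<sqsubseteq> v}"
definition cadd :: "'v set \<Rightarrow> 'v set \<Rightarrow> 'v set" where
  "cadd A B = cl {a + b | a b. a \<in> A \<and> b \<in> B}"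
definition cneg :: "'v set \<Rightarrow> 'v set" where "cneg A = {v. - v \<in> ub A}"
text \<open>A negative factor exchanges lower and upper bounds, as in \<open>cneg\<close>. The
  factor 0 is set apart because \<open>1/0 = 0\<close> would make the membership condition
  independent of \<open>v\<close>.\<close>

definition cscal :: "real \<Rightarrow> 'v set \<Rightarrow> 'v set" where
  "cscal c A = (if c = 0 then dn 0 else if c > 0 then {v. (1/c) *\<^sub>R v \<in> A} else {v. (1/c) *\<^sub>R v \<in> ub A})"

lemma ub_antimono: "A \<subseteq> B \<Longrightarrow> ub B \<subseteq> ub A" by (auto simp: ub_def)
lemma cl_mono: "A \<subseteq> B \<Longrightarrow> cl A \<subseteq> cl B" by (auto simp: cl_def ub_def lb_def)
lemma cl_increasing: "A \<subseteq> cl A" by (auto simp: cl_def ub_def lb_def)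
lemma ub_cl [simp]: "ub (cl A) = ub A" by (auto simp: cl_def ub_def lb_def)
lemma cl_lb [simp]: "cl (lb A) = lb A" by (auto simp: cl_def ub_def lb_def)
lemma cl_cl [simp]: "cl (cl A) = cl A" by (simp add: cl_def[of A])
lemma ub_dn: "ub (dn v) = {u. v \<sqsubseteq> u}" unfolding ub_def dn_def using le_refl le_trans by blast
lemma cl_dn [simp]: "cl (dn v) = dn v"
  unfolding cl_def ub_dn unfolding lb_def dn_def using le_refl le_trans by blast
lemma in_cl_iff: "v \<in> cl A \<longleftrightarrow> (\<forall>u\<in>ub A. v \<sqsubseteq> u)" by (auto simp: cl_def lb_def)
lemma cl_down: "v \<in> cl A \<Longrightarrow> w \<sqsubseteq> v \<Longrightarrow> w \<in> cl A" unfolding in_cl_iff using le_trans by blast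
lemma cut_down: "cut A \<Longrightarrow> v \<in> A \<Longrightarrow> w \<sqsubseteq> v \<Longrightarrow> w \<in> A" using cl_down by (auto simp: cut_def)
lemma cut_dn [simp]: "cut (dn v)"
  unfolding cut_def by (auto simp: ub_dn) (auto simp: dn_def)
lemma self_in_dn [simp]: "v \<in> dn v" by (simp add: dn_def)
lemma in_cut_iff: "cut A \<Longrightarrow> v \<in> A \<longleftrightarrow> (\<forall>u\<in>ub A. v \<sqsubseteq> u)"
  by (metis cut_def in_cl_iff)
lemma cut_cl: "A \<noteq> {} \<Longrightarrow> ub A \<noteq> {} \<Longrightarrow> cut (cl A)"
  using cl_increasing by (auto simp: cut_def)
lemma cl_subset_cut: "cut E \<Longrightarrow> cl A \<subseteq> E \<longleftrightarrow> A \<subseteq> E"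
  by (metis cl_increasing cl_mono cut_def subset_trans)
lemma dn_subset_cut: "cut E \<Longrightarrow> dn v \<subseteq> E \<longleftrightarrow> v \<in> E"
  using cut_down by (auto simp: dn_def)
lemma cut_subset_dn: "A \<subseteq> dn v \<longleftrightarrow> v \<in> ub A"
  by (auto simp: dn_def ub_def)

lemma cut_cadd: "cut A \<Longrightarrow> cut B \<Longrightarrow> cut (cadd A B)"
  unfolding cadd_def
proof (rule cut_cl)
  assume A: "cut A" and B: "cut B"
  show "{a + b |a b. a \<in> A \<and> b \<in> B} \<noteq> {}" using A B by (auto simp: cut_def)
  obtain u v where "u \<in> ub A" "v \<in> ub B" using A B by (auto simp: cut_def)
  then have "u + v \<in> ub {a + b |a b. a \<in> A \<and> b \<in> B}" by (auto simp: ub_def intro: le_add)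
  then show "ub {a + b |a b. a \<in> A \<and> b \<in> B} \<noteq> {}" by auto
qed

lemma cadd_subset_iff: "cut E \<Longrightarrow> cadd A B \<subseteq> E \<longleftrightarrow> (\<forall>a\<in>A. \<forall>b\<in>B. a + b \<in> E)"
  unfolding cadd_def cl_subset_cut by auto

lemma cadd_memI: "a \<in> A \<Longrightarrow> b \<in> B \<Longrightarrow> a + b \<in> cadd A B"
  unfolding cadd_def by (rule subsetD[OF cl_increasing]) blast

lemma cadd_commute: "cadd A B = cadd B A"
  unfolding cadd_def by (rule arg_cong[of _ _ cl]) (use add.commute in blast)

text \<open>Subtracting \<open>c\<close> from an upper bound of \<open>E\<close> gives an upper
  bound of \<open>A\<close>, hence of its closure. So a summand may be replaced by its closure,
  which is what associativity of \<open>cadd\<close> rests on.\<close>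

lemma cadd_residual_closed:
  assumes "cut E" "\<forall>a\<in>A. \<forall>c\<in>C. a + c \<in> E" "a \<in> cl A" "c \<in> C"
  shows "a + c \<in> E"
proof -
  have "a + c \<sqsubseteq> u" if u: "u \<in> ub E" for u
  proof -
    have "u - c \<in> ub A"
      unfolding ub_def
    proof safe
      fix a assume "a \<in> A"
      then have "a + c \<sqsubseteq> u" using assms(2,4) u by (auto simp: ub_def)
      then show "a \<sqsubseteq> u - c" by (rule le_cong_diff) (simp add: algebra_simps)
    qed
    then have "a \<sqsubseteq> u - c" using assms(3) by (auto simp: in_cl_iff)
    then show ?thesis by (rule le_cong_diff) (simp add: algebra_simps)
  qed
  then show ?thesis using assms(1) by (simp add: in_cut_iff)
qed

lemma cadd_assoc_subset:
  assumes "cut A" "cut B" "cut C"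
  shows "cadd (cadd A B) C \<subseteq> cadd A (cadd B C)"
proof -
  let ?E = "cadd A (cadd B C)"
  have E: "cut ?E" using assms by (intro cut_cadd)
  have "\<forall>s\<in>{a + b |a b. a \<in> A \<and> b \<in> B}. \<forall>c\<in>C. s + c \<in> ?E"
    using cadd_memI[of _ A _ "cadd B C"] cadd_memI[of _ B _ C] by (fastforce simp: add.assoc)
  then show ?thesis
    unfolding cadd_subset_iff[OF E] using cadd_residual_closed[OF E] unfolding cadd_def[of A B] by blast
qed

lemma cadd_assoc: "cut A \<Longrightarrow> cut B \<Longrightarrow> cut C \<Longrightarrow> cadd (cadd A B) C = cadd A (cadd B C)"
  using cadd_assoc_subset[of A B C] cadd_assoc_subset[of C B A] by (auto simp: cadd_commute)

lemma cadd_zero: "cut A \<Longrightarrow> cadd (dn 0) A = A"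
proof
  assume A: "cut A"
  show "cadd (dn 0) A \<subseteq> A"
    unfolding cadd_subset_iff[OF A]
  proof (intro ballI)
    fix a b assume "a \<in> dn 0" "b \<in> A"
    then show "a + b \<in> A" using cut_down[OF A, of b "a + b"] le_add_right[of a 0 b] by (simp add: dn_def)
  qed
  show "A \<subseteq> cadd (dn 0) A" using cadd_memI[of 0 "dn 0" _ A] by auto
qed

lemma cadd_mono: "cut B \<Longrightarrow> cut C \<Longrightarrow> A \<subseteq> B \<Longrightarrow> cadd A C \<subseteq> cadd B C"
  unfolding cadd_def by (rule cl_mono) blast

lemma cneg_eq_lb: "cneg A = lb (uminus ` A)"
  by (auto simp: cneg_def ub_def lb_def) (metis le_minus_iff minus_minus)+

lemma cut_cneg: "cut A \<Longrightarrow> cut (cneg A)"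
proof -
  assume A: "cut A"
  obtain a u where "a \<in> A" "u \<in> ub A" using A by (auto simp: cut_def)
  then have "- u \<in> cneg A" "- a \<in> ub (cneg A)"
    by (auto simp: cneg_def ub_def) (metis le_minus_iff minus_minus)
  then show ?thesis using cl_lb by (auto simp: cut_def cneg_eq_lb)
qed

lemma ub_cneg: "cut A \<Longrightarrow> ub (cneg A) = {u. - u \<in> A}"
proof -
  assume A: "cut A"
  have "u \<in> ub (cneg A) \<longleftrightarrow> (\<forall>v\<in>ub A. - u \<sqsubseteq> v)" for u
    by (auto simp: ub_def cneg_def) (metis le_minus_iff minus_minus)+
  then show ?thesis using in_cut_iff[OF A] by auto
qed

lemma cneg_cneg: "cut A \<Longrightarrow> cneg (cneg A) = A"
  by (simp add: cneg_def[of "cneg A"] ub_cneg)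

lemma cneg_dn: "cneg (dn v) = dn (- v)"
proof -
  have "v \<sqsubseteq> - w \<longleftrightarrow> w \<sqsubseteq> - v" for w using le_minus_iff[of "- w" v] by simp
  then show ?thesis unfolding cneg_def ub_dn by (simp add: dn_def)
qed

lemma cneg_antimono: "A \<subseteq> B \<Longrightarrow> cneg B \<subseteq> cneg A"
  using ub_antimono by (auto simp: cneg_def)

lemma dn_add: "cadd (dn a) (dn b) = dn (a + b)"
proof
  show "cadd (dn a) (dn b) \<subseteq> dn (a + b)"
    unfolding cadd_subset_iff[OF cut_dn] by (auto simp: dn_def intro: le_add)
  show "dn (a + b) \<subseteq> cadd (dn a) (dn b)"
    unfolding dn_subset_cut[OF cut_cadd[OF cut_dn cut_dn]] by (intro cadd_memI self_in_dn)
qed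

lemma cscal_pos: "0 < c \<Longrightarrow> cscal c A = (\<lambda>v. c *\<^sub>R v) ` A"
proof -
  assume "0 < c"
  then have "v \<in> cscal c A \<longleftrightarrow> v \<in> (\<lambda>v. c *\<^sub>R v) ` A" for v
    using image_eqI[of v "\<lambda>v. c *\<^sub>R v" "(1/c) *\<^sub>R v" A] by (auto simp: cscal_def)
  then show ?thesis by blast
qed

lemma ub_cscal: "0 < c \<Longrightarrow> ub (cscal c A) = (\<lambda>v. c *\<^sub>R v) ` ub A"
proof -
  assume c: "0 < c"
  have "x \<in> ub (cscal c A) \<longleftrightarrow> (1/c) *\<^sub>R x \<in> ub A" for x
    using c le_scaleR_iff[of c _ "(1/c) *\<^sub>R x"] by (auto simp: cscal_pos ub_def)
  moreover have "x \<in> (\<lambda>v. c *\<^sub>R v) ` B \<longleftrightarrow> (1/c) *\<^sub>R x \<in> B" for x and B :: "'v set"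
    using c image_eqI[of x "\<lambda>v. c *\<^sub>R v" "(1/c) *\<^sub>R x" B] by auto
  ultimately show ?thesis by blast
qed

lemma cl_cscal: "0 < c \<Longrightarrow> cl (cscal c A) = cscal c (cl A)"
proof -
  assume c: "0 < c"
  have "x \<in> cl (cscal c A) \<longleftrightarrow> (1/c) *\<^sub>R x \<in> cl A" for x
    using c le_scaleR_iff[of c "(1/c) *\<^sub>R x"] by (auto simp: in_cl_iff ub_cscal)
  then show ?thesis using c by (auto simp: cscal_def)
qed

lemma cscal_0 [simp]: "cscal 0 A = dn 0" by (simp add: cscal_def)
lemma cscal_1 [simp]: "cscal 1 A = A" by (simp add: cscal_def)

lemma cscal_minus: "cscal (- c) A = cneg (cscal c A)" if "cut A"
proof (cases "c = 0")
  case True then show ?thesis by (simp add: cneg_dn)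
next
  case False
  consider "c > 0" | "c < 0" using False by linarith
  then show ?thesis
  proof cases
    case 1
    have "v \<in> cscal (- c) A \<longleftrightarrow> v \<in> cneg (cscal c A)" for v
    proof -
      have "- v \<in> (*\<^sub>R) c ` ub A \<longleftrightarrow> (1/(-c)) *\<^sub>R v \<in> ub A"
      proof
        assume "- v \<in> (*\<^sub>R) c ` ub A"
        then obtain u where u: "u \<in> ub A" "- v = c *\<^sub>R u" by blast
        then have "v = - (c *\<^sub>R u)" by (metis minus_minus)
        then show "(1/(-c)) *\<^sub>R v \<in> ub A" using u 1 by simp
      qed (use 1 image_eqI[of "- v" "(*\<^sub>R) c" "(1/(-c)) *\<^sub>R v" "ub A"] in auto)
      then show ?thesis using 1 ub_cscal[OF 1, of A] by (simp add: cneg_def cscal_def[of "- c"])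
    qed
    then show ?thesis by blast
  next
    case 2
    have *: "cscal c A = cneg (cscal (- c) A)"
    proof -
      have "v \<in> cscal c A \<longleftrightarrow> v \<in> cneg (cscal (-c) A)" for v
      proof -
        have "- v \<in> (*\<^sub>R) (-c) ` ub A \<longleftrightarrow> (1/c) *\<^sub>R v \<in> ub A"
        proof
          assume "- v \<in> (*\<^sub>R) (-c) ` ub A"
          then obtain u where u: "u \<in> ub A" "- v = - (c *\<^sub>R u)" by auto
          then have "v = c *\<^sub>R u" by simp
          then show "(1/c) *\<^sub>R v \<in> ub A" using u 2 by simp
        qed (use 2 image_eqI[of "- v" "(*\<^sub>R) (-c)" "(1/c) *\<^sub>R v" "ub A"] in auto)
        then show ?thesis using 2 ub_cscal[of "- c" A] by (simp add: cneg_def cscal_def[of c])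
      qed
      then show ?thesis by blast
    qed
    have "cut (cscal (-c) A)"
      using 2 that cl_cscal[of "-c" A] ub_cscal[of "-c" A] by (auto simp: cut_def cscal_pos)
    then show ?thesis using * by (simp add: cneg_cneg)
  qed
qed

lemma cut_cscal: "cut A \<Longrightarrow> cut (cscal c A)"
proof -
  assume A: "cut A"
  have *: "cut (cscal c A)" if "0 < c" for c
    using that A cl_cscal[of c A] ub_cscal[of c A] by (auto simp: cut_def cscal_pos)
  consider "c > 0" | "c = 0" | "- c > 0" by linarith
  then show ?thesis
  proof cases
    case 3
    then show ?thesis using cut_cneg[OF *[OF 3]] cscal_minus[OF A, of "- c"] by simp
  qed (use * in auto)
qed

lemma cscal_mono: "0 \<le> c \<Longrightarrow> A \<subseteq> B \<Longrightarrow> cscal c A \<subseteq> cscal c B"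
  by (auto simp: cscal_def)

lemma cscal_add_pos: "cut A \<Longrightarrow> cut B \<Longrightarrow> 0 \<le> c \<Longrightarrow> cscal c (cadd A B) = cadd (cscal c A) (cscal c B)"
proof (cases "c = 0")
  case True
  then show ?thesis by (simp add: dn_add)
next
  case False
  assume "cut A" "cut B" "0 \<le> c"
  then have c: "0 < c" using False by simp
  have "cscal c {a + b |a b. a \<in> A \<and> b \<in> B} = {a + b |a b. a \<in> cscal c A \<and> b \<in> cscal c B}"
    unfolding cscal_pos[OF c]
  proof safe
    fix x y a b assume "a \<in> A" "b \<in> B"
    then show "\<exists>a' b'. c *\<^sub>R (a + b) = a' + b' \<and> a' \<in> (*\<^sub>R) c ` A \<and> b' \<in> (*\<^sub>R) c ` B"
      using scaleR_right_distrib by blast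
    have "c *\<^sub>R a + c *\<^sub>R b = c *\<^sub>R (a + b)" by (simp add: scaleR_right_distrib)
    then show "c *\<^sub>R a + c *\<^sub>R b \<in> (*\<^sub>R) c ` {a + b |a b. a \<in> A \<and> b \<in> B}"
      using \<open>a \<in> A\<close> \<open>b \<in> B\<close> by blast
  qed
  then show ?thesis unfolding cadd_def using cl_cscal[OF c] by metis
qed

text \<open>For \<open>v\<close>, \<open>w\<close> in \<open>A\<close> the vector
  \<open>a v + b w\<close> is not exhibited as a multiple of a member of \<open>A\<close>; it is
  compared with all upper bounds \<open>(a + b) u\<close> instead.\<close>

lemma cscal_plus_pos: assumes A: "cut A" and a: "0 \<le> a" and b: "0 \<le> b"
  shows "cscal (a + b) A = cadd (cscal a A) (cscal b A)"
proof (cases "a = 0 \<or> b = 0")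
  case True
  then show ?thesis using cadd_zero[OF cut_cscal[OF A]] cadd_commute by fastforce
next
  case False
  then have ab: "0 < a" "0 < b" "0 < a + b" using a b by auto
  have E: "cut (cscal (a + b) A)" by (rule cut_cscal[OF A])
  show ?thesis
  proof
    show "cadd (cscal a A) (cscal b A) \<subseteq> cscal (a + b) A"
    proof (unfold cadd_subset_iff[OF E], intro ballI)
      fix x y assume x: "x \<in> cscal a A" and y: "y \<in> cscal b A"
      obtain v w where v: "v \<in> A" "x = a *\<^sub>R v" and w: "w \<in> A" "y = b *\<^sub>R w"
        using x y ab by (auto simp: cscal_pos)
      have "x + y \<sqsubseteq> (a + b) *\<^sub>R u" if "u \<in> ub A" for u
      proof -
        have "v \<sqsubseteq> u" "w \<sqsubseteq> u" using that v w by (auto simp: ub_def)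
        then have "a *\<^sub>R v + b *\<^sub>R w \<sqsubseteq> a *\<^sub>R u + b *\<^sub>R u" using ab by (intro le_add le_scaleR) auto
        then show ?thesis by (simp add: v w scaleR_left_distrib)
      qed
      then show "x + y \<in> cscal (a + b) A"
        using in_cut_iff[OF E] ub_cscal[OF ab(3)] by auto
    qed
    show "cscal (a + b) A \<subseteq> cadd (cscal a A) (cscal b A)"
      using ab by (auto simp: cscal_pos scaleR_left_distrib intro!: cadd_memI)
  qed
qed

lemma cscal_cscal_pos: "0 \<le> a \<Longrightarrow> 0 \<le> b \<Longrightarrow> cut A \<Longrightarrow> cscal a (cscal b A) = cscal (a * b) A"
proof (cases "a = 0 \<or> b = 0")
  case True
  assume "0 \<le> a" "0 \<le> b"
  have "cscal a (dn 0) = dn 0"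
  proof (cases "a = 0")
    case False
    then show ?thesis using \<open>0 \<le> a\<close> le_scaleR_iff[of "1/a" _ 0] by (auto simp: cscal_def dn_def)
  qed simp
  then show ?thesis using True by auto
qed (auto simp: cscal_def mult.commute)

text \<open>With one summand fixed, the inequality can be solved for the other and says that some
  vector is an upper bound of \<open>A\<close>, hence of \<open>cl A\<close>; this is done once for
  each summand. A zero coefficient leaves nothing to solve for, and nonemptiness then provides an
  element to test on.\<close>

lemma cl_combination:
  assumes "v \<in> cl A" "w \<in> cl B" "0 \<le> a" "0 \<le> b"
    and u: "\<And>x y. x \<in> A \<Longrightarrow> y \<in> B \<Longrightarrow> a *\<^sub>R x + b *\<^sub>R y \<sqsubseteq> u" and ne: "A \<noteq> {}" "B \<noteq> {}"
  shows "a *\<^sub>R v + b *\<^sub>R w \<sqsubseteq> u"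
proof -
  have step: "a *\<^sub>R v + t \<sqsubseteq> u" if "v \<in> cl A" "0 \<le> a" "\<And>x. x \<in> A \<Longrightarrow> a *\<^sub>R x + t \<sqsubseteq> u" "A \<noteq> {}" for a v A t
  proof (cases "a = 0")
    case True
    then show ?thesis using that by auto
  next
    case False
    then have a: "0 < a" using that by simp
    have "(1/a) *\<^sub>R (u - t) \<in> ub A"
      unfolding ub_def
    proof safe
      fix x assume "x \<in> A"
      from that(3)[OF this] show "x \<sqsubseteq> (1/a) *\<^sub>R (u - t)"
        by (rule le_cong_scaleR[where t="1/a"]) (use a in \<open>auto simp: algebra_simps\<close>)
    qed
    then have "v \<sqsubseteq> (1/a) *\<^sub>R (u - t)" using that(1) by (simp add: in_cl_iff)
    then show ?thesis
      by (rule le_cong_scaleR[where t=a]) (use a in \<open>auto simp: algebra_simps\<close>)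
  qed
  have "a *\<^sub>R x + b *\<^sub>R w \<sqsubseteq> u" if "x \<in> A" for x
    using step[of w B b "a *\<^sub>R x"] assms that by (auto simp: add.commute)
  then show ?thesis using step[of v A a "b *\<^sub>R w"] assms by auto
qed

end

section \<open>Cuts of a directed Archimedean order form a vector lattice\<close>

locale archimedean_space = preordered_space +
  assumes archimedean: "(\<And>n::nat. x \<sqsubseteq> real n *\<^sub>R w) \<Longrightarrow> 0 \<sqsubseteq> w"
    and directed: "\<exists>u. a \<sqsubseteq> u \<and> b \<sqsubseteq> u"
begin

text \<open>If \<open>w\<close> bounds all differences of a member and an upper bound of
  \<open>A\<close>, then adding \<open>w\<close> to an upper bound of \<open>A\<close> gives an
  upper bound again. Iteration yields \<open>a <= u + n w\<close> for all \<open>n\<close>, and the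
  Archimedean property forces \<open>0 <= w\<close>. Without that property a cut need not have an
  additive inverse.\<close>

lemma cadd_cneg: assumes A: "cut A" shows "cadd A (cneg A) = dn 0"
proof
  show "cadd A (cneg A) \<subseteq> dn 0"
    unfolding cadd_subset_iff[OF cut_dn]
  proof (intro ballI)
    fix a b assume "a \<in> A" "b \<in> cneg A"
    then have "a \<sqsubseteq> - b" by (auto simp: cneg_def ub_def)
    then show "a + b \<in> dn 0" unfolding dn_def mem_Collect_eq by (rule le_cong_diff) simp
  qed
  have "0 \<sqsubseteq> w" if w: "w \<in> ub {a + b |a b. a \<in> A \<and> b \<in> cneg A}" for w
  proof -
    have step: "u + w \<in> ub A" if "u \<in> ub A" for u
      unfolding ub_def
    proof safe
      fix a assume "a \<in> A"
      moreover have "- u \<in> cneg A" using that by (simp add: cneg_def)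
      ultimately have "a + - u \<sqsubseteq> w" using w unfolding ub_def by blast
      then show "a \<sqsubseteq> u + w" by (rule le_cong_diff) (simp add: algebra_simps)
    qed
    obtain a u where a: "a \<in> A" and u: "u \<in> ub A" using A by (auto simp: cut_def)
    have "u + real n *\<^sub>R w \<in> ub A" for n
    proof (induction n)
      case (Suc n)
      then show ?case using step[OF Suc] by (simp add: algebra_simps)
    qed (use u in simp)
    then have *: "a \<sqsubseteq> u + real n *\<^sub>R w" for n using a unfolding ub_def by blast
    have "a - u \<sqsubseteq> real n *\<^sub>R w" for n
      using *[of n] by (rule le_cong_diff) (simp add: algebra_simps)
    then show ?thesis by (rule archimedean)
  qed
  then have "0 \<in> cadd A (cneg A)" by (simp add: cadd_def in_cl_iff)
  then show "dn 0 \<subseteq> cadd A (cneg A)"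
    using dn_subset_cut[OF cut_cadd[OF A cut_cneg[OF A]]] by blast
qed

lemma cadd_left_cancel: 
  assumes "cut A" "cut B" shows "cadd (cneg A) (cadd A B) = B"
proof -
  have "cadd (cneg A) (cadd A B) = cadd (cadd (cneg A) A) B" using assms by (simp add: cadd_assoc cut_cneg)
  also have "cadd (cneg A) A = dn 0" using cadd_cneg[OF assms(1)] by (simp add: cadd_commute)
  finally show ?thesis using assms by (simp add: cadd_zero)
qed

lemma cneg_unique: "cut A \<Longrightarrow> cut B \<Longrightarrow> cadd A B = dn 0 \<Longrightarrow> B = cneg A"
  using cadd_left_cancel[of A B] cadd_zero[of "cneg A"] by (simp add: cut_cneg cadd_commute[of "cneg A"])

lemma cadd_cadd_swap: 
  assumes "cut A" "cut B" "cut C" "cut D"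
  shows "cadd (cadd A B) (cadd C D) = cadd (cadd A C) (cadd B D)"
proof -
  have "cadd (cadd A B) (cadd C D) = cadd A (cadd B (cadd C D))" using assms by (simp add: cadd_assoc cut_cadd)
  also have "cadd B (cadd C D) = cadd (cadd B C) D" using assms by (simp add: cadd_assoc)
  also have "cadd B C = cadd C B" by (rule cadd_commute)
  also have "cadd (cadd C B) D = cadd C (cadd B D)" using assms by (simp add: cadd_assoc)
  also have "cadd A \<dots> = cadd (cadd A C) (cadd B D)" using assms by (simp add: cadd_assoc cut_cadd)
  finally show ?thesis .
qed

lemma cneg_cadd: assumes "cut A" "cut B" shows "cneg (cadd A B) = cadd (cneg A) (cneg B)"
proof -
  have "cadd (cadd A B) (cadd (cneg A) (cneg B)) = dn 0"
    using assms cadd_cadd_swap[OF assms cut_cneg[OF assms(1)] cut_cneg[OF assms(2)]]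
    by (simp add: cadd_cneg dn_add)
  then show ?thesis using assms by (intro cneg_unique[symmetric]) (auto intro: cut_cadd cut_cneg)
qed

lemma cscal_add: assumes "cut A" "cut B" shows "cscal c (cadd A B) = cadd (cscal c A) (cscal c B)"
proof (cases "0 \<le> c")
  case False
  then show ?thesis using assms cscal_minus[of _ "- c"] cscal_add_pos[of A B "- c"]
    by (simp add: cut_cadd cneg_cadd cut_cscal)
qed (use assms cscal_add_pos in auto)

text \<open>Mixed signs are reduced to \<open>cscal_plus_pos\<close> by moving the negative term
  across, as in \<open>a = (a + b) + (- b)\<close>, and cancelling; a negative total is handled by
  negation.\<close>

lemma cscal_plus: assumes A: "cut A" shows "cscal (a + b) A = cadd (cscal a A) (cscal b A)"
proof -
  note cs = cut_cscal[OF A]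
  have 1: "cscal (a + b) A = cadd (cscal a A) (cscal b A)" if "0 \<le> a + b" "0 \<le> a" for a b
  proof (cases "0 \<le> b")
    case False
    then have "cscal ((a + b) + (- b)) A = cadd (cscal (a + b) A) (cscal (- b) A)"
      using that by (intro cscal_plus_pos[OF A]) auto
    then have "cadd (cscal a A) (cscal b A) = cadd (cneg (cscal (- b) A)) (cadd (cscal (- b) A) (cscal (a + b) A))"
      using cscal_minus[OF A, of "- b"] by (simp add: cadd_commute)
    then show ?thesis using cadd_left_cancel cs by simp
  qed (use that cscal_plus_pos[OF A] in auto)
  have 2: "cscal (a + b) A = cadd (cscal a A) (cscal b A)" if "0 \<le> a + b" for a b
    using 1[of a b] 1[of b a] that by (cases "0 \<le> a") (auto simp: cadd_commute add.commute)
  show ?thesis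
  proof (cases "0 \<le> a + b")
    case False
    then have "cneg (cscal (- a + - b) A) = cneg (cadd (cscal (- a) A) (cscal (- b) A))"
      using 2[of "-a" "-b"] by simp
    then show ?thesis
      using cscal_minus[OF A, of "- a + - b"] cscal_minus[OF A, of "- a"] cscal_minus[OF A, of "- b"] cs
      by (simp add: cneg_cadd add.commute)
  qed (rule 2)
qed

lemma cscal_cscal: assumes A: "cut A" shows "cscal a (cscal b A) = cscal (a * b) A"
proof -
  note cs = cut_cscal[OF A]
  have neg: "cscal a (cneg B) = cneg (cscal a B)" if "cut B" for a B
  proof -
    have "cadd (cscal a B) (cscal a (cneg B)) = cscal a (dn 0)"
      using that by (simp add: cscal_add[symmetric] cut_cneg cadd_cneg)
    also have "\<dots> = dn 0"
      using cscal_add[of "dn 0" "dn 0" a] cadd_left_cancel[of "cscal a (dn 0)" "cscal a (dn 0)"]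
      by (simp add: cut_cscal dn_add cadd_cneg cadd_commute[of "cneg _"])
    finally show ?thesis using that by (intro cneg_unique) (auto intro: cut_cscal cut_cneg)
  qed
  have 1: "cscal a (cscal b A) = cscal (a * b) A" if "0 \<le> a" for a
  proof (cases "0 \<le> b")
    case False
    have "cscal a (cscal b A) = cneg (cscal a (cscal (- b) A))"
      using neg[OF cs, of a "- b"] cscal_minus[OF A, of "- b"] by simp
    also have "\<dots> = cneg (cscal (a * (- b)) A)" using False that A by (simp add: cscal_cscal_pos)
    finally show ?thesis using cscal_minus[OF A, of "a * (- b)"] by simp
  qed (use that A cscal_cscal_pos in auto)
  show ?thesis
  proof (cases "0 \<le> a")
    case False
    then show ?thesis using 1[of "- a"] cscal_minus[OF cs, of "- a" b] cscal_minus[OF A, of "- a * b"] by simp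
  qed (rule 1)
qed

lemma cut_Sup: 
  assumes "\<And>A. A \<in> \<A> \<Longrightarrow> cut A" "\<A> \<noteq> {}" "cut E" "\<And>A. A \<in> \<A> \<Longrightarrow> A \<subseteq> E"
  shows "cut (cl (\<Union>\<A>))"
proof (rule cut_cl)
  show "\<Union>\<A> \<noteq> {}" using assms(1,2) by (force simp: cut_def)
  have "ub E \<subseteq> ub (\<Union>\<A>)" using assms(4) by (intro ub_antimono) auto
  then show "ub (\<Union>\<A>) \<noteq> {}" using assms(3) by (auto simp: cut_def)
qed

lemma cut_join: assumes A: "cut A" and B: "cut B" shows "cut (cl (A \<union> B))"
proof -
  obtain a b u where u: "a \<in> ub A" "b \<in> ub B" "a \<sqsubseteq> u" "b \<sqsubseteq> u"
  proof -
    obtain a b where "a \<in> ub A" "b \<in> ub B" using A B by (auto simp: cut_def)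
    then show thesis using that directed[of a b] by blast
  qed
  have "u \<in> ub (A \<union> B)"
    unfolding ub_def using u le_trans[OF _ u(3)] le_trans[OF _ u(4)] by (auto simp: ub_def)
  then show ?thesis using A by (intro cut_cl) (auto simp: cut_def)
qed

text \<open>Moving a summand across an inequality, as in any ordered group. Distances between cuts
  are estimated in this form throughout.\<close>

lemma cadd_cneg_subset_iff: assumes A: "cut A" and B: "cut B" and E: "cut E"
  shows "cadd A (cneg B) \<subseteq> E \<longleftrightarrow> A \<subseteq> cadd E B"
proof
  note nB = cut_cneg[OF B]
  assume "cadd A (cneg B) \<subseteq> E"
  then have "cadd (cadd A (cneg B)) B \<subseteq> cadd E B" by (rule cadd_mono[OF E B])
  moreover have "cadd B (cadd (cneg B) A) = A"
    using cadd_left_cancel[OF nB A] unfolding cneg_cneg[OF B] .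
  moreover have "cadd (cadd A (cneg B)) B = cadd B (cadd (cneg B) A)"
    by (metis cadd_commute)
  ultimately show "A \<subseteq> cadd E B" by simp
next
  note nB = cut_cneg[OF B]
  assume "A \<subseteq> cadd E B"
  then have "cadd A (cneg B) \<subseteq> cadd (cadd E B) (cneg B)" by (rule cadd_mono[OF cut_cadd[OF E B] nB])
  moreover have "cadd (cadd E B) (cneg B) = cadd (cneg B) (cadd B E)"
    by (metis cadd_commute)
  ultimately show "cadd A (cneg B) \<subseteq> E" using cadd_left_cancel[OF B E] by simp
qed

end

section \<open>Seminormed lattices\<close>

lemma abs_le_1_if_powr_le_1: "\<bar>c\<bar> \<le> 1" if "\<bar>c\<bar> powr q \<le> 1" "0 < q" for c q :: real
proof (rule ccontr)
  assume "\<not> \<bar>c\<bar> \<le> 1"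
  then have "1 powr q < \<bar>c\<bar> powr q" using that by (intro powr_less_mono2) auto
  then show False using that by simp
qed

text \<open>A Banach lattice up to the kernel of its norm. Since \<open>nm (- x) = nm x\<close>, the
  axiom \<open>nm_zero_le\<close> applies to \<open>x\<close> and \<open>- x\<close> and makes
  vectors of norm 0 order-equivalent to 0. Meets are written as negated joins of negatives.\<close>

locale seminormed_lattice = preordered_space +
  fixes jn :: "'a::real_vector \<Rightarrow> 'a \<Rightarrow> 'a" and nm :: "'a \<Rightarrow> real"
  assumes jn_ub1: "x \<sqsubseteq> jn x y" and jn_ub2: "y \<sqsubseteq> jn x y"
    and jn_least: "x \<sqsubseteq> z \<Longrightarrow> y \<sqsubseteq> z \<Longrightarrow> jn x y \<sqsubseteq> z"
    and nm_scaleR: "nm (c *\<^sub>R x) = \<bar>c\<bar> * nm x"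
    and nm_triangle: "nm (x + y) \<le> nm x + nm y"
    and nm_mono_abs: "jn x (- x) \<sqsubseteq> jn y (- y) \<Longrightarrow> nm x \<le> nm y"
    and nm_zero_le: "nm x = 0 \<Longrightarrow> x \<sqsubseteq> 0"
    and nm_complete: "(\<And>e. 0 < e \<Longrightarrow> \<exists>N. \<forall>m\<ge>N. \<forall>n\<ge>N. nm (s m - s n) < e) \<Longrightarrow>
       \<exists>x. (\<lambda>n. nm (s n - x)) \<longlonglongrightarrow> 0"
begin

abbreviation pp :: "'a \<Rightarrow> 'a" where "pp x \<equiv> jn x 0"
abbreviation ab :: "'a \<Rightarrow> 'a" where "ab x \<equiv> jn x (- x)"

lemma nm_0 [simp]: "nm 0 = 0" using nm_scaleR[of 0 0] by simp
lemma nm_minus: "nm (- x) = nm x" using nm_scaleR[of "-1" x] by simp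
lemma nm_nonneg [simp]: "0 \<le> nm x"
  using nm_triangle[of x "- x"] by (simp add: nm_minus)
lemma nm_diff: "nm (x - y) \<le> nm x + nm y" using nm_triangle[of x "- y"] by (simp add: nm_minus)
lemma nm_sum: "nm (\<Sum>i\<in>I. f i) \<le> (\<Sum>i\<in>I. nm (f i))"
  by (induction I rule: infinite_finite_induct) (auto intro: order_trans[OF nm_triangle])

lemma ab_pos: "0 \<sqsubseteq> ab x"
proof -
  have "x + - x \<sqsubseteq> ab x + ab x" by (intro le_add jn_ub1 jn_ub2)
  then show ?thesis by (rule le_cong_scaleR[where t="1/2"]) (auto simp: algebra_simps scaleR_left_distrib[symmetric])
qed

lemma ab_le: "- y \<sqsubseteq> x \<Longrightarrow> x \<sqsubseteq> y \<Longrightarrow> ab x \<sqsubseteq> y"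
  using le_minus_iff[of x "- y"] by (intro jn_least) auto

lemma nm_mono: "- y \<sqsubseteq> x \<Longrightarrow> x \<sqsubseteq> y \<Longrightarrow> nm x \<le> nm y"
  by (rule nm_mono_abs) (rule le_trans[OF ab_le jn_ub1])

lemma nm_mono_pos: "0 \<sqsubseteq> x \<Longrightarrow> x \<sqsubseteq> y \<Longrightarrow> nm x \<le> nm y"
proof (rule nm_mono)
  assume "0 \<sqsubseteq> x" "x \<sqsubseteq> y"
  then have "0 \<sqsubseteq> y" by (rule le_trans)
  then have "- y \<sqsubseteq> 0" using le_minus_iff[of y 0] by simp
  then show "- y \<sqsubseteq> x" using \<open>0 \<sqsubseteq> x\<close> by (rule le_trans)
qed

lemma neg_ab_le: "- ab x \<sqsubseteq> x"
  using le_minus_iff[of "ab x" "- x"] jn_ub2[of "- x" x] by simp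

lemma nm_ab: "nm (ab x) = nm x"
proof (rule antisym)
  show "nm x \<le> nm (ab x)" by (rule nm_mono) (auto intro: jn_ub1 neg_ab_le)
  show "nm (ab x) \<le> nm x"
  proof (rule nm_mono_abs, rule ab_le)
    show "- ab x \<sqsubseteq> ab x" using le_minus_iff[of "ab x" 0] ab_pos[of x] by (auto elim: le_trans)
  qed simp
qed

lemma pp_mono: "x \<sqsubseteq> y \<Longrightarrow> pp x \<sqsubseteq> pp y"
  by (rule jn_least) (auto intro: jn_ub2 le_trans[OF _ jn_ub1])

text \<open>The positive cone is norm closed: \<open>x <= d\<close> gives that the positive part of
  \<open>x\<close> lies below the absolute value of \<open>d\<close>, so its norm is at most every
  \<open>e\<close>.\<close>

lemma le_closed: 
  assumes "\<And>e. 0 < e \<Longrightarrow> \<exists>d. x \<sqsubseteq> d \<and> nm d \<le> e" shows "x \<sqsubseteq> 0"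
proof -
  have "nm (pp x) \<le> 0 + e" if e: "0 < e" for e
  proof -
    obtain d where d: "x \<sqsubseteq> d" "nm d \<le> e" using assms e by blast
    have "pp x \<sqsubseteq> ab d" by (rule jn_least) (auto intro: ab_pos le_trans[OF d(1) jn_ub1])
    then have "nm (pp x) \<le> nm (ab d)" by (intro nm_mono_pos jn_ub2)
    then show ?thesis using d(2) by (simp add: nm_ab)
  qed
  then have "nm (pp x) \<le> 0" by (rule field_le_epsilon)
  then have "nm (pp x) = 0" using nm_nonneg[of "pp x"] by linarith
  then have "pp x \<sqsubseteq> 0" by (rule nm_zero_le)
  then show ?thesis by (rule le_trans[OF jn_ub1])
qed

lemma le_limit:
  assumes "\<And>n. x \<sqsubseteq> s n" "(\<lambda>n. nm (s n - y)) \<longlonglongrightarrow> 0" shows "x \<sqsubseteq> y"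
proof -
  have "x - y \<sqsubseteq> 0"
  proof (rule le_closed)
    fix e :: real assume "0 < e"
    then obtain n where "nm (s n - y) < e"
      using eventually_happens[OF order_tendstoD(2)[OF assms(2)]] by auto
    moreover have "x - y \<sqsubseteq> s n - y" using assms(1)[of n] by (rule le_cong_diff) simp
    ultimately show "\<exists>d. x - y \<sqsubseteq> d \<and> nm d \<le> e" by (meson less_imp_le)
  qed
  then show ?thesis by (rule le_cong_diff) simp
qed

lemma limit_le:
  assumes "\<And>n. s n \<sqsubseteq> y" "(\<lambda>n. nm (s n - x)) \<longlonglongrightarrow> 0" shows "x \<sqsubseteq> y"
proof -
  have "- y \<sqsubseteq> - x"
  proof (rule le_limit)
    show "- y \<sqsubseteq> - s n" for n using assms(1) by (simp add: le_minus_iff)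
    have "nm (- s n - - x) = nm (s n - x)" for n using nm_minus[of "s n - x"] by simp
    then show "(\<lambda>n. nm (- s n - - x)) \<longlonglongrightarrow> 0" using assms(2) by simp
  qed
  then show ?thesis by (simp add: le_minus_iff)
qed

text \<open>Stated without a meet: the infimum of \<open>x\<close> and \<open>y\<close> is at most
  0. For positive elements this is the usual disjointness, and being one-sided it passes to smaller
  elements.\<close>

definition disj :: "'a \<Rightarrow> 'a \<Rightarrow> bool" where
  "disj x y \<longleftrightarrow> (\<forall>w. w \<sqsubseteq> x \<longrightarrow> w \<sqsubseteq> y \<longrightarrow> w \<sqsubseteq> 0)"

lemma disj_mono: "disj x y \<Longrightarrow> x' \<sqsubseteq> x \<Longrightarrow> y' \<sqsubseteq> y \<Longrightarrow> disj x' y'"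
  unfolding disj_def using le_trans by blast

text \<open>The negative part of \<open>v\<close> is at most \<open>pp v - v\<close>. Hence a common
  lower bound \<open>w\<close> satisfies both \<open>v <= pp v - w\<close> and
  \<open>0 <= pp v - w\<close>, so \<open>pp v <= pp v - w\<close>.\<close>

lemma disj_pp: "disj (pp v) (pp (- v))"
  unfolding disj_def
proof (intro allI impI)
  fix w assume w: "w \<sqsubseteq> pp v" "w \<sqsubseteq> pp (- v)"
  have "pp (- v) \<sqsubseteq> pp v - v"
  proof (rule jn_least)
    show "- v \<sqsubseteq> pp v - v" using jn_ub2[of 0 v] by (rule le_cong_diff) simp
    show "0 \<sqsubseteq> pp v - v" using jn_ub1[of v 0] by (rule le_cong_diff) simp
  qed
  with w(2) have *: "w \<sqsubseteq> pp v - v" by (rule le_trans)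
  have "pp v \<sqsubseteq> pp v - w"
  proof (rule jn_least)
    show "v \<sqsubseteq> pp v - w" using * by (rule le_cong_diff) simp
    show "0 \<sqsubseteq> pp v - w" using w(1) by (rule le_cong_diff) simp
  qed
  then show "w \<sqsubseteq> 0" by (rule le_cong_diff) simp
qed

text \<open>The vector \<open>u - a\<close> lies below \<open>b\<close> and, as \<open>a\<close> is
  positive, below \<open>u\<close>; disjointness makes it nonpositive.\<close>

lemma disj_absorb: "u \<sqsubseteq> a + b \<Longrightarrow> 0 \<sqsubseteq> a \<Longrightarrow> disj u b \<Longrightarrow> u \<sqsubseteq> a"
proof -
  assume h: "u \<sqsubseteq> a + b" "0 \<sqsubseteq> a" "disj u b"
  have "u - a \<sqsubseteq> b" using h(1) by (rule le_cong_diff) simp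
  moreover have "u - a \<sqsubseteq> u" using h(2) by (rule le_cong_diff) simp
  ultimately have "u - a \<sqsubseteq> 0" using h(3) unfolding disj_def by blast
  then show ?thesis by (rule le_cong_diff) simp
qed

lemma finite_lub:
  assumes "finite F" "F \<noteq> {}"
  shows "\<exists>z. F \<subseteq> dn z \<and> (\<forall>w. F \<subseteq> dn w \<longrightarrow> z \<sqsubseteq> w)"
  using assms
proof (induction F rule: finite_ne_induct)
  case (singleton x)
  show ?case by (rule exI[of _ x]) (auto simp: dn_def)
next
  case (insert x F)
  then obtain z where z: "F \<subseteq> dn z" "\<forall>w. F \<subseteq> dn w \<longrightarrow> z \<sqsubseteq> w" by blast
  have "F \<subseteq> dn (jn x z)" using z(1) le_trans[OF _ jn_ub2[of z x]] by (auto simp: dn_def)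
  then show ?case using z(2) by (intro exI[of _ "jn x z"]) (auto simp: dn_def intro: jn_ub1 jn_least)
qed

text \<open>Each \<open>z k\<close> is below every upper bound of \<open>S\<close>, in particular
  below \<open>z m + e / (m + 1)\<close>. So the sequence is Cauchy at a rate given by
  \<open>e\<close>, and closedness of the order makes its limit the supremum.\<close>

lemma approx_lub:
  assumes S: "\<And>m s. s \<in> S \<Longrightarrow> s \<sqsubseteq> z m + (1 / real (Suc m)) *\<^sub>R e"
    and z: "\<And>m w. S \<subseteq> dn w \<Longrightarrow> z m \<sqsubseteq> w" and e: "0 \<sqsubseteq> e"
  shows "\<exists>l. S \<subseteq> dn l \<and> (\<forall>w. S \<subseteq> dn w \<longrightarrow> l \<sqsubseteq> w)"
proof -
  have zz: "z k \<sqsubseteq> z m + (1 / real (Suc m)) *\<^sub>R e" for k m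
    using S by (intro z) (auto simp: dn_def)
  have e_mono: "(1 / real (Suc m)) *\<^sub>R e \<sqsubseteq> (1 / real (Suc N)) *\<^sub>R e" if "N \<le> m" for m N
    using e by (rule le_cong_scaleR[where t="1 / real (Suc N) - 1 / real (Suc m)"])
      (use that in \<open>simp_all add: frac_le algebra_simps\<close>)
  have up: "z k - z m \<sqsubseteq> (1 / real (Suc N)) *\<^sub>R e" if "N \<le> m" for N k m
    using zz[of k m] e_mono[OF that] by (rule le_cong_diff2) (simp add: algebra_simps)
  have nmz: "nm (z k - z m) \<le> nm e / real (Suc N)" if "N \<le> m" "N \<le> k" for k m N
  proof -
    have "- ((1 / real (Suc N)) *\<^sub>R e) \<sqsubseteq> z k - z m"
      using up[OF that(2), of m] le_minus_iff[of "(1 / real (Suc N)) *\<^sub>R e" "z m - z k"] by simp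
    then have "nm (z k - z m) \<le> nm ((1 / real (Suc N)) *\<^sub>R e)" using up[OF that(1)] by (rule nm_mono)
    then show ?thesis by (simp add: nm_scaleR)
  qed
  have lim0: "(\<lambda>N. nm e / real (Suc N)) \<longlonglongrightarrow> 0"
    using LIMSEQ_Suc[OF tendsto_divide_0[OF tendsto_const filterlim_at_top_imp_at_infinity[OF filterlim_real_sequentially]]] .
  obtain l where l: "(\<lambda>n. nm (z n - l)) \<longlonglongrightarrow> 0"
  proof (atomize_elim, rule nm_complete)
    fix d :: real assume "0 < d"
    then obtain N where "nm e / real (Suc N) < d"
      using eventually_happens[OF order_tendstoD(2)[OF lim0]] by auto
    then show "\<exists>N. \<forall>m\<ge>N. \<forall>n\<ge>N. nm (z m - z n) < d" using nmz by (meson le_less_trans)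
  qed
  have "s \<sqsubseteq> l" if "s \<in> S" for s
  proof (rule le_limit)
    show "s \<sqsubseteq> z n + (1 / real (Suc n)) *\<^sub>R e" for n by (rule S[OF that])
    have "nm (z n + (1 / real (Suc n)) *\<^sub>R e - l) \<le> nm (z n - l) + nm e / real (Suc n)" for n
      using nm_triangle[of "z n - l" "(1 / real (Suc n)) *\<^sub>R e"] by (simp add: nm_scaleR algebra_simps)
    then have "\<forall>\<^sub>F n in sequentially. norm (nm (z n + (1 / real (Suc n)) *\<^sub>R e - l)) \<le> nm (z n - l) + nm e / real (Suc n)"
      by simp
    then show "(\<lambda>n. nm (z n + (1 / real (Suc n)) *\<^sub>R e - l)) \<longlonglongrightarrow> 0"
      by (rule Lim_null_comparison) (use tendsto_add[OF l lim0] in simp)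
  qed
  moreover have "l \<sqsubseteq> w" if "S \<subseteq> dn w" for w
    using z[OF that] l by (rule limit_le)
  ultimately show ?thesis by (intro exI[of _ l]) (auto simp: dn_def)
qed

text \<open>\<open>p_sum\<close> is a definite description, so p-convexity says something only once
  the supremum is known to exist. Norm completeness provides it: finitely many grid coefficients
  approximate all of them uniformly.\<close>

lemma q_combination_lub:
  assumes x: "0 \<sqsubseteq> x" and y: "0 \<sqsubseteq> y" and q: "0 < q"
  defines "S \<equiv> {a *\<^sub>R x + b *\<^sub>R y | a b. \<bar>a\<bar> powr q + \<bar>b\<bar> powr q \<le> 1}"
  shows "\<exists>l. S \<subseteq> dn l \<and> (\<forall>w. S \<subseteq> dn w \<longrightarrow> l \<sqsubseteq> w)"
proof -
  \<comment> \<open>Rounding towards zero keeps the coefficients admissible. The error has to be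
    bounded only from above, since \<open>x\<close> and \<open>y\<close> are positive.\<close>
  define tr where "tr m a = (if 0 \<le> a then 1 else -1) * real_of_int \<lfloor>\<bar>a\<bar> * real (Suc m)\<rfloor> / real (Suc m)" for m and a :: real
  have tr1: "\<bar>tr m a\<bar> \<le> \<bar>a\<bar>" and tr2: "a - tr m a \<le> 1 / real (Suc m)" for m a
  proof -
    define f where "f = real_of_int \<lfloor>\<bar>a\<bar> * real (Suc m)\<rfloor> / real (Suc m)"
    have N: "0 < real (Suc m)" by simp
    have "real_of_int \<lfloor>\<bar>a\<bar> * real (Suc m)\<rfloor> \<le> \<bar>a\<bar> * real (Suc m)"
      "\<bar>a\<bar> * real (Suc m) \<le> real_of_int \<lfloor>\<bar>a\<bar> * real (Suc m)\<rfloor> + 1" by linarith+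
    then have "f \<le> \<bar>a\<bar>" "\<bar>a\<bar> \<le> f + 1 / real (Suc m)"
      using N by (simp_all only: f_def pos_divide_le_eq pos_le_divide_eq add_divide_distrib[symmetric])
    moreover have "tr m a = (if 0 \<le> a then f else - f)" by (simp add: tr_def f_def)
    moreover have "0 \<le> f" "0 \<le> 1 / real (Suc m)" by (simp_all add: f_def)
    ultimately show "\<bar>tr m a\<bar> \<le> \<bar>a\<bar>" "a - tr m a \<le> 1 / real (Suc m)"
      by (auto split: if_splits)
  qed
  define grid where "grid m = (\<lambda>i. real_of_int i / real (Suc m)) ` {- int (Suc m)..int (Suc m)}" for m
  have tr_grid: "tr m a \<in> grid m" if "\<bar>a\<bar> \<le> 1" for m a
  proof -
    define i where "i = \<lfloor>\<bar>a\<bar> * real (Suc m)\<rfloor>"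
    have "\<bar>a\<bar> * real (Suc m) \<le> 1 * real (Suc m)" using that by (intro mult_right_mono) auto
    from floor_mono[OF this] have "i \<le> int (Suc m)" unfolding i_def by (simp only: mult_1 floor_of_nat)
    moreover have "0 \<le> i" unfolding i_def by simp
    moreover have "tr m a = real_of_int (if 0 \<le> a then i else - i) / real (Suc m)"
      by (simp add: tr_def i_def)
    ultimately show ?thesis unfolding grid_def by (intro image_eqI) auto
  qed
  define F where "F m = {a *\<^sub>R x + b *\<^sub>R y | a b. a \<in> grid m \<and> b \<in> grid m \<and> \<bar>a\<bar> powr q + \<bar>b\<bar> powr q \<le> 1}" for m
  have "finite (F m)" for m
  proof (rule finite_subset)
    show "F m \<subseteq> (\<lambda>(a,b). a *\<^sub>R x + b *\<^sub>R y) ` (grid m \<times> grid m)" by (auto simp: F_def)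
    show "finite ((\<lambda>(a,b). a *\<^sub>R x + b *\<^sub>R y) ` (grid m \<times> grid m))" by (simp add: grid_def)
  qed
  moreover have "0 \<in> F m" for m
    unfolding F_def grid_def by (auto intro!: exI[of _ 0] image_eqI[where x=0])
  ultimately have "\<exists>z. F m \<subseteq> dn z \<and> (\<forall>w. F m \<subseteq> dn w \<longrightarrow> z \<sqsubseteq> w)" for m
    by (intro finite_lub) auto
  then obtain z where z: "\<And>m. F m \<subseteq> dn (z m)" "\<And>m w. F m \<subseteq> dn w \<Longrightarrow> z m \<sqsubseteq> w" by metis
  show ?thesis
  proof (rule approx_lub)
    show "0 \<sqsubseteq> x + y" using le_add[OF x y] by simp
    fix m
    have "F m \<subseteq> S" by (auto simp: F_def S_def)
    then show "z m \<sqsubseteq> w" if "S \<subseteq> dn w" for w using z(2) that by blast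
    fix s assume "s \<in> S"
    then obtain a b where ab: "s = a *\<^sub>R x + b *\<^sub>R y" "\<bar>a\<bar> powr q + \<bar>b\<bar> powr q \<le> 1" by (auto simp: S_def)
    have "\<bar>a\<bar> powr q \<le> 1" "\<bar>b\<bar> powr q \<le> 1"
      using ab(2) powr_ge_zero[of "\<bar>a\<bar>" q] powr_ge_zero[of "\<bar>b\<bar>" q] by linarith+
    then have ab1: "\<bar>a\<bar> \<le> 1" "\<bar>b\<bar> \<le> 1" using abs_le_1_if_powr_le_1 q by blast+
    have "\<bar>tr m a\<bar> powr q \<le> \<bar>a\<bar> powr q" "\<bar>tr m b\<bar> powr q \<le> \<bar>b\<bar> powr q"
      using tr1 q by (auto intro!: powr_mono2)
    then have "tr m a *\<^sub>R x + tr m b *\<^sub>R y \<in> F m"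
      using tr_grid ab1 ab(2) unfolding F_def mem_Collect_eq
      by (intro exI[of _ "tr m a"] exI[of _ "tr m b"]) auto
    then have 1: "tr m a *\<^sub>R x + tr m b *\<^sub>R y \<sqsubseteq> z m" using z(1) by (auto simp: dn_def)
    have "0 + 0 \<sqsubseteq> (1 / real (Suc m) - (a - tr m a)) *\<^sub>R x + (1 / real (Suc m) - (b - tr m b)) *\<^sub>R y"
      using x y tr2 le_scaleR[OF _ x] le_scaleR[OF _ y] by (intro le_add) (metis diff_ge_0_iff_ge scaleR_zero_right)+
    from 1 this show "s \<sqsubseteq> z m + (1 / real (Suc m)) *\<^sub>R (x + y)"
      by (rule le_cong_diff2) (simp add: ab(1) algebra_simps)
  qed
qed

text \<open>Cutting \<open>h = jn x y\<close> near the level \<open>n\<^sup>2 (x - y) = (i + 1) h\<close> leaves disjoint pieces \<open>s (i + 1)\<close> and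
  \<open>t i\<close> that are bounded by \<open>x\<close> and almost by \<open>y\<close>. What is lost at the cut telescopes, so its average over
  \<open>i < n\<close> is of order \<open>1/n\<close>.\<close>

lemma disjoint_upper_estimate_imp_sup:
  assumes p: "0 < p"
    and up: "\<And>x y. 0 \<sqsubseteq> x \<Longrightarrow> 0 \<sqsubseteq> y \<Longrightarrow> disj x y \<Longrightarrow> nm (x + y) powr p \<le> nm x powr p + nm y powr p"
    and x: "0 \<sqsubseteq> x" and y: "0 \<sqsubseteq> y"
  shows "nm (jn x y) powr p \<le> nm x powr p + nm y powr p"
proof -
  define h where "h = jn x y"
  have h: "x \<sqsubseteq> h" "y \<sqsubseteq> h" by (auto simp: h_def intro: jn_ub1 jn_ub2)
  have h0: "0 \<sqsubseteq> h" using x h(1) by (rule le_trans)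
  define M where "M n = (nm x powr p + (nm y + nm h / real n) powr p) powr (1/p)" for n :: nat
  have main: "nm h \<le> M n + nm h / real n" if n: "1 \<le> n" for n :: nat
  proof -
    \<comment> \<open>The square makes \<open>(i + 1) / k\<close> at most \<open>1 / n\<close> for
      \<open>i < n\<close>, so that \<open>t i\<close> exceeds \<open>y\<close> by no more than
      \<open>h / n\<close>.\<close>
    define k where "k = real n ^ 2"
    have k1: "1 \<le> k" using n by (simp add: k_def)
    define z where "z = k *\<^sub>R (x - y)"
    define P where "P i = pp (z - real i *\<^sub>R h)" for i
    \<comment> \<open>This is the infimum of \<open>h\<close> and \<open>P i\<close>; accordingly
      \<open>t i\<close> below is the positive part of \<open>h - P i\<close>.\<close>
    define s where "s i = - jn (- h) (- P i)" for i
    define t where "t i = h - s i" for i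
    have P0: "0 \<sqsubseteq> P i" for i unfolding P_def by (rule jn_ub2)
    have sh: "s i \<sqsubseteq> h" for i using jn_ub1[of "- h" "- P i"] by (rule le_cong_diff) (simp add: s_def)
    have sP: "s i \<sqsubseteq> P i" for i using jn_ub2[of "- P i" "- h"] by (rule le_cong_diff) (simp add: s_def)
    have s0: "0 \<sqsubseteq> s i" for i
    proof -
      have "jn (- h) (- P i) \<sqsubseteq> 0"
        using h0 P0[of i] le_minus_iff[of h 0] le_minus_iff[of "P i" 0] by (intro jn_least) auto
      then show ?thesis by (rule le_cong_diff) (simp add: s_def)
    qed
    have t0: "0 \<sqsubseteq> t i" for i using sh[of i] by (rule le_cong_diff) (simp add: t_def)
    have th: "t i \<sqsubseteq> h" for i using s0[of i] by (rule le_cong_diff) (simp add: t_def)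
    \<comment> \<open>As \<open>P i\<close> is at least \<open>z - i h\<close>, the difference
      \<open>h - P i\<close> is at most \<open>(i + 1) h - z\<close>. So \<open>t i\<close> sits
      below a negative part whose positive part dominates \<open>s (i + 1)\<close>: hence the shift
      of the index in the disjoint pair.\<close>
    have tP: "t i \<sqsubseteq> pp (- (z - real (Suc i) *\<^sub>R h))" for i
    proof -
      let ?Q = "pp (- (z - real (Suc i) *\<^sub>R h))"
      have "jn (- h) (- P i) \<sqsubseteq> ?Q - h"
      proof (rule jn_least)
        show "- h \<sqsubseteq> ?Q - h" using jn_ub2[of 0 "- (z - real (Suc i) *\<^sub>R h)"] by (rule le_cong_diff) simp
        have "z - real i *\<^sub>R h \<sqsubseteq> P i" unfolding P_def by (rule jn_ub1)
        then show "- P i \<sqsubseteq> ?Q - h" using jn_ub1[of "- (z - real (Suc i) *\<^sub>R h)" 0]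
          by (rule le_cong_diff2) (simp add: algebra_simps)
      qed
      then show ?thesis by (rule le_cong_diff) (simp add: t_def s_def)
    qed
    have disj_st: "disj (s (Suc i)) (t i)" for i
      using disj_mono[OF disj_pp sP[of "Suc i", unfolded P_def] tP[of i]] .
    \<comment> \<open>In \<open>h <= x + pp (y - x)\<close> the last term is dropped by
      disjointness: \<open>s (i + 1)\<close> is below the positive part of \<open>z\<close>, and
      \<open>y - x\<close> is a multiple of \<open>- z\<close> with factor at most 1.\<close>
    have sx: "s (Suc i) \<sqsubseteq> x" for i
    proof (rule disj_absorb)
      have "h \<sqsubseteq> x + pp (y - x)"
        unfolding h_def
      proof (rule jn_least)
        show "x \<sqsubseteq> x + pp (y - x)" using jn_ub2[of 0 "y - x"] by (rule le_cong_diff) simp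
        show "y \<sqsubseteq> x + pp (y - x)" using jn_ub1[of "y - x" 0] by (rule le_cong_diff) simp
      qed
      with sh show "s (Suc i) \<sqsubseteq> x + pp (y - x)" by (rule le_trans)
      have "z - real (Suc i) *\<^sub>R h \<sqsubseteq> z"
        using h0 by (rule le_cong_scaleR[where t="real (Suc i)"]) simp_all
      then have 1: "P (Suc i) \<sqsubseteq> pp z" unfolding P_def by (rule pp_mono)
      have 2: "pp (y - x) \<sqsubseteq> pp (- z)"
      proof (rule jn_least)
        have "(1/k) *\<^sub>R (- z) \<sqsubseteq> (1/k) *\<^sub>R pp (- z)" using k1 by (intro le_scaleR jn_ub1) auto
        moreover have "(1/k) *\<^sub>R (- z) = y - x" using k1 by (simp add: z_def)
        moreover have "(1/k) *\<^sub>R pp (- z) \<sqsubseteq> pp (- z)" using jn_ub2[of 0 "- z"]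
          by (rule le_cong_scaleR[where t="1 - 1/k"]) (use k1 in \<open>auto simp: algebra_simps\<close>)
        ultimately show "y - x \<sqsubseteq> pp (- z)" by (metis le_trans)
      qed (rule jn_ub2)
      show "disj (s (Suc i)) (pp (y - x))"
        using disj_mono[OF disj_pp le_trans[OF sP 1] 2] .
    qed (rule x)
    \<comment> \<open>From \<open>z <= P (i + 1) + (i + 1) h\<close>, division by \<open>k\<close>
      bounds \<open>x - y\<close> by \<open>P (i + 1) + h / n\<close>. The term
      \<open>P (i + 1)\<close> is disjoint from \<open>t i\<close> and drops out.\<close>
    have ty: "t i \<sqsubseteq> y + (1 / real n) *\<^sub>R h" if "i < n" for i
    proof (rule disj_absorb)
      have hn: "0 \<sqsubseteq> (1 / real n) *\<^sub>R h" using le_scaleR[OF _ h0, of "1 / real n"] by simp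
      show "0 \<sqsubseteq> y + (1 / real n) *\<^sub>R h" using le_add[OF y hn] by simp
      have "jn x y \<sqsubseteq> y + (1 / real n) *\<^sub>R jn x y + P (Suc i)"
      proof (rule jn_least)
        show "y \<sqsubseteq> y + (1 / real n) *\<^sub>R jn x y + P (Suc i)"
          using le_add[OF hn P0[of "Suc i"]] by (rule le_cong_diff) (simp add: h_def)
        have 1: "0 \<sqsubseteq> P (Suc i) - (z - real (Suc i) *\<^sub>R h)"
          using jn_ub1[of "z - real (Suc i) *\<^sub>R h" 0] by (rule le_cong_diff) (simp add: P_def)
        have 2: "0 \<sqsubseteq> (1/k) *\<^sub>R (P (Suc i) - (z - real (Suc i) *\<^sub>R h))"
          using 1 by (rule le_cong_scaleR[where t="1/k"]) (use k1 in auto)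
        have 3: "0 \<sqsubseteq> (1 - 1/k) *\<^sub>R P (Suc i)"
          using P0[of "Suc i"] by (rule le_cong_scaleR[where t="1 - 1/k"]) (use k1 in auto)
        have "real (Suc i) / k \<le> 1 / real n"
          using that n mult_right_mono[of "real (Suc i)" "real n" "real n"]
          by (simp add: k_def power2_eq_square field_simps)
        then have 4: "0 \<sqsubseteq> (1 / real n - real (Suc i) / k) *\<^sub>R h"
          using le_scaleR[OF _ h0, of "1 / real n - real (Suc i) / k"] by simp
        have z': "(1/k) *\<^sub>R z = x - y" using k1 by (simp add: z_def)
        have eq: "(1/k) *\<^sub>R (P (Suc i) - (z - real (Suc i) *\<^sub>R h)) + (1 - 1/k) *\<^sub>R P (Suc i) + (1 / real n - real (Suc i) / k) *\<^sub>R h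
            = (1 / real n) *\<^sub>R h + P (Suc i) - (1/k) *\<^sub>R z"
          unfolding scaleR_diff_right scaleR_diff_left by simp
        show "x \<sqsubseteq> y + (1 / real n) *\<^sub>R jn x y + P (Suc i)"
          using le_add[OF le_add[OF 2 3] 4] unfolding eq z' h_def[symmetric]
          by (rule le_cong_diff) simp
      qed
      then have "h \<sqsubseteq> y + (1 / real n) *\<^sub>R h + P (Suc i)" unfolding h_def .
      with th show "t i \<sqsubseteq> y + (1 / real n) *\<^sub>R h + P (Suc i)" by (rule le_trans)
      have "disj (P (Suc i)) (t i)" unfolding P_def using disj_mono[OF disj_pp le_refl tP[of i]] .
      then show "disj (t i) (P (Suc i))" by (auto simp: disj_def)
    qed
    have st: "nm (s (Suc i) + t i) \<le> M n" if "i < n" for i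
    proof -
      have "nm (t i) \<le> nm (y + (1 / real n) *\<^sub>R h)" using t0 ty[OF that] by (rule nm_mono_pos)
      also have "\<dots> \<le> nm y + nm h / real n" using nm_triangle[of y "(1 / real n) *\<^sub>R h"] by (simp add: nm_scaleR)
      finally have 1: "nm (t i) \<le> nm y + nm h / real n" .
      have 2: "nm (s (Suc i)) \<le> nm x" using s0 sx by (rule nm_mono_pos)
      have "nm (s (Suc i) + t i) powr p \<le> nm (s (Suc i)) powr p + nm (t i) powr p"
        by (rule up[OF s0 t0 disj_st])
      also have "\<dots> \<le> nm x powr p + (nm y + nm h / real n) powr p"
        using 1 2 p by (intro add_mono powr_mono2) auto
      finally have "(nm (s (Suc i) + t i) powr p) powr (1/p) \<le> M n"
        unfolding M_def using p by (intro powr_mono2) auto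
      then show ?thesis using p by (simp add: powr_powr)
    qed
    have tele: "(\<Sum>i<m. s (Suc i) + t i) = real m *\<^sub>R h + s m - s 0" for m
      by (induction m) (auto simp: t_def algebra_simps)
    have "real n *\<^sub>R h = (\<Sum>i<n. s (Suc i) + t i) + (s 0 - s n)" unfolding tele by simp
    then have "real n * nm h = nm ((\<Sum>i<n. s (Suc i) + t i) + (s 0 - s n))"
      using nm_scaleR[of "real n" h] by simp
    also have "\<dots> \<le> nm (\<Sum>i<n. s (Suc i) + t i) + nm (s 0 - s n)" by (rule nm_triangle)
    also have "nm (\<Sum>i<n. s (Suc i) + t i) \<le> (\<Sum>i<n. M n)"
      using nm_sum by (rule order_trans) (rule sum_mono, simp add: st)
    also have "nm (s 0 - s n) \<le> nm h"
    proof (rule nm_mono)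
      show "s 0 - s n \<sqsubseteq> h" using sh[of 0] s0[of n] by (rule le_cong_diff2) simp
      show "- h \<sqsubseteq> s 0 - s n" using sh[of n] s0[of 0] by (rule le_cong_diff2) simp
    qed
    finally show ?thesis using n by (simp add: field_simps)
  qed
  have inv: "(\<lambda>n. nm h / real n) \<longlonglongrightarrow> 0"
    by (rule tendsto_divide_0[OF tendsto_const filterlim_at_top_imp_at_infinity[OF filterlim_real_sequentially]])
  have "M \<longlonglongrightarrow> (nm x powr p + (nm y + 0) powr p) powr (1/p)"
    unfolding M_def using p inv
    by (intro tendsto_powr' tendsto_add tendsto_const) (auto intro!: always_eventually add_nonneg_nonneg)
  then have "(\<lambda>n. M n + nm h / real n) \<longlonglongrightarrow> (nm x powr p + (nm y + 0) powr p) powr (1/p) + 0"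
    using inv by (rule tendsto_add)
  then have "nm h \<le> (nm x powr p + nm y powr p) powr (1/p)"
    using main by (intro LIMSEQ_le_const[where X="\<lambda>n. M n + nm h / real n"]) auto
  then have "nm h powr p \<le> ((nm x powr p + nm y powr p) powr (1/p)) powr p"
    using p by (intro powr_mono2) auto
  then show ?thesis using p by (simp add: powr_powr h_def)
qed

text \<open>Partial sums of positive terms increase, so their norm limit dominates every one of
  them. The remainders \<open>s - (x 0 + ... + x (m - 1))\<close> later serve as order bounds of
  vanishing norm.\<close>

lemma positive_series:
  assumes pos: "\<And>k. 0 \<sqsubseteq> x k" and small: "\<And>k. nm (x k) \<le> C * (1/2) ^ k"
  shows "\<exists>s. (\<forall>m n. m \<le> n \<longrightarrow> (\<Sum>i=m..<n. x i) \<sqsubseteq> s - (\<Sum>i<m. x i)) \<and> (\<forall>m. 0 \<sqsubseteq> (s - (\<Sum>i<m. x i)))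
      \<and> (\<lambda>n. nm (s - (\<Sum>i<n. x i))) \<longlonglongrightarrow> 0"
proof -
  define S where "S n = (\<Sum>i<n. x i)" for n
  have diff: "S n - S m = (\<Sum>i=m..<n. x i)" if "m \<le> n" for m n
    using sum_diff[of "{..<n}" "{..<m}" x] that by (simp add: S_def lessThan_minus_lessThan)
  have tail_pos: "0 \<sqsubseteq> (\<Sum>i=m..<n. x i)" for m n
    by (induction n) (use le_add[OF _ pos] in \<open>fastforce simp: sum.atLeastLessThan_Suc\<close>)+
  have lim: "(\<lambda>n. C * 2 * (1/2) ^ n) \<longlonglongrightarrow> 0" for C :: real
    using tendsto_mult_right_zero[OF LIMSEQ_power_zero[of "1/2::real"]] by simp
  have C: "0 \<le> C" using order_trans[OF nm_nonneg small[of 0]] by simp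
  have tail: "nm (S n - S m) \<le> C * 2 * (1/2) ^ m" if "m \<le> n" for m n
  proof -
    have "(\<Sum>i=m..<n. (1/2::real) ^ i) = 2 * ((1/2) ^ m - (1/2) ^ n)"
      using that by (induction n rule: dec_induct) (auto simp: sum.atLeastLessThan_Suc)
    then have geo: "(\<Sum>i=m..<n. (1/2::real) ^ i) \<le> 2 * (1/2) ^ m" by simp
    have "nm (S n - S m) \<le> (\<Sum>i=m..<n. nm (x i))" unfolding diff[OF that] by (rule nm_sum)
    also have "\<dots> \<le> (\<Sum>i=m..<n. C * (1/2) ^ i)" by (intro sum_mono small)
    also have "\<dots> = C * (\<Sum>i=m..<n. (1/2) ^ i)" by (simp add: sum_distrib_left)
    also have "\<dots> \<le> C * (2 * (1/2) ^ m)" using geo C by (rule mult_left_mono)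
    finally show ?thesis by simp
  qed
  obtain s where s: "(\<lambda>n. nm (S n - s)) \<longlonglongrightarrow> 0"
  proof (atomize_elim, rule nm_complete)
    fix e :: real assume e: "0 < e"
    obtain M where M: "C * 2 * (1/2) ^ M < e"
      using eventually_happens[OF order_tendstoD(2)[OF lim e]] by auto
    have "nm (S m - S n) < e" if "M \<le> m" "M \<le> n" for m n
    proof -
      have mono: "C * 2 * (1/2) ^ k \<le> C * 2 * (1/2) ^ M" if "M \<le> k" for k
        using that C by (intro mult_left_mono power_decreasing) auto
      have "nm (S m - S n) \<le> C * 2 * (1/2) ^ M"
      proof (cases "m \<le> n")
        case True
        then show ?thesis using tail[OF True] mono[OF that(1)] nm_minus[of "S n - S m"] by simp
      next
        case False
        then show ?thesis using tail[of n m] mono[OF that(2)] by simp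
      qed
      then show ?thesis using M by simp
    qed
    then show "\<exists>M. \<forall>m\<ge>M. \<forall>n\<ge>M. nm (S m - S n) < e" by blast
  qed
  have ub: "S n \<sqsubseteq> s" for n
  proof (rule le_limit)
    show "(\<lambda>k. nm (S (k + n) - s)) \<longlonglongrightarrow> 0" using s by (rule LIMSEQ_ignore_initial_segment)
    show "S n \<sqsubseteq> S (k + n)" for k
      using tail_pos[of n "k + n"] by (rule le_cong_diff) (simp add: diff)
  qed
  have "(\<lambda>n. nm (s - S n)) \<longlonglongrightarrow> 0" using s nm_minus[of "S _ - s"] by simp
  moreover have "(\<Sum>i=m..<n. x i) \<sqsubseteq> s - S m" if "m \<le> n" for m n
    using ub[of n] by (rule le_cong_diff) (simp add: diff[OF that, symmetric])
  moreover have "0 \<sqsubseteq> (s - S m)" for m using ub[of m] by (rule le_cong_diff) simp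
  ultimately show ?thesis unfolding S_def by blast
qed

end

section \<open>Banach lattices as seminormed lattices on free vector spaces\<close>

lemma lookup_scaleR: "Poly_Mapping.lookup (c *\<^sub>R v) x = c *\<^sub>R Poly_Mapping.lookup v x"
proof -
  have "finite {x. c *\<^sub>R Poly_Mapping.lookup v x \<noteq> 0}"
    by (rule finite_subset[OF _ finite_lookup[of v]]) auto
  then show ?thesis by (simp add: scaleR_poly_mapping_def)
qed

locale blattice =
  fixes X :: "'a blat"
  assumes banach: "banach_lattice X"
begin

lemmas ax0 = banach[unfolded banach_lattice_def Let_def]
lemmas ax1 = conjunct2[OF ax0]
lemmas ax2 = conjunct2[OF ax1]
lemmas ax3 = conjunct2[OF ax2]
lemmas ax4 = conjunct2[OF ax3]
lemmas ax5 = conjunct2[OF ax4]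
lemmas ax6 = conjunct2[OF ax5]
lemmas ax7 = conjunct2[OF ax6]
lemmas ax8 = conjunct2[OF ax7]
lemmas ax9 = conjunct2[OF ax8]
lemmas ax10 = conjunct2[OF ax9]
lemmas ax11 = conjunct2[OF ax10]
lemmas ax12 = conjunct2[OF ax11]
lemmas ax13 = conjunct2[OF ax12]
lemmas ax14 = conjunct2[OF ax13]
lemmas ax15 = conjunct2[OF ax14]
lemmas ax16 = conjunct2[OF ax15]
lemmas ax17 = conjunct2[OF ax16]
lemmas ax18 = conjunct2[OF ax17]
lemmas ax19 = conjunct2[OF ax18]
lemmas ax20 = conjunct2[OF ax19]
lemmas ax21 = conjunct2[OF ax20]

lemma
  shows zero_mem [simp]: "bl_zero X \<in> bl_carrier X"
    and add_mem [simp]: "x \<in> bl_carrier X \<Longrightarrow> y \<in> bl_carrier X \<Longrightarrow> bl_add X x y \<in> bl_carrier X"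
    and scal_mem [simp]: "x \<in> bl_carrier X \<Longrightarrow> bl_scal X a x \<in> bl_carrier X"
    and badd_assoc: "x \<in> bl_carrier X \<Longrightarrow> y \<in> bl_carrier X \<Longrightarrow> z \<in> bl_carrier X \<Longrightarrow>
    bl_add X (bl_add X x y) z = bl_add X x (bl_add X y z)"
    and badd_commute: "x \<in> bl_carrier X \<Longrightarrow> y \<in> bl_carrier X \<Longrightarrow> bl_add X x y = bl_add X y x"
    and bzero_add [simp]: "x \<in> bl_carrier X \<Longrightarrow> bl_add X (bl_zero X) x = x"
    and badd_neg: "x \<in> bl_carrier X \<Longrightarrow> bl_add X x (bl_scal X (-1) x) = bl_zero X"
    and bscal_add: "x \<in> bl_carrier X \<Longrightarrow> y \<in> bl_carrier X \<Longrightarrow>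
    bl_scal X a (bl_add X x y) = bl_add X (bl_scal X a x) (bl_scal X a y)"
    and bscal_plus: "x \<in> bl_carrier X \<Longrightarrow> bl_scal X (a + b) x = bl_add X (bl_scal X a x) (bl_scal X b x)"
    and bscal_bscal: "x \<in> bl_carrier X \<Longrightarrow> bl_scal X a (bl_scal X b x) = bl_scal X (a * b) x"
    and bscal_one [simp]: "x \<in> bl_carrier X \<Longrightarrow> bl_scal X 1 x = x"
    and ble_refl: "x \<in> bl_carrier X \<Longrightarrow> bl_leq X x x"
    and ble_antisym: "bl_leq X x y \<Longrightarrow> bl_leq X y x \<Longrightarrow> x \<in> bl_carrier X \<Longrightarrow> y \<in> bl_carrier X \<Longrightarrow> x = y"
    and ble_trans: "bl_leq X x y \<Longrightarrow> bl_leq X y z \<Longrightarrow> x \<in> bl_carrier X \<Longrightarrow> y \<in> bl_carrier X \<Longrightarrow> z \<in> bl_carrier X \<Longrightarrow>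
    bl_leq X x z"
    and ble_add: "bl_leq X x y \<Longrightarrow> x \<in> bl_carrier X \<Longrightarrow> y \<in> bl_carrier X \<Longrightarrow> z \<in> bl_carrier X \<Longrightarrow>
    bl_leq X (bl_add X x z) (bl_add X y z)"
    and ble_scal: "bl_leq X x y \<Longrightarrow> 0 \<le> a \<Longrightarrow> x \<in> bl_carrier X \<Longrightarrow> y \<in> bl_carrier X \<Longrightarrow>
    bl_leq X (bl_scal X a x) (bl_scal X a y)"
    and lub_ex: "x \<in> bl_carrier X \<Longrightarrow> y \<in> bl_carrier X \<Longrightarrow> \<exists>w. bl_lub X {x, y} w"
    and nrm_zero_iff: "x \<in> bl_carrier X \<Longrightarrow> bl_nrm X x = 0 \<longleftrightarrow> x = bl_zero X"
    and nrm_scal: "x \<in> bl_carrier X \<Longrightarrow> bl_nrm X (bl_scal X a x) = \<bar>a\<bar> * bl_nrm X x"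
    and nrm_add: "x \<in> bl_carrier X \<Longrightarrow> y \<in> bl_carrier X \<Longrightarrow> bl_nrm X (bl_add X x y) \<le> bl_nrm X x + bl_nrm X y"
    and nrm_mono: "bl_leq X (bl_abs X x) (bl_abs X y) \<Longrightarrow> x \<in> bl_carrier X \<Longrightarrow> y \<in> bl_carrier X \<Longrightarrow>
    bl_nrm X x \<le> bl_nrm X y"
    and nrm_complete: "(\<And>n. s n \<in> bl_carrier X) \<Longrightarrow>
    (\<And>e. 0 < e \<Longrightarrow> \<exists>N. \<forall>m\<ge>N. \<forall>n\<ge>N. bl_nrm X (bl_diff X (s m) (s n)) < e) \<Longrightarrow>
    \<exists>x\<in>bl_carrier X. (\<lambda>n. bl_nrm X (bl_diff X (s n) x)) \<longlonglongrightarrow> 0"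
  by (use conjunct1[OF ax0] in blast, use conjunct1[OF ax1] in blast, use conjunct1[OF ax2] in blast,
      use conjunct1[OF ax3] in blast, use conjunct1[OF ax4] in blast, use conjunct1[OF ax5] in blast,
      use conjunct1[OF ax6] in blast, use conjunct1[OF ax7] in blast, use conjunct1[OF ax8] in blast,
      use conjunct1[OF ax9] in blast, use conjunct1[OF ax10] in blast, use conjunct1[OF ax11] in blast,
      use conjunct1[OF ax12] in blast, use conjunct1[OF ax13] in blast, use conjunct1[OF ax14] in blast,
      use conjunct1[OF ax15] in blast, use conjunct1[OF ax16] in blast, use conjunct1[OF ax17] in blast,
      use conjunct1[OF ax18] in blast, use conjunct1[OF ax19] in blast, use conjunct1[OF ax20] in blast,
      use ax21 in blast)

lemma bscal_0 [simp]: "x \<in> bl_carrier X \<Longrightarrow> bl_scal X 0 x = bl_zero X"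
  using bscal_plus[of x 1 "-1"] badd_neg[of x] by simp

lemma bscal_zero [simp]: "bl_scal X a (bl_zero X) = bl_zero X"
  using bscal_bscal[of "bl_zero X" a 0] by simp

lemma lub_unique: "bl_lub X S z \<Longrightarrow> bl_lub X S w \<Longrightarrow> z = w"
  unfolding bl_lub_def using ble_antisym by blast
lemma lub_the: "bl_lub X S z \<Longrightarrow> (THE z. bl_lub X S z) = z"
  using lub_unique by (intro the_equality) auto
lemma sup_eqI: "bl_lub X {x, y} z \<Longrightarrow> bl_sup X x y = z"
  unfolding bl_sup_def by (rule lub_the)
lemma inf_eqI: "bl_glb X {x, y} z \<Longrightarrow> bl_inf X x y = z"
  unfolding bl_inf_def bl_glb_def by (rule the_equality) (use ble_antisym in blast)+
lemma sup_lub: "x \<in> bl_carrier X \<Longrightarrow> y \<in> bl_carrier X \<Longrightarrow> bl_lub X {x, y} (bl_sup X x y)"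
  using lub_ex sup_eqI by metis
lemma sup_mem [simp]: "x \<in> bl_carrier X \<Longrightarrow> y \<in> bl_carrier X \<Longrightarrow> bl_sup X x y \<in> bl_carrier X"
  using sup_lub by (auto simp: bl_lub_def)

text \<open>The additive monoid of the carrier, which makes finite sums available as
  \<open>finprod\<close>.\<close>

definition grp :: "'a monoid" where
  "grp = \<lparr>carrier = bl_carrier X, mult = bl_add X, one = bl_zero X\<rparr>"

sublocale grp: comm_monoid grp
  rewrites "carrier grp = bl_carrier X" and "mult grp = bl_add X" and "one grp = bl_zero X"
proof -
  show "comm_monoid grp"
    by (rule comm_monoidI) (auto simp: grp_def badd_assoc intro: badd_commute)
qed (auto simp: grp_def)

text \<open>The evaluation of formal linear combinations turns the carrier-based lattice into a preorder on
  a genuine real vector space type, on which the usual algebra simplification is available.\<close>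

definition val :: "('a \<Rightarrow>\<^sub>0 real) \<Rightarrow> 'a" where
  "val v = finprod grp (\<lambda>x. bl_scal X (Poly_Mapping.lookup v x) x) (Poly_Mapping.keys v \<inter> bl_carrier X)"

text \<open>Evaluating over a larger support lets two combinations be added over a common one. Keys
  outside the carrier are ignored, so \<open>val\<close> is linear on the whole type.\<close>

lemma val_superset:
  assumes "finite A" "Poly_Mapping.keys v \<inter> bl_carrier X \<subseteq> A" "A \<subseteq> bl_carrier X"
  shows "val v = finprod grp (\<lambda>x. bl_scal X (Poly_Mapping.lookup v x) x) A"
  unfolding val_def
proof (rule grp.finprod_mono_neutral_cong_left)
  show "\<And>i. i \<in> A - Poly_Mapping.keys v \<inter> bl_carrier X \<Longrightarrow> bl_scal X (Poly_Mapping.lookup v i) i = bl_zero X"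
    using assms(3) by (auto simp: not_in_keys_iff_lookup_eq_zero)
qed (use assms in auto)

lemma val_mem [simp]: "val v \<in> bl_carrier X"
  unfolding val_def by (rule grp.finprod_closed) auto

lemma val_add: "val (v + w) = bl_add X (val v) (val w)"
proof -
  let ?A = "(Poly_Mapping.keys v \<union> Poly_Mapping.keys w) \<inter> bl_carrier X"
  have "val (v + w) = finprod grp (\<lambda>x. bl_scal X (Poly_Mapping.lookup (v + w) x) x) ?A"
    using keys_add[of v w] by (intro val_superset) auto
  also have "\<dots> = finprod grp (\<lambda>x. bl_add X (bl_scal X (Poly_Mapping.lookup v x) x) (bl_scal X (Poly_Mapping.lookup w x) x)) ?A"
    by (rule grp.finprod_cong') (auto simp: lookup_add bscal_plus)
  also have "\<dots> = bl_add X (finprod grp (\<lambda>x. bl_scal X (Poly_Mapping.lookup v x) x) ?A) (finprod grp (\<lambda>x. bl_scal X (Poly_Mapping.lookup w x) x) ?A)"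
    by (rule grp.finprod_multf) auto
  also have "\<dots> = bl_add X (val v) (val w)"
    by (subst (1 2) val_superset[of ?A]) auto
  finally show ?thesis .
qed

lemma finprod_scal:
  "finite A \<Longrightarrow> A \<subseteq> bl_carrier X \<Longrightarrow> f \<in> A \<rightarrow> bl_carrier X \<Longrightarrow>
    finprod grp (\<lambda>x. bl_scal X c (f x)) A = bl_scal X c (finprod grp f A)"
proof (induction A rule: finite_induct)
  case (insert a A)
  have "finprod grp f A \<in> bl_carrier X" using insert by (intro grp.finprod_closed) auto
  moreover have "(\<lambda>x. bl_scal X c (f x)) \<in> A \<rightarrow> bl_carrier X" using insert by (auto simp: Pi_iff)
  ultimately show ?case using insert by (simp add: bscal_add Pi_iff)
qed simp

lemma val_scaleR: "val (c *\<^sub>R v) = bl_scal X c (val v)"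
proof -
  let ?A = "Poly_Mapping.keys v \<inter> bl_carrier X"
  have "val (c *\<^sub>R v) = finprod grp (\<lambda>x. bl_scal X (Poly_Mapping.lookup (c *\<^sub>R v) x) x) ?A"
    by (intro val_superset) (auto simp: in_keys_iff lookup_scaleR)
  also have "\<dots> = finprod grp (\<lambda>x. bl_scal X c (bl_scal X (Poly_Mapping.lookup v x) x)) ?A"
    by (rule grp.finprod_cong') (auto simp: lookup_scaleR bscal_bscal)
  also have "\<dots> = bl_scal X c (val v)" unfolding val_def by (rule finprod_scal) auto
  finally show ?thesis .
qed

lemma val_zero [simp]: "val 0 = bl_zero X" unfolding val_def by simp
lemma val_minus: "val (- v) = bl_neg X (val v)" using val_scaleR[of "-1" v] by (simp add: bl_neg_def)
lemma val_diff: "val (v - w) = bl_diff X (val v) (val w)"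
  using val_add[of v "- w"] by (simp add: bl_diff_def val_minus)

definition emb :: "'a \<Rightarrow> ('a \<Rightarrow>\<^sub>0 real)" where "emb x = Poly_Mapping.single x 1"

lemma val_emb [simp]: "x \<in> bl_carrier X \<Longrightarrow> val (emb x) = x"
proof -
  assume x: "x \<in> bl_carrier X"
  have "val (emb x) = finprod grp (\<lambda>y. bl_scal X (Poly_Mapping.lookup (emb x) y) y) (insert x {})"
    by (rule val_superset) (use x in \<open>auto simp: emb_def\<close>)
  also have "\<dots> = x"
    using x by (subst grp.finprod_insert) (auto simp: emb_def badd_commute[of x])
  finally show ?thesis .
qed

sublocale seminormed_lattice "\<lambda>v w. bl_leq X (val v) (val w)"
  "\<lambda>v w. emb (bl_sup X (val v) (val w))" "\<lambda>v. bl_nrm X (val v)"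
proof
  fix x y z :: "'a \<Rightarrow>\<^sub>0 real" and c :: real and s :: "nat \<Rightarrow> 'a \<Rightarrow>\<^sub>0 real"
  show "bl_leq X (val x) (val x)" by (simp add: ble_refl)
  show "bl_leq X (val x) (val y) \<Longrightarrow> bl_leq X (val y) (val z) \<Longrightarrow> bl_leq X (val x) (val z)"
    by (rule ble_trans) auto
  show "bl_leq X (val x) (val y) \<Longrightarrow> bl_leq X (val (x + z)) (val (y + z))"
    by (simp add: val_add ble_add)
  show "0 \<le> c \<Longrightarrow> bl_leq X (val x) (val y) \<Longrightarrow> bl_leq X (val (c *\<^sub>R x)) (val (c *\<^sub>R y))"
    by (simp add: val_scaleR ble_scal)
  have l: "bl_lub X {val x, val y} (bl_sup X (val x) (val y))" by (simp add: sup_lub)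
  then show "bl_leq X (val x) (val (emb (bl_sup X (val x) (val y))))"
    and "bl_leq X (val y) (val (emb (bl_sup X (val x) (val y))))" by (auto simp: bl_lub_def)
  show "bl_leq X (val x) (val z) \<Longrightarrow> bl_leq X (val y) (val z) \<Longrightarrow> bl_leq X (val (emb (bl_sup X (val x) (val y)))) (val z)"
    using l by (auto simp: bl_lub_def)
  show "bl_nrm X (val (c *\<^sub>R x)) = \<bar>c\<bar> * bl_nrm X (val x)" by (simp add: val_scaleR nrm_scal)
  show "bl_nrm X (val (x + y)) \<le> bl_nrm X (val x) + bl_nrm X (val y)" by (simp add: val_add nrm_add)
  show "bl_leq X (val (emb (bl_sup X (val x) (val (- x))))) (val (emb (bl_sup X (val y) (val (- y))))) \<Longrightarrow>
     bl_nrm X (val x) \<le> bl_nrm X (val y)"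
    by (rule nrm_mono) (auto simp: bl_abs_def val_minus[symmetric])
  show "bl_nrm X (val x) = 0 \<Longrightarrow> bl_leq X (val x) (val 0)" by (simp add: nrm_zero_iff ble_refl)
  assume *: "\<And>e. 0 < e \<Longrightarrow> \<exists>N. \<forall>m\<ge>N. \<forall>n\<ge>N. bl_nrm X (val (s m - s n)) < e"
  then obtain l where "l \<in> bl_carrier X" "(\<lambda>n. bl_nrm X (bl_diff X (val (s n)) l)) \<longlonglongrightarrow> 0"
    using nrm_complete[of "\<lambda>n. val (s n)"] by (auto simp: val_diff)
  then show "\<exists>x. (\<lambda>n. bl_nrm X (val (s n - x))) \<longlonglongrightarrow> 0"
    by (intro exI[of _ "emb l"]) (simp add: val_diff)
qed

lemma lub_val:
  assumes "\<And>s. s \<in> S \<Longrightarrow> \<exists>v\<in>V. s = val v" "\<And>v. v \<in> V \<Longrightarrow> val v \<in> S"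
    and "V \<subseteq> dn l" "\<And>w. V \<subseteq> dn w \<Longrightarrow> bl_leq X (val l) (val w)"
  shows "bl_lub X S (val l)"
  unfolding bl_lub_def
proof (intro conjI ballI impI)
  show "bl_leq X s (val l)" if "s \<in> S" for s using assms(1)[OF that] assms(3) by (auto simp: dn_def)
  fix w assume w: "w \<in> bl_carrier X" "\<forall>s\<in>S. bl_leq X s w"
  have "V \<subseteq> dn (emb w)" using w assms(2) by (auto simp: dn_def)
  then show "bl_leq X (val l) w" using assms(4)[of "emb w"] w by simp
qed simp

abbreviation pair_seq :: "('a \<Rightarrow>\<^sub>0 real) \<Rightarrow> ('a \<Rightarrow>\<^sub>0 real) \<Rightarrow> nat \<Rightarrow> 'a" where
  "pair_seq x y \<equiv> \<lambda>k. if k = 0 then val x else val y"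

text \<open>Two summands suffice as input from \<open>X1\<close> and \<open>X2\<close>: longer sums
  in the amalgam are built by iterating binary combinations.\<close>

lemma p_sum_two:
  assumes S: "S = {a *\<^sub>R x + b *\<^sub>R y | a b. \<bar>a\<bar> powr (p / (p - 1)) + \<bar>b\<bar> powr (p / (p - 1)) \<le> 1}"
    and l: "S \<subseteq> dn l" "\<And>w. S \<subseteq> dn w \<Longrightarrow> bl_leq X (val l) (val w)"
  shows "p_sum X p (pair_seq x y) 2 = val l"
  unfolding p_sum_def
proof (rule lub_the, rule lub_val[where V=S])
  have sum2: "bl_sum X (\<lambda>k. bl_scal X (a k) (pair_seq x y k)) 2 = val (a 0 *\<^sub>R x + a 1 *\<^sub>R y)" for a
    by (simp add: numeral_2_eq_2 val_add val_scaleR)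
  have abs2: "(\<Sum>k<2. \<bar>a k\<bar> powr (p / (p - 1))) = \<bar>a 0\<bar> powr (p / (p - 1)) + \<bar>a 1\<bar> powr (p / (p - 1))" for a :: "nat \<Rightarrow> real"
    by (simp add: numeral_2_eq_2)
  let ?T = "{bl_sum X (\<lambda>k. bl_scal X (a k) (pair_seq x y k)) 2 |a. (\<Sum>k<2. \<bar>a k\<bar> powr (p / (p - 1))) \<le> 1}"
  show "\<exists>v\<in>S. s = val v" if "s \<in> ?T" for s
    using that unfolding S sum2 abs2 by blast
  fix v assume "v \<in> S"
  then obtain a b where ab: "v = a *\<^sub>R x + b *\<^sub>R y" "\<bar>a\<bar> powr (p / (p - 1)) + \<bar>b\<bar> powr (p / (p - 1)) \<le> 1"
    unfolding S by blast
  show "val v \<in> ?T"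
    unfolding mem_Collect_eq sum2 abs2 using ab by (intro exI[of _ "\<lambda>k. if k = 0 then a else b"]) simp
qed (use l in auto)

end

text \<open>The supremum of \<open>a x + b y\<close> over nonnegative \<open>a\<close>,
  \<open>b\<close> with \<open>a powr r + b powr r <= 1\<close> is the p-sum of positive
  \<open>x\<close>, \<open>y\<close> when \<open>r\<close> is the dual exponent, and their join when
  \<open>r = 1\<close>. Upper p-estimates thus become the case \<open>r = 1\<close> of the same
  formalism.\<close>

fun coefficient_exponent :: "lattice_class \<Rightarrow> real \<Rightarrow> real" where
  "coefficient_exponent Cp p = p / (p - 1)"
| "coefficient_exponent Cp_inf p = 1"

context blattice
begin

lemma p_norm_two:
  assumes "0 < p" "bl_nrm X (p_sum X p (pair_seq x y) 2) \<le> (\<Sum>k<2. bl_nrm X (pair_seq x y k) powr p) powr (1 / p)"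
    and "p_sum X p (pair_seq x y) 2 = val l"
  shows "bl_nrm X (val l) powr p \<le> bl_nrm X (val x) powr p + bl_nrm X (val y) powr p"
proof -
  have "bl_nrm X (val l) \<le> (bl_nrm X (val x) powr p + bl_nrm X (val y) powr p) powr (1 / p)"
    using assms by (simp add: numeral_2_eq_2)
  then have "bl_nrm X (val l) powr p \<le> ((bl_nrm X (val x) powr p + bl_nrm X (val y) powr p) powr (1 / p)) powr p"
    using assms(1) by (intro powr_mono2) auto
  then show ?thesis using assms(1) by (simp add: powr_powr)
qed

text \<open>For disjoint positive vectors the p-sum is \<open>x + y\<close>: admissible coefficients
  have modulus at most 1, and for a common upper bound \<open>w\<close> of \<open>x\<close> and
  \<open>y\<close> the vector \<open>x + y - w\<close> lies below both, hence below 0.\<close>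

lemma upper_estimate_disjoint:
  assumes p: "1 < p" and u: "upper_p_est1 p X"
    and x: "bl_leq X (val 0) (val x)" and y: "bl_leq X (val 0) (val y)" and d: "disj x y"
  shows "bl_nrm X (val (x + y)) powr p \<le> bl_nrm X (val x) powr p + bl_nrm X (val y) powr p"
proof (rule p_norm_two)
  have abs_pos: "bl_abs X (val v) = val v" if "bl_leq X (val 0) (val v)" for v
  proof -
    have "bl_leq X (val (- v)) (val v)" using le_add[OF that that] by (rule le_cong_diff) simp
    then have "bl_lub X {val v, val (- v)} (val v)" by (auto simp: bl_lub_def ble_refl)
    then show ?thesis unfolding bl_abs_def by (metis sup_eqI val_minus)
  qed
  have glb: "bl_glb X {val x, val y} (bl_zero X)"
    unfolding bl_glb_def
  proof (intro conjI ballI impI)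
    fix w assume w: "w \<in> bl_carrier X" "\<forall>s\<in>{val x, val y}. bl_leq X w s"
    then have "bl_leq X (val (emb w)) (val 0)" using d unfolding disj_def by (metis insertCI val_emb)
    then show "bl_leq X w (bl_zero X)" using w by simp
  qed (use x y in auto)
  then have "bl_inf X (val x) (val y) = bl_zero X" "bl_inf X (val y) (val x) = bl_zero X"
    by (auto intro!: inf_eqI simp: insert_commute)
  then have "pairwise_disjoint X (pair_seq x y) 2"
    using x y by (auto simp: pairwise_disjoint_def abs_pos)
  then show "bl_nrm X (p_sum X p (pair_seq x y) 2) \<le> (\<Sum>k<2. bl_nrm X (pair_seq x y k) powr p) powr (1 / p)"
    using u unfolding upper_p_est1_def by simp
  let ?q = "p / (p - 1)" and ?S = "{a *\<^sub>R x + b *\<^sub>R y | a b. \<bar>a\<bar> powr (p / (p - 1)) + \<bar>b\<bar> powr (p / (p - 1)) \<le> 1}"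
  have q: "0 < ?q" using p by simp
  show "p_sum X p (pair_seq x y) 2 = val (x + y)"
  proof (rule p_sum_two[OF refl])
    show "?S \<subseteq> dn (x + y)"
    proof safe
      fix a b :: real assume ab: "\<bar>a\<bar> powr ?q + \<bar>b\<bar> powr ?q \<le> 1"
      have "\<bar>a\<bar> powr ?q \<le> 1" "\<bar>b\<bar> powr ?q \<le> 1"
        using ab powr_ge_zero[of "\<bar>a\<bar>" ?q] powr_ge_zero[of "\<bar>b\<bar>" ?q] by linarith+
      then have "\<bar>a\<bar> \<le> 1" "\<bar>b\<bar> \<le> 1" using abs_le_1_if_powr_le_1 q by blast+
      then have "bl_leq X (val ((1 - a) *\<^sub>R 0)) (val ((1 - a) *\<^sub>R x))" "bl_leq X (val ((1 - b) *\<^sub>R 0)) (val ((1 - b) *\<^sub>R y))"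
        using x y by - (rule le_scaleR, linarith, assumption)+
      then have "bl_leq X (val (a *\<^sub>R x + b *\<^sub>R y)) (val (x + y))"
        by (rule le_cong_diff2) (simp add: algebra_simps)
      then show "a *\<^sub>R x + b *\<^sub>R y \<in> dn (x + y)" by (simp add: dn_def)
    qed
    fix w assume w: "?S \<subseteq> dn w"
    have "1 *\<^sub>R x + 0 *\<^sub>R y \<in> ?S"
      by (intro CollectI exI[of _ 1] exI[of _ 0]) simp
    moreover have "0 *\<^sub>R x + 1 *\<^sub>R y \<in> ?S"
      by (intro CollectI exI[of _ 0] exI[of _ 1]) simp
    ultimately have xw: "bl_leq X (val x) (val w)" and yw: "bl_leq X (val y) (val w)" using w by (auto simp: dn_def)
    have "bl_leq X (val (x + y - w)) (val x)" using yw by (rule le_cong_diff) simp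
    moreover have "bl_leq X (val (x + y - w)) (val y)" using xw by (rule le_cong_diff) simp
    ultimately have "bl_leq X (val (x + y - w)) (val 0)" using d unfolding disj_def by blast
    then show "bl_leq X (val (x + y)) (val w)" by (rule le_cong_diff) simp
  qed
qed (use p in simp)

text \<open>The form in which membership in either class enters the amalgam. For p-convexity
  \<open>z\<close> is the p-sum; for upper p-estimates it is the join, whose norm is controlled
  after the estimate has been extended from disjoint to arbitrary positive pairs.\<close>

lemma class_combination:
  assumes p: "1 < p" and c: "in_class c p X" and x: "bl_leq X (val 0) (val x)" and y: "bl_leq X (val 0) (val y)"
  shows "\<exists>z. bl_nrm X (val z) powr p \<le> bl_nrm X (val x) powr p + bl_nrm X (val y) powr p \<and>
    (\<forall>a b. 0 \<le> a \<longrightarrow> 0 \<le> b \<longrightarrow> a powr coefficient_exponent c p + b powr coefficient_exponent c p \<le> 1 \<longrightarrow>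
      bl_leq X (val (a *\<^sub>R x + b *\<^sub>R y)) (val z))"
proof (cases c)
  case Cp
  let ?q = "p / (p - 1)"
  let ?S = "{a *\<^sub>R x + b *\<^sub>R y | a b. \<bar>a\<bar> powr ?q + \<bar>b\<bar> powr ?q \<le> 1}"
  obtain l where l: "?S \<subseteq> dn l" "\<And>w. ?S \<subseteq> dn w \<Longrightarrow> bl_leq X (val l) (val w)"
    using q_combination_lub[OF x y, of ?q] p by auto
  have "p_convex1 p X" using c Cp by simp
  then have "bl_nrm X (p_sum X p (pair_seq x y) 2) \<le> (\<Sum>k<2. bl_nrm X (pair_seq x y k) powr p) powr (1 / p)"
    unfolding p_convex1_def by simp
  then have "bl_nrm X (val l) powr p \<le> bl_nrm X (val x) powr p + bl_nrm X (val y) powr p"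
    using p_norm_two[OF _ _ p_sum_two[OF refl l]] p by simp
  moreover have "bl_leq X (val (a *\<^sub>R x + b *\<^sub>R y)) (val l)" if "0 \<le> a" "0 \<le> b" "a powr ?q + b powr ?q \<le> 1" for a b
  proof -
    have "a *\<^sub>R x + b *\<^sub>R y \<in> ?S" using that by (intro CollectI exI[of _ a] exI[of _ b]) simp
    then show ?thesis using l(1) by (auto simp: dn_def)
  qed
  ultimately show ?thesis using Cp by auto
next
  case Cp_inf
  let ?h = "emb (bl_sup X (val x) (val y))"
  have "upper_p_est1 p X" using c Cp_inf by simp
  then have "bl_nrm X (val ?h) powr p \<le> bl_nrm X (val x) powr p + bl_nrm X (val y) powr p"
    using disjoint_upper_estimate_imp_sup[OF _ upper_estimate_disjoint[OF p] x y] p by auto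
  moreover have "bl_leq X (val (a *\<^sub>R x + b *\<^sub>R y)) (val ?h)" if ab: "0 \<le> a" "0 \<le> b" "a + b \<le> 1" for a b
  proof -
    have h0: "bl_leq X (val 0) (val ?h)" using x jn_ub1 by (rule le_trans)
    have "bl_leq X (val (a *\<^sub>R x)) (val (a *\<^sub>R ?h))" "bl_leq X (val (b *\<^sub>R y)) (val (b *\<^sub>R ?h))"
      using ab by (intro le_scaleR jn_ub1 jn_ub2; simp)+
    then have "bl_leq X (val (a *\<^sub>R x + b *\<^sub>R y)) (val ((a + b) *\<^sub>R ?h))"
      by (rule le_cong_diff2) (simp add: algebra_simps)
    moreover have "bl_leq X (val ((a + b) *\<^sub>R ?h)) (val ?h)"
      using h0 by (rule le_cong_scaleR[where t="1 - (a + b)"]) (use ab in \<open>auto simp: algebra_simps\<close>)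
    ultimately show ?thesis by (rule le_trans)
  qed
  ultimately show ?thesis using Cp_inf by (intro exI[of _ ?h]) auto
qed

end

section \<open>The amalgam of two seminormed lattices\<close>

text \<open>Convexity of the p-th power at the midpoint; this is the source of the constant
  \<open>2 powr (1 - 1/p)\<close>.\<close>

lemma powr_power_mean:
  fixes a b p :: real
  assumes "0 \<le> a" "0 \<le> b" "1 < p"
  shows "a + b \<le> 2 powr (1 - 1/p) * (a powr p + b powr p) powr (1/p)"
proof (cases "a = 0 \<or> b = 0")
  case True
  have "1 \<le> 2 powr (1 - 1/p)" using assms by (intro ge_one_powr_ge_zero) auto
  from mult_right_mono[OF this, of "a + b"] have "a + b \<le> 2 powr (1 - 1/p) * (a + b)" using assms by simp
  moreover have "(a powr p + b powr p) powr (1/p) = a + b" using True assms by (auto simp: powr_powr)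
  ultimately show ?thesis by simp
next
  case False
  then have "((1/2) *\<^sub>R a + (1/2) *\<^sub>R b) powr p \<le> (1/2) * a powr p + (1/2) * b powr p"
    using convex_onD[OF powr_convex[of p], of "1/2" a b] assms by simp
  then have "(((a + b) / 2) powr p) powr (1/p) \<le> ((a powr p + b powr p) / 2) powr (1/p)"
    using assms by (intro powr_mono2) (auto simp: field_simps)
  then have *: "(a + b) / 2 \<le> (a powr p + b powr p) powr (1/p) / 2 powr (1/p)"
    using assms by (simp add: powr_powr powr_divide)
  have "a + b = 2 * ((a + b) / 2)" by simp
  also have "\<dots> \<le> 2 * ((a powr p + b powr p) powr (1/p) / 2 powr (1/p))"
    using * by (rule mult_left_mono) simp
  also have "\<dots> = 2 powr (1 - 1/p) * (a powr p + b powr p) powr (1/p)" by (simp add: powr_diff)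
  finally show ?thesis .
qed

lemma powr_add_le:
  fixes a b p :: real
  assumes "0 \<le> a" "0 \<le> b" "1 \<le> p"
  shows "a powr p + b powr p \<le> (a + b) powr p"
proof (cases "a = 0 \<or> b = 0")
  case False
  then have ab: "0 < a" "0 < b" "0 < a + b" using assms by auto
  have *: "x powr p \<le> x * (a + b) powr (p - 1)" if "0 < x" "x \<le> a + b" for x
  proof -
    have "x powr p = x * x powr (p - 1)" using that by (simp add: powr_mult_base)
    also have "\<dots> \<le> x * (a + b) powr (p - 1)" using that assms by (intro mult_left_mono powr_mono2) auto
    finally show ?thesis .
  qed
  have "a powr p + b powr p \<le> a * (a + b) powr (p - 1) + b * (a + b) powr (p - 1)"
    using *[of a] *[of b] ab by auto
  also have "\<dots> = (a + b) powr p" using ab by (simp add: powr_mult_base distrib_right[symmetric])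
  finally show ?thesis .
qed auto

context preordered_space
begin

text \<open>Rescaling by the r-norm of the coefficients, which must be nonzero to divide by; for
  zero coefficients both sides are 0.\<close>

lemma combination_homogeneous:
  assumes z: "\<forall>a b. 0 \<le> a \<longrightarrow> 0 \<le> b \<longrightarrow> a powr r + b powr r \<le> 1 \<longrightarrow> a *\<^sub>R x + b *\<^sub>R x' \<sqsubseteq> z"
    and r: "0 < r" and ab: "0 \<le> a" "0 \<le> b"
  shows "a *\<^sub>R x + b *\<^sub>R x' \<sqsubseteq> (a powr r + b powr r) powr (1/r) *\<^sub>R z"
proof (cases "a = 0 \<and> b = 0")
  case False
  define c where "c = (a powr r + b powr r) powr (1/r)"
  have pos: "0 < a powr r + b powr r" using False ab by (smt (verit) powr_gt_zero powr_ge_zero)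
  then have c: "0 < c" unfolding c_def by simp
  have cr: "c powr r = a powr r + b powr r" using r pos by (simp add: c_def powr_powr)
  have "(a/c) powr r + (b/c) powr r = 1" using ab c pos by (simp add: powr_divide cr add_divide_distrib[symmetric])
  then have "(a/c) *\<^sub>R x + (b/c) *\<^sub>R x' \<sqsubseteq> z" using z ab c by auto
  then show ?thesis unfolding c_def[symmetric]
    by (rule le_cong_scaleR[where t=c]) (use c in \<open>auto simp: algebra_simps\<close>)
qed simp

end

text \<open>Here \<open>X0\<close> survives only as \<open>link a b\<close>, to be read as: some
  \<open>w\<close> in \<open>X0\<close> has \<open>a <= T1 w\<close> and \<open>T2 w <= b\<close>.
  Joins and meets of links come from those of witnesses, and \<open>link_norm\<close> is where
  contractivity of \<open>T1\<close> and isometry of \<open>T2\<close> are stored.\<close>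

locale amalgam =
  L1: seminormed_lattice le1 jn1 nm1 + L2: seminormed_lattice le2 jn2 nm2
  for le1 :: "'a::real_vector \<Rightarrow> 'a \<Rightarrow> bool" and jn1 nm1
    and le2 :: "'b::real_vector \<Rightarrow> 'b \<Rightarrow> bool" and jn2 nm2 +
  fixes link :: "'a \<Rightarrow> 'b \<Rightarrow> bool" and p r :: real
  assumes link_zero: "link 0 0"
    and link_add: "link a b \<Longrightarrow> link a' b' \<Longrightarrow> link (a + a') (b + b')"
    and link_scaleR: "0 \<le> c \<Longrightarrow> link a b \<Longrightarrow> link (c *\<^sub>R a) (c *\<^sub>R b)"
    and link_mono: "link a b \<Longrightarrow> le1 a' a \<Longrightarrow> le2 b b' \<Longrightarrow> link a' b'"
    and link_join: "link a b \<Longrightarrow> link a' b' \<Longrightarrow> link (jn1 a a') (jn2 b b')"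
    and link_meet: "link a b \<Longrightarrow> link a' b' \<Longrightarrow> link (- jn1 (- a) (- a')) (- jn2 (- b) (- b'))"
    and link_norm: "link a b \<Longrightarrow> le1 0 a \<Longrightarrow> le2 0 b \<Longrightarrow> nm1 a \<le> nm2 b"
    and p: "1 < p" and r: "1 \<le> r"
    and combination1: "le1 0 x \<Longrightarrow> le1 0 x' \<Longrightarrow> \<exists>z. nm1 z powr p \<le> nm1 x powr p + nm1 x' powr p \<and>
        (\<forall>a b. 0 \<le> a \<longrightarrow> 0 \<le> b \<longrightarrow> a powr r + b powr r \<le> 1 \<longrightarrow> le1 (a *\<^sub>R x + b *\<^sub>R x') z)"
    and combination2: "le2 0 y \<Longrightarrow> le2 0 y' \<Longrightarrow> \<exists>z. nm2 z powr p \<le> nm2 y powr p + nm2 y' powr p \<and>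
        (\<forall>a b. 0 \<le> a \<longrightarrow> 0 \<le> b \<longrightarrow> a powr r + b powr r \<le> 1 \<longrightarrow> le2 (a *\<^sub>R y + b *\<^sub>R y') z)"
begin

text \<open>The pair \<open>(x, y)\<close> stands for the formal sum \<open>x + y\<close>, so the
  excess in the first component must be paid for by a gain in the second. The errors
  \<open>d\<close>, \<open>d'\<close> close the cone in norm.\<close>

definition pair_le :: "'a \<times> 'b \<Rightarrow> 'a \<times> 'b \<Rightarrow> bool" (infix \<open>\<sqsubseteq>\<close> 50) where
  "v \<sqsubseteq> w \<longleftrightarrow> (\<forall>e>0. \<exists>d d'. nm1 d \<le> e \<and> nm2 d' \<le> e \<and> link (fst v - fst w - d) (snd w - snd v + d'))"

lemma pair_le_E:
  assumes "v \<sqsubseteq> w" "0 < e"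
  obtains d d' where "nm1 d \<le> e" "nm2 d' \<le> e" "link (fst v - fst w - d) (snd w - snd v + d')"
  using assms unfolding pair_le_def by blast

lemma pair_le_I: "le1 (fst v) (fst w) \<Longrightarrow> le2 (snd v) (snd w) \<Longrightarrow> v \<sqsubseteq> w"
  unfolding pair_le_def
proof (intro allI impI exI[of _ 0] conjI)
  assume h: "le1 (fst v) (fst w)" "le2 (snd v) (snd w)"
  have 1: "le1 (fst v - fst w - 0) 0" using h(1) by (rule L1.le_cong_diff) simp
  have 2: "le2 0 (snd w - snd v + 0)" using h(2) by (rule L2.le_cong_diff) simp
  show "link (fst v - fst w - 0) (snd w - snd v + 0)" by (rule link_mono[OF link_zero 1 2])
qed auto

lemma pair_le_componentwise: "le1 x x' \<Longrightarrow> le2 y y' \<Longrightarrow> (x, y) \<sqsubseteq> (x', y')"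
  by (rule pair_le_I) auto

lemma pair_le_trans: assumes "v \<sqsubseteq> w" "w \<sqsubseteq> u" shows "v \<sqsubseteq> u"
  unfolding pair_le_def
proof (intro allI impI)
  fix e :: real assume e: "0 < e"
  then have e2: "0 < e/2" by simp
  obtain d d' where d: "nm1 d \<le> e/2" "nm2 d' \<le> e/2" "link (fst v - fst w - d) (snd w - snd v + d')"
    using pair_le_E[OF assms(1) e2] .
  obtain c c' where c: "nm1 c \<le> e/2" "nm2 c' \<le> e/2" "link (fst w - fst u - c) (snd u - snd w + c')"
    using pair_le_E[OF assms(2) e2] .
  have "link (fst v - fst u - (d + c)) (snd u - snd v + (d' + c'))"
    using link_add[OF d(3) c(3)] by (simp add: algebra_simps)
  moreover have "nm1 (d + c) \<le> e" "nm2 (d' + c') \<le> e"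
    using L1.nm_triangle[of d c] L2.nm_triangle[of d' c'] d c by auto
  ultimately show "\<exists>d d'. nm1 d \<le> e \<and> nm2 d' \<le> e \<and> link (fst v - fst u - d) (snd u - snd v + d')" by blast
qed

lemma pair_le_scaleR: assumes "0 \<le> c" "v \<sqsubseteq> w" shows "c *\<^sub>R v \<sqsubseteq> c *\<^sub>R w"
proof (cases "c = 0")
  case True then show ?thesis by (auto intro: pair_le_I)
next
  case False
  then have c: "0 < c" using assms by simp
  show ?thesis
    unfolding pair_le_def
  proof (intro allI impI)
    fix e :: real assume "0 < e"
    then have "0 < e/c" using c by simp
    from pair_le_E[OF assms(2) this]
    obtain d d' where d: "nm1 d \<le> e/c" "nm2 d' \<le> e/c" "link (fst v - fst w - d) (snd w - snd v + d')" .
    have "link (fst (c *\<^sub>R v) - fst (c *\<^sub>R w) - c *\<^sub>R d) (snd (c *\<^sub>R w) - snd (c *\<^sub>R v) + c *\<^sub>R d')"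
      using link_scaleR[OF _ d(3), of c] c by (simp add: algebra_simps)
    moreover have "nm1 (c *\<^sub>R d) \<le> e" "nm2 (c *\<^sub>R d') \<le> e"
      using d c by (auto simp: L1.nm_scaleR L2.nm_scaleR field_simps)
    ultimately show "\<exists>d d'. nm1 d \<le> e \<and> nm2 d' \<le> e \<and> link (fst (c *\<^sub>R v) - fst (c *\<^sub>R w) - d) (snd (c *\<^sub>R w) - snd (c *\<^sub>R v) + d')"
      by blast
  qed
qed

text \<open>Dividing by a large \<open>n\<close> turns \<open>x\<close> into a vector of small norm
  in both components, which the error terms absorb.\<close>

lemma pair_le_archimedean: assumes "\<And>n::nat. x \<sqsubseteq> real n *\<^sub>R w" shows "0 \<sqsubseteq> w"
  unfolding pair_le_def
proof (intro allI impI)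
  fix e :: real assume e: "0 < e"
  obtain n :: nat where n: "2 * (nm1 (fst x) + nm2 (snd x)) / e < real n" using reals_Archimedean2 by blast
  moreover have "0 \<le> 2 * (nm1 (fst x) + nm2 (snd x)) / e" using e by simp
  ultimately have n0: "0 < real n" by linarith
  then have n1: "1 \<le> real n" by simp
  have sm: "nm1 (fst x) / real n \<le> e/2" "nm2 (snd x) / real n \<le> e/2"
    using n n0 e L1.nm_nonneg[of "fst x"] L2.nm_nonneg[of "snd x"] 
    by (simp_all only: pos_divide_less_eq pos_divide_le_eq) (argo | linarith)+
  have e2: "0 < e/2" using e by simp
  obtain d d' where d: "nm1 d \<le> e/2" "nm2 d' \<le> e/2"
      "link (fst x - fst (real n *\<^sub>R w) - d) (snd (real n *\<^sub>R w) - snd x + d')"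
    using pair_le_E[OF assms[of n] e2] .
  let ?d = "(1 / real n) *\<^sub>R d - (1 / real n) *\<^sub>R fst x" and ?d' = "(1 / real n) *\<^sub>R d' - (1 / real n) *\<^sub>R snd x"
  have link: "link (fst 0 - fst w - ?d) (snd w - snd 0 + ?d')"
    using link_scaleR[OF _ d(3), of "1 / real n"] n0 by (simp add: scaleR_diff_right scaleR_add_right algebra_simps)
  have "nm1 d / real n \<le> e/2" "nm2 d' / real n \<le> e/2"
    using d(1,2) n0 mult_left_mono[OF n1, of "nm1 d"] mult_left_mono[OF n1, of "nm2 d'"]
      mult_left_mono[OF n1, of "e/2"] e by (simp_all only: pos_divide_le_eq L1.nm_nonneg L2.nm_nonneg) linarith+
  moreover have "nm1 ?d \<le> nm1 d / real n + nm1 (fst x) / real n" "nm2 ?d' \<le> nm2 d' / real n + nm2 (snd x) / real n"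
    using L1.nm_diff[of "(1 / real n) *\<^sub>R d" "(1 / real n) *\<^sub>R fst x"]
      L2.nm_diff[of "(1 / real n) *\<^sub>R d'" "(1 / real n) *\<^sub>R snd x"]
    by (simp_all add: L1.nm_scaleR L2.nm_scaleR)
  ultimately have "nm1 ?d \<le> e" "nm2 ?d' \<le> e" using sm by linarith+
  with link show "\<exists>d d'. nm1 d \<le> e \<and> nm2 d' \<le> e \<and> link (fst 0 - fst w - d) (snd w - snd 0 + d')" by blast
qed

sublocale P: archimedean_space pair_le
proof
  fix x y z w a b :: "'a \<times> 'b" and c :: real
  show "x \<sqsubseteq> x" by (rule pair_le_I) auto
  show "x \<sqsubseteq> y \<Longrightarrow> y \<sqsubseteq> z \<Longrightarrow> x \<sqsubseteq> z" by (rule pair_le_trans)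
  show "x \<sqsubseteq> y \<Longrightarrow> x + z \<sqsubseteq> y + z" by (simp add: pair_le_def)
  show "0 \<le> c \<Longrightarrow> x \<sqsubseteq> y \<Longrightarrow> c *\<^sub>R x \<sqsubseteq> c *\<^sub>R y" by (rule pair_le_scaleR)
  show "(\<And>n. x \<sqsubseteq> real n *\<^sub>R w) \<Longrightarrow> 0 \<sqsubseteq> w" by (rule pair_le_archimedean)
  have "a \<sqsubseteq> (jn1 (fst a) (fst b), jn2 (snd a) (snd b))" "b \<sqsubseteq> (jn1 (fst a) (fst b), jn2 (snd a) (snd b))"
    by (auto intro!: pair_le_I L1.jn_ub1 L1.jn_ub2 L2.jn_ub1 L2.jn_ub2)
  then show "\<exists>u. a \<sqsubseteq> u \<and> b \<sqsubseteq> u" by blast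
qed

lemma pair_le_closed: 
  assumes "\<And>e. 0 < e \<Longrightarrow> \<exists>x y. v \<sqsubseteq> (x, y) \<and> nm1 x \<le> e \<and> nm2 y \<le> e"
  shows "v \<sqsubseteq> 0"
  unfolding pair_le_def
proof (intro allI impI)
  fix e :: real assume "0 < e"
  then have e2: "0 < e/2" by simp
  from assms[OF this] obtain x y where xy: "v \<sqsubseteq> (x, y)" "nm1 x \<le> e/2" "nm2 y \<le> e/2" by blast
  from pair_le_E[OF xy(1) e2]
  obtain d d' where d: "nm1 d \<le> e/2" "nm2 d' \<le> e/2" "link (fst v - x - d) (y - snd v + d')" by auto
  have "link (fst v - fst 0 - (x + d)) (snd 0 - snd v + (y + d'))" using d(3) by (simp add: algebra_simps)
  moreover have "nm1 (x + d) \<le> e" "nm2 (y + d') \<le> e"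
    using L1.nm_triangle[of x d] L2.nm_triangle[of y d'] xy d by auto
  ultimately show "\<exists>d d'. nm1 d \<le> e \<and> nm2 d' \<le> e \<and> link (fst v - fst 0 - d) (snd 0 - snd v + d')" by blast
qed

end

section \<open>Joins under small perturbations\<close>

context seminormed_lattice
begin

lemma ab_add_bounds: "d \<sqsubseteq> ab d + ab d'" "d' \<sqsubseteq> ab d + ab d'"
  using le_add[OF jn_ub1[of d "- d"] ab_pos[of d']] le_add[OF ab_pos[of d] jn_ub1[of d' "- d'"]] by simp_all

lemma jn_perturb_upper: "jn (y + d) (y + d') \<sqsubseteq> y + (ab d + ab d')"
proof (rule jn_least)
  show "y + d \<sqsubseteq> y + (ab d + ab d')" using ab_add_bounds(1)[of d d'] by (rule le_cong_diff) simp
  show "y + d' \<sqsubseteq> y + (ab d + ab d')" using ab_add_bounds(2)[of d' d] by (rule le_cong_diff) simp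
qed

lemma jn_perturb_lower: "jn a b \<sqsubseteq> jn (a - x - d) (b - x - d') + x + (ab d + ab d')"
proof (rule jn_least)
  show "a \<sqsubseteq> jn (a - x - d) (b - x - d') + x + (ab d + ab d')"
    using jn_ub1[of "a - x - d" "b - x - d'"] ab_add_bounds(1)[of d d'] by (rule le_cong_diff2) (simp add: algebra_simps)
  show "b \<sqsubseteq> jn (a - x - d) (b - x - d') + x + (ab d + ab d')"
    using jn_ub2[of "b - x - d'" "a - x - d"] ab_add_bounds(2)[of d' d] by (rule le_cong_diff2) (simp add: algebra_simps)
qed

lemma nm_ab_add: "nm d \<le> e/2 \<Longrightarrow> nm d' \<le> e/2 \<Longrightarrow> nm (ab d + ab d') \<le> e"
  using nm_triangle[of "ab d" "ab d'"] by (simp add: nm_ab)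

end

context amalgam
begin

text \<open>The two links are joined and their errors merge into sums of absolute values, whence the
  choice of \<open>e/2\<close>. A join formed in \<open>X1\<close> is therefore least among all
  pairs above both elements.\<close>

lemma pair_le_join1: assumes "(a, 0) \<sqsubseteq> v" "(b, 0) \<sqsubseteq> v" shows "(jn1 a b, 0) \<sqsubseteq> v"
  unfolding pair_le_def
proof (intro allI impI)
  fix e :: real assume "0 < e"
  then have e2: "0 < e/2" by simp
  obtain d d' where d: "nm1 d \<le> e/2" "nm2 d' \<le> e/2" "link (a - fst v - d) (snd v + d')"
    using pair_le_E[OF assms(1) e2] by auto
  obtain c c' where c: "nm1 c \<le> e/2" "nm2 c' \<le> e/2" "link (b - fst v - c) (snd v + c')"
    using pair_le_E[OF assms(2) e2] by auto
  have 1: "le1 (jn1 a b - fst v - (L1.ab d + L1.ab c)) (jn1 (a - fst v - d) (b - fst v - c))"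
    using L1.jn_perturb_lower[of a b "fst v" d c] by (rule L1.le_cong_diff) (simp add: algebra_simps)
  have "link (jn1 a b - fst v - (L1.ab d + L1.ab c)) (snd v + (L2.ab d' + L2.ab c'))"
    by (rule link_mono[OF link_join[OF d(3) c(3)] 1 L2.jn_perturb_upper])
  moreover have "nm1 (L1.ab d + L1.ab c) \<le> e" "nm2 (L2.ab d' + L2.ab c') \<le> e"
    using d c by (auto intro: L1.nm_ab_add L2.nm_ab_add)
  ultimately show "\<exists>d d'. nm1 d \<le> e \<and> nm2 d' \<le> e \<and>
      link (fst (jn1 a b, 0::'b) - fst v - d) (snd v - snd (jn1 a b, 0) + d')"
    by (intro exI[of _ "L1.ab d + L1.ab c"] exI[of _ "L2.ab d' + L2.ab c'"]) simp
qed

text \<open>The second component enters a link as \<open>snd v - a\<close>, with \<open>a\<close>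
  negated, so a join in \<open>X2\<close> corresponds to a meet of links.\<close>

lemma pair_le_join2: assumes "(0, a) \<sqsubseteq> v" "(0, b) \<sqsubseteq> v" shows "(0, jn2 a b) \<sqsubseteq> v"
  unfolding pair_le_def
proof (intro allI impI)
  fix e :: real assume "0 < e"
  then have e2: "0 < e/2" by simp
  obtain d d' where d: "nm1 d \<le> e/2" "nm2 d' \<le> e/2" "link (- fst v - d) (snd v - a + d')"
    using pair_le_E[OF assms(1) e2] by auto
  obtain c c' where c: "nm1 c \<le> e/2" "nm2 c' \<le> e/2" "link (- fst v - c) (snd v - b + c')"
    using pair_le_E[OF assms(2) e2] by auto
  have link: "link (- jn1 (fst v + d) (fst v + c)) (- jn2 (a - snd v - d') (b - snd v - c'))"
    using link_meet[OF d(3) c(3)] by (simp add: algebra_simps)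
  have 1: "le1 (- fst v - (L1.ab d + L1.ab c)) (- jn1 (fst v + d) (fst v + c))"
    using L1.jn_perturb_upper[of "fst v" d c] by (rule L1.le_cong_diff) (simp add: algebra_simps)
  have 2: "le2 (- jn2 (a - snd v - d') (b - snd v - c')) (snd v - jn2 a b + (L2.ab d' + L2.ab c'))"
    using L2.jn_perturb_lower[of a b "snd v" d' c'] by (rule L2.le_cong_diff) (simp add: algebra_simps)
  have "link (- fst v - (L1.ab d + L1.ab c)) (snd v - jn2 a b + (L2.ab d' + L2.ab c'))"
    by (rule link_mono[OF link 1 2])
  moreover have "nm1 (L1.ab d + L1.ab c) \<le> e" "nm2 (L2.ab d' + L2.ab c') \<le> e"
    using d c by (auto intro: L1.nm_ab_add L2.nm_ab_add)
  ultimately show "\<exists>d d'. nm1 d \<le> e \<and> nm2 d' \<le> e \<and>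
      link (fst (0::'a, jn2 a b) - fst v - d) (snd v - snd (0::'a, jn2 a b) + d')"
    by (intro exI[of _ "L1.ab d + L1.ab c"] exI[of _ "L2.ab d' + L2.ab c'"]) simp
qed

text \<open>The link relates \<open>x - x1 - d\<close> to \<open>x2 + d'\<close>. Joining it with
  the trivial link makes both sides positive, so \<open>link_norm\<close> bounds the positive part
  of the excess \<open>x - x1 - d\<close> by the norm of \<open>x2\<close>, up to errors.\<close>

lemma pair_le_norm: 
  assumes "(x, 0) \<sqsubseteq> (x1, x2)" "le1 0 x" "le1 0 x1" "le2 0 x2"
  shows "nm1 x \<le> nm1 x1 + nm2 x2"
proof (rule field_le_epsilon)
  fix e :: real assume "0 < e"
  then have e2: "0 < e/2" by simp
  obtain d d' where d: "nm1 d \<le> e/2" "nm2 d' \<le> e/2" "link (x - x1 - d) (x2 + d')"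
    using pair_le_E[OF assms(1) e2] by auto
  let ?u = "L1.pp (x - x1 - d)" and ?w = "L2.pp (x2 + d')"
  have "nm1 ?u \<le> nm2 ?w"
    by (rule link_norm[OF link_join[OF d(3) link_zero]]) (rule L1.jn_ub2, rule L2.jn_ub2)
  also have "le2 ?w (x2 + L2.ab d')"
  proof (rule L2.jn_least)
    show "le2 (x2 + d') (x2 + L2.ab d')" using L2.jn_ub1[of d' "- d'"] by (rule L2.le_cong_diff) simp
    show "le2 0 (x2 + L2.ab d')" using L2.le_add[OF assms(4) L2.ab_pos[of d']] by simp
  qed
  then have "nm2 ?w \<le> nm2 (x2 + L2.ab d')" by (intro L2.nm_mono_pos L2.jn_ub2)
  also have "\<dots> \<le> nm2 x2 + e/2" using L2.nm_triangle[of x2 "L2.ab d'"] d(2) by (simp add: L2.nm_ab)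
  finally have u: "nm1 ?u \<le> nm2 x2 + e/2" .
  have "le1 x (x1 + L1.ab d + ?u)"
    using L1.jn_ub1[of "x - x1 - d" 0] L1.jn_ub1[of d "- d"] by (rule L1.le_cong_diff2) (simp add: algebra_simps)
  then have "nm1 x \<le> nm1 (x1 + L1.ab d + ?u)" by (rule L1.nm_mono_pos[OF assms(2)])
  also have "\<dots> \<le> nm1 x1 + nm1 (L1.ab d) + nm1 ?u"
    using L1.nm_triangle[of "x1 + L1.ab d" ?u] L1.nm_triangle[of x1 "L1.ab d"] by linarith
  also have "\<dots> \<le> nm1 x1 + nm2 x2 + e" using u d(1) by (simp add: L1.nm_ab)
  finally show "nm1 x \<le> nm1 x1 + nm2 x2 + e" .
qed

text \<open>Its supremum in the completion stands for the p-sum or the join of \<open>x\<close> and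
  \<open>y\<close>, according to \<open>r\<close>. It is an element that the class forces to have
  norm at most the p-norm of the two norms.\<close>

definition gen :: "'a \<Rightarrow> 'b \<Rightarrow> ('a \<times> 'b) set" where
  "gen x y = {(a *\<^sub>R x, b *\<^sub>R y) | a b. 0 \<le> a \<and> 0 \<le> b \<and> a powr r + b powr r \<le> 1}"

text \<open>A set \<open>G\<close> of pairs stands for its supremum in the Dedekind completion, and \<open>bounded_family t G\<close> says that this
  supremum belongs to \<open>t\<close> times the unit ball. The closure under convex combinations is what makes the
  resulting gauge subadditive for the class of upper \<open>p\<close>-estimates.\<close>

inductive bounded_family :: "real \<Rightarrow> ('a \<times> 'b) set \<Rightarrow> bool" where
  gen: "0 \<le> t \<Longrightarrow> le1 0 x \<Longrightarrow> le2 0 y \<Longrightarrow> nm1 x powr p + nm2 y powr p \<le> t powr p \<Longrightarrow> bounded_family t (gen x y)"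
| conv: "bounded_family t G \<Longrightarrow> bounded_family t G' \<Longrightarrow> 0 \<le> l \<Longrightarrow> l \<le> 1 \<Longrightarrow> bounded_family t {l *\<^sub>R a + (1 - l) *\<^sub>R b | a b. a \<in> G \<and> b \<in> G'}"

lemma bounded_family_nonneg: "bounded_family t G \<Longrightarrow> 0 \<le> t"
  by (induction rule: bounded_family.induct) auto

lemma bounded_family_zero_mem: "bounded_family t G \<Longrightarrow> 0 \<in> G"
proof (induction rule: bounded_family.induct)
  case (gen t x y)
  then show ?case using r by (auto simp: gen_def zero_prod_def intro!: exI[of _ 0])
next
  case (conv t G G' l)
  then show ?case by (intro CollectI exI[of _ 0]) simp
qed

lemma bounded_family_mono: "bounded_family t G \<Longrightarrow> t \<le> t' \<Longrightarrow> bounded_family t' G"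
proof (induction rule: bounded_family.induct)
  case (gen t x y)
  have "t powr p \<le> t' powr p" using gen p by (intro powr_mono2) auto
  then show ?case using gen by (intro bounded_family.gen) auto
next
  case (conv t G G' l)
  then show ?case by (intro bounded_family.conv) auto
qed

text \<open>The induction step shared by several proofs: for maps affine along the combination,
  combining two dominating families dominates the image. The set \<open>F\<close> holds all
  coefficients for which one and the same \<open>K\<close> has to work.\<close>

lemma bounded_family_conv_affine:
  assumes "\<exists>K. bounded_family t K \<and> (\<forall>f\<in>F. \<forall>a\<in>G. \<exists>k\<in>K. f a \<sqsubseteq> k)" "\<exists>K. bounded_family t K \<and> (\<forall>f\<in>F. \<forall>b\<in>G'. \<exists>k\<in>K. f b \<sqsubseteq> k)"
    and l: "0 \<le> l" "l \<le> 1" and affine: "\<And>f a b. f \<in> F \<Longrightarrow> f (l *\<^sub>R a + (1 - l) *\<^sub>R b) = l *\<^sub>R f a + (1 - l) *\<^sub>R f b"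
  shows "\<exists>K. bounded_family t K \<and> (\<forall>f\<in>F. \<forall>a\<in>{l *\<^sub>R a + (1 - l) *\<^sub>R b | a b. a \<in> G \<and> b \<in> G'}. \<exists>k\<in>K. f a \<sqsubseteq> k)"
proof -
  obtain K1 where K1: "bounded_family t K1" "\<forall>f\<in>F. \<forall>a\<in>G. \<exists>k\<in>K1. f a \<sqsubseteq> k" using assms(1) by blast
  obtain K2 where K2: "bounded_family t K2" "\<forall>f\<in>F. \<forall>b\<in>G'. \<exists>k\<in>K2. f b \<sqsubseteq> k" using assms(2) by blast
  let ?K = "{l *\<^sub>R a + (1 - l) *\<^sub>R b | a b. a \<in> K1 \<and> b \<in> K2}"
  have "\<exists>k\<in>?K. f (l *\<^sub>R a + (1 - l) *\<^sub>R b) \<sqsubseteq> k" if h: "f \<in> F" "a \<in> G" "b \<in> G'" for f a b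
  proof -
    obtain k k' where k: "k \<in> K1" "f a \<sqsubseteq> k" "k' \<in> K2" "f b \<sqsubseteq> k'"
      using bspec[OF bspec[OF K1(2) h(1)] h(2)] bspec[OF bspec[OF K2(2) h(1)] h(3)] by blast
    then have "l *\<^sub>R f a + (1 - l) *\<^sub>R f b \<sqsubseteq> l *\<^sub>R k + (1 - l) *\<^sub>R k'" using l by (intro P.le_add P.le_scaleR) auto
    moreover have "l *\<^sub>R k + (1 - l) *\<^sub>R k' \<in> ?K" using k by blast
    ultimately show ?thesis unfolding affine[OF h(1)] by blast
  qed
  moreover have "bounded_family t ?K" using K1 K2 l by (intro bounded_family.conv)
  ultimately show ?thesis by blast
qed

lemma bounded_family_scale: "bounded_family t G \<Longrightarrow> 0 \<le> c \<Longrightarrow> \<exists>K. bounded_family (c * t) K \<and> (\<forall>g\<in>G. \<exists>k\<in>K. c *\<^sub>R g \<sqsubseteq> k)"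
proof (induction rule: bounded_family.induct)
  case (gen t x y)
  have "nm1 (c *\<^sub>R x) powr p + nm2 (c *\<^sub>R y) powr p = c powr p * (nm1 x powr p + nm2 y powr p)"
    using gen by (simp add: L1.nm_scaleR L2.nm_scaleR powr_mult distrib_left)
  also have "\<dots> \<le> c powr p * t powr p" using gen by (intro mult_left_mono) auto
  also have "\<dots> = (c * t) powr p" using gen by (simp add: powr_mult)
  finally have "bounded_family (c * t) (gen (c *\<^sub>R x) (c *\<^sub>R y))"
    using gen L1.le_scaleR[of c 0 x] L2.le_scaleR[of c 0 y] by (intro bounded_family.gen) auto
  moreover have "c *\<^sub>R g \<in> gen (c *\<^sub>R x) (c *\<^sub>R y)" if "g \<in> gen x y" for g
    using that unfolding gen_def by (force simp: mult.commute)
  ultimately show ?case using P.le_refl by blast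
next
  case (conv t G G' l)
  then show ?case using bounded_family_conv_affine[of "c * t" "{\<lambda>g. c *\<^sub>R g}" G G' l] by (simp add: algebra_simps)
qed

text \<open>The class property is applied in each lattice separately, to \<open>x\<close>,
  \<open>x'\<close> and to \<open>y\<close>, \<open>y'\<close>. The resulting vectors generate one
  family that dominates all mixed combinations.\<close>

lemma bounded_family_combination_gen:
  assumes g: "0 \<le> s" "le1 0 x" "le2 0 y" "nm1 x powr p + nm2 y powr p \<le> s powr p"
    and g': "0 \<le> t" "le1 0 x'" "le2 0 y'" "nm1 x' powr p + nm2 y' powr p \<le> t powr p"
  shows "\<exists>K. bounded_family ((s powr p + t powr p) powr (1/p)) K \<and> (\<forall>a\<in>gen x y. \<forall>b\<in>gen x' y'. \<forall>c d. 0 \<le> c \<longrightarrow> 0 \<le> d \<longrightarrow>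
      c powr r + d powr r \<le> 1 \<longrightarrow> (\<exists>k\<in>K. c *\<^sub>R a + d *\<^sub>R b \<sqsubseteq> k))"
proof -
  obtain u where u: "nm1 u powr p \<le> nm1 x powr p + nm1 x' powr p"
      "\<forall>a b. 0 \<le> a \<longrightarrow> 0 \<le> b \<longrightarrow> a powr r + b powr r \<le> 1 \<longrightarrow> le1 (a *\<^sub>R x + b *\<^sub>R x') u"
    using combination1[OF g(2) g'(2)] by blast
  obtain w where w: "nm2 w powr p \<le> nm2 y powr p + nm2 y' powr p"
      "\<forall>a b. 0 \<le> a \<longrightarrow> 0 \<le> b \<longrightarrow> a powr r + b powr r \<le> 1 \<longrightarrow> le2 (a *\<^sub>R y + b *\<^sub>R y') w"
    using combination2[OF g(3) g'(3)] by blast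
  have pos: "le1 0 u" "le2 0 w" using u(2)[rule_format, of 0 0] w(2)[rule_format, of 0 0] r by auto
  have "((s powr p + t powr p) powr (1/p)) powr p = s powr p + t powr p" using p by (simp add: powr_powr)
  then have bounded_family: "bounded_family ((s powr p + t powr p) powr (1/p)) (gen u w)"
    using u(1) w(1) g(4) g'(4) pos by (intro bounded_family.gen) auto
  have "\<exists>k\<in>gen u w. c *\<^sub>R v + d *\<^sub>R v' \<sqsubseteq> k"
    if v: "v \<in> gen x y" "v' \<in> gen x' y'" and cd: "0 \<le> c" "0 \<le> d" "c powr r + d powr r \<le> 1" for v v' c d
  proof -
    obtain a b where ab: "v = (a *\<^sub>R x, b *\<^sub>R y)" "0 \<le> a" "0 \<le> b" "a powr r + b powr r \<le> 1" using v(1) by (auto simp: gen_def)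
    obtain a' b' where ab': "v' = (a' *\<^sub>R x', b' *\<^sub>R y')" "0 \<le> a'" "0 \<le> b'" "a' powr r + b' powr r \<le> 1" using v(2) by (auto simp: gen_def)
    \<comment> \<open>\<open>m\<close> and \<open>n\<close> collect the r-th powers of the
      coefficients that fall to \<open>X1\<close> and to \<open>X2\<close>. Regrouped by
      \<open>c\<close> and \<open>d\<close> they add up to at most 1, so their r-th roots are
      admissible coefficients for \<open>gen u w\<close>.\<close>
    define m where "m = (c * a) powr r + (d * a') powr r"
    define n where "n = (c * b) powr r + (d * b') powr r"
    have mn0: "0 \<le> m" "0 \<le> n" by (auto simp: m_def n_def)
    have "m + n = c powr r * (a powr r + b powr r) + d powr r * (a' powr r + b' powr r)"
      using ab ab' cd by (simp add: m_def n_def powr_mult algebra_simps)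
    also have "\<dots> \<le> c powr r * 1 + d powr r * 1" using ab ab' by (intro add_mono mult_left_mono) auto
    finally have "m + n \<le> 1" using cd by simp
    then have "(m powr (1/r)) powr r + (n powr (1/r)) powr r \<le> 1" using mn0 r by (simp add: powr_powr)
    then have "(m powr (1/r) *\<^sub>R u, n powr (1/r) *\<^sub>R w) \<in> gen u w" 
      unfolding gen_def by (intro CollectI exI[of _ "m powr (1/r)"] exI[of _ "n powr (1/r)"]) simp
    moreover have "le1 ((c * a) *\<^sub>R x + (d * a') *\<^sub>R x') (m powr (1/r) *\<^sub>R u)"
      unfolding m_def using L1.combination_homogeneous[OF u(2)] r cd ab ab' by simp
    moreover have "le2 ((c * b) *\<^sub>R y + (d * b') *\<^sub>R y') (n powr (1/r) *\<^sub>R w)"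
      unfolding n_def using L2.combination_homogeneous[OF w(2)] r cd ab ab' by simp
    ultimately show ?thesis
      by (intro bexI[of _ "(m powr (1/r) *\<^sub>R u, n powr (1/r) *\<^sub>R w)"] pair_le_I) (auto simp: ab ab')
  qed
  with bounded_family show ?thesis by blast
qed

text \<open>Induction on both derivations works because \<open>c a + d b\<close> is affine in each
  argument while the other is fixed. The order of quantifiers, \<open>K\<close> before the
  coefficients, is the reason for the sets of maps \<open>?F\<close>.\<close>

lemma bounded_family_combination:
  assumes "bounded_family s G" "bounded_family t G'"
  shows "\<exists>K. bounded_family ((s powr p + t powr p) powr (1/p)) K \<and> (\<forall>a\<in>G. \<forall>b\<in>G'. \<forall>c d. 0 \<le> c \<longrightarrow> 0 \<le> d \<longrightarrow>
      c powr r + d powr r \<le> 1 \<longrightarrow> (\<exists>k\<in>K. c *\<^sub>R a + d *\<^sub>R b \<sqsubseteq> k))"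
  using assms(1)
proof (induction rule: bounded_family.induct)
  case (gen s x y)
  from assms(2) show ?case
  proof (induction rule: bounded_family.induct)
    case (gen t x' y')
    then show ?case using \<open>0 \<le> s\<close> \<open>le1 0 x\<close> \<open>le2 0 y\<close> \<open>nm1 x powr p + nm2 y powr p \<le> s powr p\<close>
      by (intro bounded_family_combination_gen)
  next
    case (conv t G1 G2 l)
    let ?T = "(s powr p + t powr p) powr (1/p)"
    let ?F = "{\<lambda>b. c *\<^sub>R a + d *\<^sub>R b | a c d. a \<in> gen x y \<and> 0 \<le> c \<and> 0 \<le> d \<and> c powr r + d powr r \<le> 1}"
    have "\<exists>K. bounded_family ?T K \<and> (\<forall>f\<in>?F. \<forall>b\<in>{l *\<^sub>R a + (1 - l) *\<^sub>R b | a b. a \<in> G1 \<and> b \<in> G2}. \<exists>k\<in>K. f b \<sqsubseteq> k)"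
    proof (rule bounded_family_conv_affine)
      show "\<exists>K. bounded_family ?T K \<and> (\<forall>f\<in>?F. \<forall>b\<in>G1. \<exists>k\<in>K. f b \<sqsubseteq> k)" using conv.IH(1) by (elim ex_forward conj_forward) (assumption, blast)
      show "\<exists>K. bounded_family ?T K \<and> (\<forall>f\<in>?F. \<forall>b\<in>G2. \<exists>k\<in>K. f b \<sqsubseteq> k)" using conv.IH(2) by (elim ex_forward conj_forward) (assumption, blast)
    qed (use conv in \<open>auto simp: algebra_simps\<close>)
    then obtain K where K: "bounded_family ?T K" "\<forall>f\<in>?F. \<forall>b\<in>{l *\<^sub>R a + (1 - l) *\<^sub>R b | a b. a \<in> G1 \<and> b \<in> G2}. \<exists>k\<in>K. f b \<sqsubseteq> k"
      by (elim exE conjE) (rule that)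
    show ?case
    proof (intro exI[of _ K] conjI ballI allI impI K(1))
      fix a b c d assume "a \<in> gen x y" "0 \<le> c" "0 \<le> d" "c powr r + d powr r \<le> 1"
        and b: "b \<in> {l *\<^sub>R a + (1 - l) *\<^sub>R b | a b. a \<in> G1 \<and> b \<in> G2}"
      then have "(\<lambda>b. c *\<^sub>R a + d *\<^sub>R b) \<in> ?F" by blast
      from bspec[OF bspec[OF K(2) this] b] show "\<exists>k\<in>K. c *\<^sub>R a + d *\<^sub>R b \<sqsubseteq> k" .
    qed
  qed
next
  case (conv s G1 G2 l)
  let ?T = "(s powr p + t powr p) powr (1/p)"
  let ?F = "{\<lambda>a. c *\<^sub>R a + d *\<^sub>R b | b c d. b \<in> G' \<and> 0 \<le> c \<and> 0 \<le> d \<and> c powr r + d powr r \<le> 1}"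
  have "\<exists>K. bounded_family ?T K \<and> (\<forall>f\<in>?F. \<forall>a\<in>{l *\<^sub>R a + (1 - l) *\<^sub>R b | a b. a \<in> G1 \<and> b \<in> G2}. \<exists>k\<in>K. f a \<sqsubseteq> k)"
  proof (rule bounded_family_conv_affine)
    show "\<exists>K. bounded_family ?T K \<and> (\<forall>f\<in>?F. \<forall>a\<in>G1. \<exists>k\<in>K. f a \<sqsubseteq> k)" using conv.IH(1) by (elim ex_forward conj_forward) (assumption, blast)
    show "\<exists>K. bounded_family ?T K \<and> (\<forall>f\<in>?F. \<forall>a\<in>G2. \<exists>k\<in>K. f a \<sqsubseteq> k)" using conv.IH(2) by (elim ex_forward conj_forward) (assumption, blast)
  qed (use conv in \<open>auto simp: algebra_simps\<close>)
  then obtain K where K: "bounded_family ?T K" "\<forall>f\<in>?F. \<forall>a\<in>{l *\<^sub>R a + (1 - l) *\<^sub>R b | a b. a \<in> G1 \<and> b \<in> G2}. \<exists>k\<in>K. f a \<sqsubseteq> k"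
    by (elim exE conjE) (rule that)
  show ?case
  proof (intro exI[of _ K] conjI ballI allI impI K(1))
    fix a b c d assume "b \<in> G'" "0 \<le> c" "0 \<le> d" "c powr r + d powr r \<le> 1"
      and a: "a \<in> {l *\<^sub>R a + (1 - l) *\<^sub>R b | a b. a \<in> G1 \<and> b \<in> G2}"
    then have "(\<lambda>a. c *\<^sub>R a + d *\<^sub>R b) \<in> ?F" by blast
    from bspec[OF bspec[OF K(2) this] a] show "\<exists>k\<in>K. c *\<^sub>R a + d *\<^sub>R b \<sqsubseteq> k" .
  qed
qed

text \<open>A generator lies below \<open>(x, y)\<close>, since its coefficients are at most 1, and
  the power mean bounds the sum of norms. That sum is convex, so the constant does not grow under
  convex combinations.\<close>

lemma bounded_family_bound:
  "bounded_family t G \<Longrightarrow> \<exists>x y. le1 0 x \<and> le2 0 y \<and> nm1 x + nm2 y \<le> 2 powr (1 - 1/p) * t \<and> G \<subseteq> P.dn (x, y)"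
proof (induction rule: bounded_family.induct)
  case (gen t x y)
  have "nm1 x + nm2 y \<le> 2 powr (1 - 1/p) * (nm1 x powr p + nm2 y powr p) powr (1/p)"
    using p by (intro powr_power_mean) auto
  also have "(nm1 x powr p + nm2 y powr p) powr (1/p) \<le> (t powr p) powr (1/p)"
    using gen p by (intro powr_mono2) auto
  also have "(t powr p) powr (1/p) = t" using gen p by (simp add: powr_powr)
  finally have "nm1 x + nm2 y \<le> 2 powr (1 - 1/p) * t" by simp
  moreover have "(a *\<^sub>R x, b *\<^sub>R y) \<sqsubseteq> (x, y)" if ab: "0 \<le> a" "0 \<le> b" "a powr r + b powr r \<le> 1" for a b
  proof -
    have "a powr r \<le> 1" "b powr r \<le> 1" using ab(3) powr_ge_zero[of a r] powr_ge_zero[of b r] by linarith+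
    then have "a \<le> 1" "b \<le> 1" using abs_le_1_if_powr_le_1[of a r] abs_le_1_if_powr_le_1[of b r] ab(1,2) r by auto
    then have "le1 (a *\<^sub>R x) x" "le2 (b *\<^sub>R y) y"
      using L1.le_cong_scaleR[OF gen(2), of "1 - a" x "a *\<^sub>R x"] L2.le_cong_scaleR[OF gen(3), of "1 - b" y "b *\<^sub>R y"]
      by (auto simp: algebra_simps)
    then show ?thesis by (rule pair_le_componentwise)
  qed
  ultimately show ?case using gen by (intro exI[of _ x] exI[of _ y]) (auto simp: gen_def P.dn_def)
next
  case (conv t G G' l)
  then obtain x y x' y' where 1: "le1 0 x" "le2 0 y" "nm1 x + nm2 y \<le> 2 powr (1 - 1/p) * t" "G \<subseteq> P.dn (x, y)"
    and 2: "le1 0 x'" "le2 0 y'" "nm1 x' + nm2 y' \<le> 2 powr (1 - 1/p) * t" "G' \<subseteq> P.dn (x', y')" by blast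
  let ?x = "l *\<^sub>R x + (1 - l) *\<^sub>R x'" and ?y = "l *\<^sub>R y + (1 - l) *\<^sub>R y'"
  have pos: "le1 0 ?x" "le2 0 ?y"
    using L1.le_add[OF L1.le_scaleR[of l 0 x] L1.le_scaleR[of "1 - l" 0 x']]
      L2.le_add[OF L2.le_scaleR[of l 0 y] L2.le_scaleR[of "1 - l" 0 y']] 1 2 conv by auto
  have "nm1 ?x + nm2 ?y \<le> l * (nm1 x + nm2 y) + (1 - l) * (nm1 x' + nm2 y')"
  proof -
    have "nm1 ?x \<le> l * nm1 x + (1 - l) * nm1 x'"
      using L1.nm_triangle[of "l *\<^sub>R x" "(1 - l) *\<^sub>R x'"] conv(3,4) by (simp add: L1.nm_scaleR)
    moreover have "nm2 ?y \<le> l * nm2 y + (1 - l) * nm2 y'"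
      using L2.nm_triangle[of "l *\<^sub>R y" "(1 - l) *\<^sub>R y'"] conv(3,4) by (simp add: L2.nm_scaleR)
    ultimately show ?thesis by (simp add: distrib_left)
  qed
  also have "\<dots> \<le> l * (2 powr (1 - 1/p) * t) + (1 - l) * (2 powr (1 - 1/p) * t)"
    using 1 2 conv by (intro add_mono mult_left_mono) auto
  finally have n: "nm1 ?x + nm2 ?y \<le> 2 powr (1 - 1/p) * t" by (simp add: algebra_simps)
  have "l *\<^sub>R a + (1 - l) *\<^sub>R b \<sqsubseteq> (?x, ?y)" if "a \<in> G" "b \<in> G'" for a b
  proof -
    have "a \<sqsubseteq> (x, y)" "b \<sqsubseteq> (x', y')" using that 1 2 by (auto simp: P.dn_def)
    then have "l *\<^sub>R a + (1 - l) *\<^sub>R b \<sqsubseteq> l *\<^sub>R (x, y) + (1 - l) *\<^sub>R (x', y')" using conv by (intro P.le_add P.le_scaleR) auto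
    then show ?thesis by simp
  qed
  then show ?case using pos n by (intro exI[of _ ?x] exI[of _ ?y]) (auto simp: P.dn_def)
qed

text \<open>The coefficients \<open>1/2\<close>, \<open>1/2\<close> are admissible because
  \<open>r >= 1\<close>, and doubling both vectors compensates for them. The crude factor 2 is
  harmless for finiteness and convergence of the gauge; the norms of the embedded spaces are
  estimated separately.\<close>

lemma bounded_family_dominates_pair: 
  assumes "le1 0 x" "le2 0 y" shows "\<exists>G. bounded_family (2 * (nm1 x + nm2 y)) G \<and> (x, y) \<in> G"
proof -
  have "nm1 (2 *\<^sub>R x) powr p + nm2 (2 *\<^sub>R y) powr p \<le> (nm1 (2 *\<^sub>R x) + nm2 (2 *\<^sub>R y)) powr p"
    using p by (intro powr_add_le) auto
  then have "bounded_family (2 * (nm1 x + nm2 y)) (gen (2 *\<^sub>R x) (2 *\<^sub>R y))"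
    using assms L1.le_scaleR[of 2 0 x] L2.le_scaleR[of 2 0 y]
    by (intro bounded_family.gen) (auto simp: L1.nm_scaleR L2.nm_scaleR distrib_left)
  moreover have "(1/2::real) powr r \<le> (1/2) powr 1" using r by (intro powr_mono') auto
  then have "(1/2::real) powr r + (1/2) powr r \<le> 1" by simp
  then have "(x, y) \<in> gen (2 *\<^sub>R x) (2 *\<^sub>R y)"
    unfolding gen_def by (intro CollectI exI[of _ "1/2"]) auto
  ultimately show ?thesis by blast
qed

end

section \<open>The gauge on the Dedekind completion\<close>

context archimedean_space
begin

primrec csum :: "(nat \<Rightarrow> 'a set) \<Rightarrow> nat \<Rightarrow> 'a set" where
  "csum f 0 = dn 0"
| "csum f (Suc n) = cadd (csum f n) (f n)"

lemma cut_csum: "(\<And>k. k < n \<Longrightarrow> cut (f k)) \<Longrightarrow> cut (csum f n)"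
  by (induction n) (auto intro: cut_cadd)

lemma cneg_cscal: "cut A \<Longrightarrow> cneg (cscal c A) = cscal c (cneg A)"
  using cscal_minus[of A c] cscal_minus[of A 1] cscal_cscal[of A c "-1"] by simp

lemma cl_dn_0: "0 \<in> A \<Longrightarrow> dn 0 \<subseteq> cl A"
  using cl_down[of 0 A] cl_increasing[of A] by (auto simp: dn_def)

definition cabs :: "'a set \<Rightarrow> 'a set" where "cabs A = cl (A \<union> cneg A)"

lemma cut_cabs: "cut A \<Longrightarrow> cut (cabs A)"
  unfolding cabs_def by (intro cut_join cut_cneg)

lemma cabs_ge: "A \<subseteq> cabs A" "cneg A \<subseteq> cabs A"
  unfolding cabs_def using cl_increasing by blast+

lemma cabs_least: "cut E \<Longrightarrow> A \<subseteq> E \<Longrightarrow> cneg A \<subseteq> E \<Longrightarrow> cabs A \<subseteq> E"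
  unfolding cabs_def by (simp add: cl_subset_cut)

lemma cabs_nonneg: assumes A: "cut A" shows "dn 0 \<subseteq> cabs A"
proof -
  have "0 \<sqsubseteq> u" if u: "u \<in> ub (cabs A)" for u
  proof -
    have "cadd A (cneg A) \<subseteq> dn (u + u)"
      unfolding cadd_subset_iff[OF cut_dn] using u cabs_ge[of A] by (auto simp: ub_def dn_def intro!: le_add)
    then have "0 \<sqsubseteq> u + u" unfolding cadd_cneg[OF A] by (auto simp: dn_def)
    then show ?thesis
      by (rule le_cong_scaleR[where t="1/2"]) (auto simp: algebra_simps scaleR_left_distrib[symmetric])
  qed
  then have "0 \<in> cabs A" using in_cut_iff[OF cut_cabs[OF A]] by blast
  then show ?thesis using dn_subset_cut[OF cut_cabs[OF A]] by blast
qed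

lemma cscal_subset_cut:
  assumes B: "cut B" "dn 0 \<subseteq> B" and A: "A \<subseteq> B" and c: "0 \<le> c" "c \<le> 1"
  shows "cscal c A \<subseteq> B"
proof (cases "c = 0")
  case False
  then have c0: "0 < c" using c by simp
  have "c *\<^sub>R v \<in> B" if "v \<in> A" for v
    unfolding in_cut_iff[OF B(1)]
  proof
    fix u assume u: "u \<in> ub B"
    have "0 \<in> B" using B(2) self_in_dn by blast
    then have "v \<sqsubseteq> u" "0 \<sqsubseteq> u" using u that A by (auto simp: ub_def)
    then have "c *\<^sub>R v + (1 - c) *\<^sub>R 0 \<sqsubseteq> c *\<^sub>R u + (1 - c) *\<^sub>R u" using c by (intro le_add le_scaleR) auto
    then show "c *\<^sub>R v \<sqsubseteq> u" by (simp add: algebra_simps)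
  qed
  then show ?thesis by (auto simp: cscal_pos[OF c0])
qed (use B in simp)

lemma cscal_subset_cabs: assumes A: "cut A" and c: "\<bar>c\<bar> \<le> 1" shows "cscal c A \<subseteq> cabs A"
proof (cases "0 \<le> c")
  case True
  then show ?thesis using c A by (intro cscal_subset_cut cut_cabs cabs_nonneg cabs_ge) auto
next
  case False
  have "cscal c A = cscal (- c) (cneg A)"
    using cscal_minus[OF A, of "- c"] cneg_cscal[OF A, of "- c"] by simp
  also have "\<dots> \<subseteq> cabs A"
    using False c A by (intro cscal_subset_cut cut_cabs cabs_nonneg cabs_ge) auto
  finally show ?thesis .
qed

lemma csum_mono: "(\<And>k. k < n \<Longrightarrow> cut (g k)) \<Longrightarrow> (\<And>k. k < n \<Longrightarrow> f k \<subseteq> g k) \<Longrightarrow> csum f n \<subseteq> csum g n"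
proof (induction n)
  case (Suc n)
  then have "csum f n \<subseteq> csum g n" "f n \<subseteq> g n" by auto
  then show ?case unfolding csum.simps cadd_def by (intro cl_mono) blast
qed simp

lemma cut_Int: assumes A: "cut A" and B: "cut B" shows "cut (A \<inter> B)"
proof -
  obtain a b where a: "a \<in> A" and b: "b \<in> B" using A B by (auto simp: cut_def)
  obtain u where "- a \<sqsubseteq> u" "- b \<sqsubseteq> u" using directed by blast
  then have "- u \<sqsubseteq> a" "- u \<sqsubseteq> b" using le_minus_iff[of "- u" a] le_minus_iff[of u "- a"] le_minus_iff[of u "- b"] by simp_all
  then have "- u \<in> A \<inter> B" using a b cut_down A B by blast
  moreover have "cl (A \<inter> B) \<subseteq> A \<inter> B" using cl_subset_cut[OF A, of "A \<inter> B"] cl_subset_cut[OF B, of "A \<inter> B"] by blast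
  moreover have "ub A \<subseteq> ub (A \<inter> B)" by (intro ub_antimono) auto
  ultimately show ?thesis using A cl_increasing[of "A \<inter> B"] unfolding cut_def by blast
qed

text \<open>Since \<open>B\<close> and \<open>S\<close> are both below \<open>E\<close>, the cut
  \<open>S + B - E\<close> lies below \<open>S\<close> and below \<open>B\<close>, hence below
  0.\<close>

lemma disjoint_add:
  assumes S: "cut S" and B: "cut B" and E: "cut E" and sub: "S \<subseteq> E" "B \<subseteq> E" and d: "S \<inter> B \<subseteq> dn 0"
  shows "cadd S B \<subseteq> E"
proof -
  have SB: "cut (cadd S B)" by (rule cut_cadd[OF S B])
  have "cadd B S \<subseteq> cadd E S" "cadd S B \<subseteq> cadd E B" 
    using cadd_mono[OF E S sub(2)] cadd_mono[OF E B sub(1)] .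
  then have "cadd S B \<subseteq> cadd S E" "cadd S B \<subseteq> cadd B E"
    by (simp_all add: cadd_commute[of B S] cadd_commute[of S E] cadd_commute[of B E])
  then have "cadd (cadd S B) (cneg E) \<subseteq> S" "cadd (cadd S B) (cneg E) \<subseteq> B"
    using cadd_cneg_subset_iff[OF SB E S] cadd_cneg_subset_iff[OF SB E B] by blast+
  then have "cadd (cadd S B) (cneg E) \<subseteq> dn 0" using d by blast
  then show ?thesis using cadd_cneg_subset_iff[OF SB E cut_dn] cadd_zero[OF E] by simp
qed

text \<open>Adding one summand at a time requires that the partial sum stay disjoint from the later
  ones. If \<open>v\<close> is below \<open>?S + B n\<close> and below \<open>B j\<close>, then
  \<open>v - ?S\<close> is below \<open>B n\<close> and \<open>B j\<close>, so \<open>v\<close> is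
  already below \<open>?S\<close>.\<close>

lemma disjoint_csum:
  assumes "\<And>k. k < m \<Longrightarrow> cut (B k)" "\<And>k. k < m \<Longrightarrow> dn 0 \<subseteq> B k" "n \<le> m"
    and d: "\<And>i j. i < m \<Longrightarrow> j < m \<Longrightarrow> i \<noteq> j \<Longrightarrow> B i \<inter> B j \<subseteq> dn 0"
  shows "dn 0 \<subseteq> csum B n \<and> (\<forall>j. n \<le> j \<and> j < m \<longrightarrow> csum B n \<inter> B j \<subseteq> dn 0)"
  using \<open>n \<le> m\<close>
proof (induction n)
  case (Suc n)
  let ?S = "csum B n"
  have S: "cut ?S" using Suc assms(1) by (intro cut_csum) auto
  have B: "cut (B n)" using Suc assms(1) by auto
  have S0: "dn 0 \<subseteq> ?S" and dS: "?S \<inter> B j \<subseteq> dn 0" if "n \<le> j" "j < m" for j using Suc that by auto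
  have "0 \<in> ?S" "0 \<in> B n" using Suc assms(2)[of n] by auto
  from cadd_memI[OF this] have "0 \<in> cadd ?S (B n)" by simp
  then have 1: "dn 0 \<subseteq> csum B (Suc n)" using dn_subset_cut[OF cut_cadd[OF S B]] by simp
  have 2: "csum B (Suc n) \<inter> B j \<subseteq> dn 0" if j: "Suc n \<le> j" "j < m" for j
  proof
    fix v assume v: "v \<in> csum B (Suc n) \<inter> B j"
    have Bj: "cut (B j)" using j assms(1) by auto
    have "dn v \<subseteq> cadd (B n) ?S"
      using v dn_subset_cut[OF cut_cadd[OF B S]] by (simp add: cadd_commute[of "B n"])
    then have 3: "cadd (dn v) (cneg ?S) \<subseteq> B n" using cadd_cneg_subset_iff[OF cut_dn S B] by blast
    have "cneg ?S \<subseteq> dn 0" using cneg_antimono[of "dn 0" ?S] S0[of j] j by (simp add: cneg_dn)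
    then have "cadd (cneg ?S) (dn v) \<subseteq> cadd (dn 0) (dn v)" by (intro cadd_mono cut_dn)
    then have "cadd (dn v) (cneg ?S) \<subseteq> dn v" by (simp add: cadd_zero cadd_commute[of "dn v"])
    also have "dn v \<subseteq> B j" using v dn_subset_cut[OF Bj] by blast
    finally have "cadd (dn v) (cneg ?S) \<subseteq> dn 0" using 3 d[of n j] j by auto
    then have "dn v \<subseteq> ?S" using cadd_cneg_subset_iff[OF cut_dn S cut_dn, of v 0] cadd_zero[OF S] by simp
    then have "v \<in> ?S" using self_in_dn by blast
    then show "v \<in> dn 0" using v dS[of j] j by auto
  qed
  show ?case using 1 2 by blast
qed (use assms(2) in auto)

lemma disjoint_csum_subset:
  assumes "\<And>k. k < n \<Longrightarrow> cut (B k)" "\<And>k. k < n \<Longrightarrow> dn 0 \<subseteq> B k" "cut E" "dn 0 \<subseteq> E"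
    and "\<And>i j. i < n \<Longrightarrow> j < n \<Longrightarrow> i \<noteq> j \<Longrightarrow> B i \<inter> B j \<subseteq> dn 0" and "\<And>k. k < n \<Longrightarrow> B k \<subseteq> E"
  shows "csum B n \<subseteq> E"
proof -
  have "m \<le> n \<Longrightarrow> csum B m \<subseteq> E" for m
  proof (induction m)
    case (Suc m)
    then have "csum B m \<inter> B m \<subseteq> dn 0" using disjoint_csum[of n B m] assms by auto
    then show ?case using Suc assms unfolding csum.simps by (intro disjoint_add cut_csum) auto
  qed (use assms in simp)
  then show ?thesis by simp
qed

end

section \<open>The gauge is a lattice norm\<close>

context amalgam
begin

text \<open>Bounding \<open>A\<close> and its negative by the same supremum bounds the absolute
  value of \<open>A\<close>, so the unit ball is solid and symmetric by construction.\<close>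

definition has_bound :: "real \<Rightarrow> ('a \<times> 'b) set \<Rightarrow> bool" where
  "has_bound t A \<longleftrightarrow> (\<exists>G. bounded_family t G \<and> A \<subseteq> P.cl G \<and> P.cneg A \<subseteq> P.cl G)"

definition gauge :: "('a \<times> 'b) set \<Rightarrow> real" where "gauge A = Inf {t. has_bound t A}"

lemma has_bound_nonneg: "has_bound t A \<Longrightarrow> 0 \<le> t"
  unfolding has_bound_def using bounded_family_nonneg by blast

lemma has_bound_mono: "has_bound t A \<Longrightarrow> t \<le> t' \<Longrightarrow> has_bound t' A"
  unfolding has_bound_def using bounded_family_mono by blast

lemma has_bound_pair:
  assumes "le1 0 x" "le2 0 y" "A \<subseteq> P.dn (x, y)" "P.cneg A \<subseteq> P.dn (x, y)"
  shows "has_bound (2 * (nm1 x + nm2 y)) A"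
proof -
  obtain G where G: "bounded_family (2 * (nm1 x + nm2 y)) G" "(x, y) \<in> G" using bounded_family_dominates_pair[OF assms(1,2)] by blast
  have "P.dn (x, y) \<subseteq> P.cl G"
    using G(2) P.cl_increasing[of G] P.cl_down[of "(x, y)" G] by (auto simp: P.dn_def)
  then show ?thesis unfolding has_bound_def using G assms by blast
qed

lemma has_bound_ex: assumes A: "P.cut A" shows "\<exists>t. has_bound t A"
proof -
  obtain a b where "a \<in> P.ub A" "b \<in> P.ub (P.cneg A)" using A P.cut_cneg[OF A] by (auto simp: P.cut_def)
  moreover obtain z where "a \<sqsubseteq> z" "b \<sqsubseteq> z" using P.directed by blast
  moreover have "z \<sqsubseteq> (L1.ab (fst z), L2.ab (snd z))" by (rule pair_le_I) (auto intro: L1.jn_ub1 L2.jn_ub1)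
  ultimately have "(L1.ab (fst z), L2.ab (snd z)) \<in> P.ub A" "(L1.ab (fst z), L2.ab (snd z)) \<in> P.ub (P.cneg A)"
    unfolding P.ub_def using P.le_trans by blast+
  then show ?thesis using has_bound_pair[OF L1.ab_pos L2.ab_pos] unfolding P.cut_subset_dn by blast
qed

lemma has_bound_bdd: "bdd_below {t. has_bound t A}"
  using has_bound_nonneg by (intro bdd_belowI[of _ 0]) auto

lemma gauge_le: "has_bound t A \<Longrightarrow> gauge A \<le> t"
  unfolding gauge_def using has_bound_bdd by (intro cInf_lower) auto

lemma gauge_nonneg: "P.cut A \<Longrightarrow> 0 \<le> gauge A"
  unfolding gauge_def using has_bound_ex has_bound_nonneg by (intro cInf_greatest) auto

lemma gauge_less: assumes "P.cut A" "gauge A < t" shows "has_bound t A"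
proof -
  have "{t. has_bound t A} \<noteq> {}" using has_bound_ex[OF assms(1)] by auto
  from cInf_lessD[OF this assms(2)[unfolded gauge_def]] show ?thesis using has_bound_mono by fastforce
qed

text \<open>The infimum in \<open>gauge\<close> need not be attained, so bounds are transferred for
  larger \<open>t\<close> and the surplus tends to 0.\<close>

lemma gauge_leI: assumes A: "P.cut A" and w: "\<And>t. has_bound t A \<Longrightarrow> 0 < t \<Longrightarrow> has_bound (c * t) B" and c: "0 < c"
  shows "gauge B \<le> c * gauge A"
proof (rule field_le_epsilon)
  fix e :: real assume e: "0 < e"
  have "0 < e / c" using e c by simp
  then have "has_bound (c * (gauge A + e / c)) B" using gauge_nonneg[OF A] by (intro w gauge_less[OF A]) auto
  then have "gauge B \<le> c * (gauge A + e / c)" by (rule gauge_le)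
  then show "gauge B \<le> c * gauge A + e" using c by (simp add: distrib_left)
qed

lemma has_bound_bound: assumes "has_bound t A"
  obtains x y where "le1 0 x" "le2 0 y" "nm1 x + nm2 y \<le> 2 powr (1 - 1/p) * t" "A \<subseteq> P.dn (x, y)" "P.cneg A \<subseteq> P.dn (x, y)"
proof -
  obtain G where G: "bounded_family t G" "A \<subseteq> P.cl G" "P.cneg A \<subseteq> P.cl G" using assms by (auto simp: has_bound_def)
  obtain x y where xy: "le1 0 x" "le2 0 y" "nm1 x + nm2 y \<le> 2 powr (1 - 1/p) * t" "G \<subseteq> P.dn (x, y)"
    using bounded_family_bound[OF G(1)] by blast
  have "P.cl G \<subseteq> P.dn (x, y)" using xy(4) P.cl_subset_cut[OF P.cut_dn] by blast
  then show thesis using that[OF xy(1-3)] G by blast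
qed

lemma cut_cl_bounded_family: assumes "bounded_family t G" shows "P.cut (P.cl G)"
proof (rule P.cut_cl)
  show "G \<noteq> {}" using bounded_family_zero_mem[OF assms] by auto
  show "P.ub G \<noteq> {}" using bounded_family_bound[OF assms] unfolding P.cut_subset_dn by auto
qed

lemma gauge_dn_0: "gauge (P.dn 0) = 0"
proof -
  have "has_bound (2 * (nm1 0 + nm2 0)) (P.dn 0)"
    by (rule has_bound_pair) (auto simp: P.cneg_dn zero_prod_def)
  then have "gauge (P.dn 0) \<le> 0" using gauge_le by fastforce
  then show ?thesis using gauge_nonneg[OF P.cut_dn, of 0] by simp
qed

text \<open>Arbitrarily small bounds put \<open>A\<close> and its negative below pairs of
  arbitrarily small norm; since the pair order is closed, both are below 0.\<close>

lemma gauge_eq_0: assumes A: "P.cut A" and gauge: "gauge A = 0" shows "A = P.dn 0"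
proof -
  have small: "\<exists>x y. nm1 x \<le> e \<and> nm2 y \<le> e \<and> A \<subseteq> P.dn (x, y) \<and> P.cneg A \<subseteq> P.dn (x, y)" if e: "0 < e" for e
  proof -
    have k: "0 < 2 powr (1 - 1/p)" by simp
    have "has_bound (e / 2 powr (1 - 1/p)) A" using e gauge by (intro gauge_less[OF A]) simp
    then obtain x y where "nm1 x + nm2 y \<le> e" "A \<subseteq> P.dn (x, y)" "P.cneg A \<subseteq> P.dn (x, y)"
      by (rule has_bound_bound) auto
    moreover have "nm1 x \<le> nm1 x + nm2 y" "nm2 y \<le> nm1 x + nm2 y" by simp_all
    ultimately show ?thesis using order_trans by blast
  qed
  have "v \<sqsubseteq> 0" if "v \<in> A \<or> v \<in> P.cneg A" for v
  proof (rule pair_le_closed)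
    fix e :: real assume "0 < e"
    from small[OF this] show "\<exists>x y. v \<sqsubseteq> (x, y) \<and> nm1 x \<le> e \<and> nm2 y \<le> e" using that by (auto simp: P.dn_def)
  qed
  then have "A \<subseteq> P.dn 0" "P.cneg A \<subseteq> P.dn 0" by (auto simp: P.dn_def)
  then show ?thesis using P.cneg_antimono[of "P.cneg A" "P.dn 0"] P.cneg_cneg[OF A] by (auto simp: P.cneg_dn)
qed

lemma has_bound_cneg: "P.cut A \<Longrightarrow> has_bound t A \<Longrightarrow> has_bound t (P.cneg A)"
  unfolding has_bound_def by (auto simp: P.cneg_cneg)

lemma gauge_cneg: "P.cut A \<Longrightarrow> gauge (P.cneg A) = gauge A"
  unfolding gauge_def using has_bound_cneg[of A] has_bound_cneg[OF P.cut_cneg[of A]] by (intro arg_cong[of _ _ Inf]) (auto simp: P.cneg_cneg)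

lemma cscal_subset_cl:
  assumes "0 < c" "\<forall>g\<in>G. \<exists>k\<in>K. c *\<^sub>R g \<sqsubseteq> k" "A \<subseteq> P.cl G"
  shows "P.cscal c A \<subseteq> P.cl K"
proof
  fix v assume "v \<in> P.cscal c A"
  then obtain a where a: "a \<in> P.cl G" "v = c *\<^sub>R a" using assms by (auto simp: P.cscal_pos)
  have "v \<sqsubseteq> u" if u: "u \<in> P.ub K" for u
  proof -
    have "(1/c) *\<^sub>R u \<in> P.ub G"
      unfolding P.ub_def
    proof safe
      fix g assume "g \<in> G"
      then obtain k where "k \<in> K" "c *\<^sub>R g \<sqsubseteq> k" using assms(2) by blast
      then have "c *\<^sub>R g \<sqsubseteq> u" using u P.le_trans unfolding P.ub_def by blast
      then show "g \<sqsubseteq> (1/c) *\<^sub>R u"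
        by (rule P.le_cong_scaleR[where t="1/c"]) (use assms(1) in \<open>auto simp: algebra_simps\<close>)
    qed
    then have "a \<sqsubseteq> (1/c) *\<^sub>R u" using a by (simp add: P.in_cl_iff)
    then show ?thesis unfolding a(2)
      by (rule P.le_cong_scaleR[where t=c]) (use assms(1) in \<open>auto simp: algebra_simps\<close>)
  qed
  then show "v \<in> P.cl K" by (simp add: P.in_cl_iff)
qed

lemma has_bound_cscal: assumes A: "P.cut A" and w: "has_bound t A" and c: "0 < c" shows "has_bound (c * t) (P.cscal c A)"
proof -
  obtain G where G: "bounded_family t G" "A \<subseteq> P.cl G" "P.cneg A \<subseteq> P.cl G" using w by (auto simp: has_bound_def)
  obtain K where K: "bounded_family (c * t) K" "\<forall>g\<in>G. \<exists>k\<in>K. c *\<^sub>R g \<sqsubseteq> k" using bounded_family_scale[OF G(1), of c] c by auto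
  have "P.cscal c A \<subseteq> P.cl K" "P.cscal c (P.cneg A) \<subseteq> P.cl K"
    using cscal_subset_cl[OF c K(2)] G by auto
  then show ?thesis unfolding has_bound_def P.cneg_cscal[OF A] using K by blast
qed

lemma gauge_cscal: assumes A: "P.cut A" shows "gauge (P.cscal c A) = \<bar>c\<bar> * gauge A"
proof -
  have pos: "gauge (P.cscal c A) = c * gauge A" if c: "0 < c" for c
  proof (rule antisym)
    show "gauge (P.cscal c A) \<le> c * gauge A" using has_bound_cscal[OF A] c by (intro gauge_leI[OF A]) auto
    note cA = P.cut_cscal[OF A, of c]
    have "gauge (P.cscal (1/c) (P.cscal c A)) \<le> (1/c) * gauge (P.cscal c A)"
      using has_bound_cscal[OF cA, of _ "1/c"] c by (intro gauge_leI[OF cA]) auto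
    moreover have "P.cscal (1/c) (P.cscal c A) = A" using P.cscal_cscal[OF A, of "1/c" c] c by simp
    ultimately show "c * gauge A \<le> gauge (P.cscal c A)" using c by (simp add: field_simps)
  qed
  consider "c = 0" | "0 < c" | "c < 0" by linarith
  then show ?thesis
  proof cases
    case 3
    have "gauge (P.cscal c A) = gauge (P.cscal (- c) A)"
      using P.cscal_minus[OF A, of "- c"] gauge_cneg[OF P.cut_cscal[OF A, of "- c"]] by simp
    then show ?thesis using pos[of "- c"] 3 by simp
  qed (use pos gauge_dn_0 in auto)
qed

text \<open>With \<open>l = s / (s + t)\<close> a sum is the convex combination of
  \<open>(s + t) / s\<close> times the first and \<open>(s + t) / t\<close> times the second
  summand, both bounded by \<open>s + t\<close>. This is the triangle inequality of the gauge, and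
  it calls for the constructor \<open>conv\<close>.\<close>

lemma bounded_family_add:
  assumes G: "bounded_family s G" "bounded_family t G'" and st: "0 < s" "0 < t"
  shows "\<exists>K. bounded_family (s + t) K \<and> (\<forall>a\<in>P.cl G. \<forall>b\<in>P.cl G'. a + b \<in> P.cl K)"
proof -
  obtain K1 where K1: "bounded_family ((s + t) / s * s) K1" "\<forall>g\<in>G. \<exists>k\<in>K1. ((s + t) / s) *\<^sub>R g \<sqsubseteq> k"
    using bounded_family_scale[OF G(1), of "(s + t) / s"] st by auto
  obtain K2 where K2: "bounded_family ((s + t) / t * t) K2" "\<forall>g\<in>G'. \<exists>k\<in>K2. ((s + t) / t) *\<^sub>R g \<sqsubseteq> k"
    using bounded_family_scale[OF G(2), of "(s + t) / t"] st by auto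
  define l where "l = s / (s + t)"
  have l: "0 < l" "l < 1" "l * ((s + t) / s) = 1" "(1 - l) * ((s + t) / t) = 1"
    using st by (simp_all add: l_def)
      (simp add: field_simps add_pos_pos less_imp_neq[symmetric])
  let ?K = "{l *\<^sub>R a + (1 - l) *\<^sub>R b | a b. a \<in> K1 \<and> b \<in> K2}"
  have "bounded_family (s + t) ?K" using K1 K2 l st by (intro bounded_family.conv) auto
  moreover have "a + b \<in> P.cl ?K" if ab: "a \<in> P.cl G" "b \<in> P.cl G'" for a b
    unfolding P.in_cl_iff
  proof
    fix u assume u: "u \<in> P.ub ?K"
    have "1 *\<^sub>R x + 1 *\<^sub>R y \<sqsubseteq> u" if "x \<in> G" "y \<in> G'" for x y
    proof -
      obtain k1 k2 where k: "k1 \<in> K1" "((s + t) / s) *\<^sub>R x \<sqsubseteq> k1" "k2 \<in> K2" "((s + t) / t) *\<^sub>R y \<sqsubseteq> k2"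
        using bspec[OF K1(2) \<open>x \<in> G\<close>] bspec[OF K2(2) \<open>y \<in> G'\<close>] by blast
      have "l *\<^sub>R (((s + t) / s) *\<^sub>R x) + (1 - l) *\<^sub>R (((s + t) / t) *\<^sub>R y) \<sqsubseteq> l *\<^sub>R k1 + (1 - l) *\<^sub>R k2"
        using k l by (intro P.le_add P.le_scaleR) auto
      moreover have "l *\<^sub>R k1 + (1 - l) *\<^sub>R k2 \<sqsubseteq> u" using u k unfolding P.ub_def by blast
      ultimately show ?thesis using P.le_trans unfolding scaleR_scaleR l by blast
    qed
    then have "1 *\<^sub>R a + 1 *\<^sub>R b \<sqsubseteq> u"
      using ab bounded_family_zero_mem[OF G(1)] bounded_family_zero_mem[OF G(2)] by (intro P.cl_combination[OF ab]) auto
    then show "a + b \<sqsubseteq> u" by simp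
  qed
  ultimately show ?thesis by blast
qed

lemma has_bound_cadd: assumes A: "P.cut A" and B: "P.cut B" and w: "has_bound s A" "has_bound t B" and st: "0 < s" "0 < t"
  shows "has_bound (s + t) (P.cadd A B)"
proof -
  obtain G where G: "bounded_family s G" "A \<subseteq> P.cl G" "P.cneg A \<subseteq> P.cl G" using w by (auto simp: has_bound_def)
  obtain G' where G': "bounded_family t G'" "B \<subseteq> P.cl G'" "P.cneg B \<subseteq> P.cl G'" using w by (auto simp: has_bound_def)
  obtain K where K: "bounded_family (s + t) K" "\<forall>a\<in>P.cl G. \<forall>b\<in>P.cl G'. a + b \<in> P.cl K" using bounded_family_add[OF G(1) G'(1) st] by blast
  note cK = cut_cl_bounded_family[OF K(1)]
  have "P.cadd A B \<subseteq> P.cl K" "P.cadd (P.cneg A) (P.cneg B) \<subseteq> P.cl K"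
    unfolding P.cadd_subset_iff[OF cK] using K(2) G G' by blast+
  then show ?thesis unfolding has_bound_def P.cneg_cadd[OF A B] using K by blast
qed

lemma gauge_cadd: assumes A: "P.cut A" and B: "P.cut B" shows "gauge (P.cadd A B) \<le> gauge A + gauge B"
proof (rule field_le_epsilon)
  fix e :: real assume e: "0 < e"
  have "has_bound ((gauge A + e/2) + (gauge B + e/2)) (P.cadd A B)"
    using e gauge_nonneg[OF A] gauge_nonneg[OF B] by (intro has_bound_cadd[OF A B] gauge_less A B) auto
  then show "gauge (P.cadd A B) \<le> gauge A + gauge B + e" using gauge_le by fastforce
qed

lemma gauge_mono: assumes A: "P.cut A" and B: "P.cut B" and le: "P.cabs A \<subseteq> P.cabs B" shows "gauge A \<le> gauge B"
proof -
  have "has_bound (1 * t) A" if "has_bound t B" for t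
  proof -
    obtain G where G: "bounded_family t G" "B \<subseteq> P.cl G" "P.cneg B \<subseteq> P.cl G" using \<open>has_bound t B\<close> by (auto simp: has_bound_def)
    have "P.cabs B \<subseteq> P.cl G" using G by (intro P.cabs_least cut_cl_bounded_family) auto
    then have "A \<subseteq> P.cl G" "P.cneg A \<subseteq> P.cl G" using le P.cabs_ge[of A] by blast+
    then show ?thesis unfolding has_bound_def using G(1) by auto
  qed
  then have "gauge A \<le> 1 * gauge B" by (intro gauge_leI[OF B]) auto
  then show ?thesis by simp
qed

lemma gauge_pair:
  assumes A: "P.cut A" "A \<subseteq> P.dn (x, y)" "P.cneg A \<subseteq> P.dn (x, y)" and pos: "le1 0 x" "le2 0 y"
  shows "gauge A \<le> 2 * (nm1 x + nm2 y)"
  using has_bound_pair[OF pos A(2,3)] by (rule gauge_le)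

text \<open>With the second generator 0 the coefficients 1 and 0 are admissible, so
  \<open>(x, 0)\<close> belongs to the family and no factor is lost.\<close>

lemma gauge_le_norm1: assumes "le1 0 x" shows "gauge (P.dn (x, 0)) \<le> nm1 x"
proof (rule gauge_le)
  have "nm1 x powr p + nm2 0 powr p \<le> nm1 x powr p" using p by simp
  then have bounded_family: "bounded_family (nm1 x) (gen x 0)" using assms by (intro bounded_family.gen) auto
  have "(1 *\<^sub>R x, 0 *\<^sub>R 0) \<in> gen x 0" unfolding gen_def using r by (intro CollectI exI[of _ 1] exI[of _ 0]) auto
  then have x: "(x, 0) \<in> P.cl (gen x 0)" using P.cl_increasing by auto
  have "- (x, 0::'b) \<sqsubseteq> (x, 0)"
    using L1.le_add[OF assms assms] by (auto intro!: pair_le_componentwise L1.le_cong_diff[of 0 "x + x"])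
  then have "- (x, 0::'b) \<in> P.cl (gen x 0)" using x P.cl_down by blast
  then show "has_bound (nm1 x) (P.dn (x, 0))"
    unfolding has_bound_def P.cneg_dn using bounded_family x P.dn_subset_cut[OF cut_cl_bounded_family[OF bounded_family]] by blast
qed

lemma gauge_le_norm2: assumes "le2 0 y" shows "gauge (P.dn (0, y)) \<le> nm2 y"
proof (rule gauge_le)
  have "nm1 0 powr p + nm2 y powr p \<le> nm2 y powr p" using p by simp
  then have bounded_family: "bounded_family (nm2 y) (gen 0 y)" using assms by (intro bounded_family.gen) auto
  have "(0 *\<^sub>R 0, 1 *\<^sub>R y) \<in> gen 0 y" unfolding gen_def using r by (intro CollectI exI[of _ 0] exI[of _ 1]) auto
  then have x: "(0, y) \<in> P.cl (gen 0 y)" using P.cl_increasing by auto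
  have "- (0::'a, y) \<sqsubseteq> (0, y)"
    using L2.le_add[OF assms assms] by (auto intro!: pair_le_componentwise L2.le_cong_diff[of 0 "y + y"])
  then have "- (0::'a, y) \<in> P.cl (gen 0 y)" using x P.cl_down by blast
  then show "has_bound (nm2 y) (P.dn (0, y))"
    unfolding has_bound_def P.cneg_dn using bounded_family x P.dn_subset_cut[OF cut_cl_bounded_family[OF bounded_family]] by blast
qed

text \<open>A bound \<open>t\<close> places \<open>(x, 0)\<close> below a pair whose norms add up to
  at most \<open>2 powr (1 - 1/p) * t\<close>, and \<open>pair_le_norm\<close> transfers this sum to
  \<open>x\<close>.\<close>

lemma gauge_lower: assumes "le1 0 x" shows "nm1 x \<le> 2 powr (1 - 1/p) * gauge (P.dn (x, 0))"
proof (rule field_le_epsilon)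
  fix e :: real assume e: "0 < e"
  have k: "0 < 2 powr (1 - 1/p)" by simp
  have "has_bound (gauge (P.dn (x, 0)) + e / 2 powr (1 - 1/p)) (P.dn (x, 0))" using e k by (intro gauge_less P.cut_dn) auto
  then obtain x1 x2 where x: "le1 0 x1" "le2 0 x2" "nm1 x1 + nm2 x2 \<le> 2 powr (1 - 1/p) * (gauge (P.dn (x, 0)) + e / 2 powr (1 - 1/p))"
      "P.dn (x, 0) \<subseteq> P.dn (x1, x2)" by (rule has_bound_bound)
  have "(x, 0) \<sqsubseteq> (x1, x2)" using x(4) P.self_in_dn unfolding P.dn_def by blast
  from pair_le_norm[OF this assms x(1,2)] x(3) show "nm1 x \<le> 2 powr (1 - 1/p) * gauge (P.dn (x, 0)) + e"
    using k by (simp add: distrib_left)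
qed

end

section \<open>Completeness of the gauge\<close>

context amalgam
begin

lemma cadd_dn_step:
  assumes cut: "\<And>k. P.cut (A k)" and step: "\<And>k. P.cadd (A (Suc k)) (P.cneg (A k)) \<subseteq> P.dn (e k)"
    and "m \<le> n"
  shows "A n \<subseteq> P.cadd (P.dn (\<Sum>i=m..<n. e i)) (A m)"
  using \<open>m \<le> n\<close>
proof (induction n rule: dec_induct)
  case base
  then show ?case using P.cadd_zero[OF cut] by simp
next
  case (step n)
  have "A (Suc n) \<subseteq> P.cadd (P.dn (e n)) (A n)"
    using assms(2)[of n] P.cadd_cneg_subset_iff[OF cut cut P.cut_dn] by blast
  also have "\<dots> \<subseteq> P.cadd (P.dn (e n)) (P.cadd (P.dn (\<Sum>i=m..<n. e i)) (A m))"
    using P.cadd_mono[OF P.cut_cadd[OF P.cut_dn cut] P.cut_dn step.IH] by (simp add: P.cadd_commute[of "P.dn (e n)"])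
  also have "\<dots> = P.cadd (P.cadd (P.dn (e n)) (P.dn (\<Sum>i=m..<n. e i))) (A m)"
    using cut by (simp add: P.cadd_assoc)
  also have "\<dots> = P.cadd (P.dn (\<Sum>i=m..<Suc n. e i)) (A m)"
    using step.hyps by (simp add: P.dn_add sum.atLeastLessThan_Suc add.commute)
  finally show ?case .
qed

text \<open>Cauchy sequences converge because the dominating pairs can be summed in the two given Banach
  lattices, which yields order bounds for which the Dedekind completion provides a supremum.\<close>

lemma gauge_complete_fast:
  assumes cut: "\<And>k. P.cut (A k)" and fast: "\<And>k. gauge (P.cadd (A (Suc k)) (P.cneg (A k))) < (1/2) ^ k"
  shows "\<exists>W. P.cut W \<and> (\<lambda>k. gauge (P.cadd (A k) (P.cneg W))) \<longlonglongrightarrow> 0"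
proof -
  let ?C = "2 powr (1 - 1/p)"
  have cd: "P.cut (P.cadd (A m) (P.cneg (A k)))" for m k by (intro P.cut_cadd P.cut_cneg cut)
  have "\<exists>x y. le1 0 x \<and> le2 0 y \<and> nm1 x + nm2 y \<le> ?C * (1/2) ^ k \<and>
      P.cadd (A (Suc k)) (P.cneg (A k)) \<subseteq> P.dn (x, y) \<and> P.cneg (P.cadd (A (Suc k)) (P.cneg (A k))) \<subseteq> P.dn (x, y)" for k
    using has_bound_bound[OF gauge_less[OF cd fast[of k]]] by metis
  then obtain x y where xy: "\<And>k. le1 0 (x k)" "\<And>k. le2 0 (y k)" "\<And>k. nm1 (x k) + nm2 (y k) \<le> ?C * (1/2) ^ k"
      and up: "\<And>k. P.cadd (A (Suc k)) (P.cneg (A k)) \<subseteq> P.dn (x k, y k)"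
      and dn: "\<And>k. P.cneg (P.cadd (A (Suc k)) (P.cneg (A k))) \<subseteq> P.dn (x k, y k)" by metis
  have "nm1 (x k) \<le> ?C * (1/2) ^ k" "nm2 (y k) \<le> ?C * (1/2) ^ k" for k
    using xy(3)[of k] L1.nm_nonneg[of "x k"] L2.nm_nonneg[of "y k"] by linarith+
  note bx = this(1) and by' = this(2)
  obtain sx where sx: "\<And>m n. m \<le> n \<Longrightarrow> le1 (\<Sum>i=m..<n. x i) (sx - (\<Sum>i<m. x i))" "\<And>m. le1 0 (sx - (\<Sum>i<m. x i))"
      "(\<lambda>n. nm1 (sx - (\<Sum>i<n. x i))) \<longlonglongrightarrow> 0"
    using L1.positive_series[OF xy(1) bx] by blast
  obtain sy where sy: "\<And>m n. m \<le> n \<Longrightarrow> le2 (\<Sum>i=m..<n. y i) (sy - (\<Sum>i<m. y i))" "\<And>m. le2 0 (sy - (\<Sum>i<m. y i))"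
      "(\<lambda>n. nm2 (sy - (\<Sum>i<n. y i))) \<longlonglongrightarrow> 0"
    using L2.positive_series[OF xy(2) by'] by blast
  \<comment> \<open>The tails of the two summed series: from index \<open>m\<close> on, the cuts
    differ from \<open>A m\<close> by at most \<open>E m\<close> in either direction.\<close>
  define E where "E m = (sx - (\<Sum>i<m. x i), sy - (\<Sum>i<m. y i))" for m
  have sum_pair: "(\<Sum>i=m..<n. (x i, y i)) = (\<Sum>i=m..<n. x i, \<Sum>i=m..<n. y i)" for m n
    by (induction n) (auto simp: sum.atLeastLessThan_Suc zero_prod_def)
  have sumE: "(\<Sum>i=m..<n. (x i, y i)) \<sqsubseteq> E m" if "m \<le> n" for m n
    unfolding sum_pair E_def using sx(1)[OF that] sy(1)[OF that] by (rule pair_le_componentwise)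
  have dnE: "P.dn (\<Sum>i=m..<n. (x i, y i)) \<subseteq> P.dn (E m)" if "m \<le> n" for m n
    using sumE[OF that] P.dn_subset_cut[OF P.cut_dn] by (simp add: P.dn_def)
  have up': "A n \<subseteq> P.cadd (P.dn (E m)) (A m)" if "m \<le> n" for m n
    using cadd_dn_step[of A, OF cut up that] P.cadd_mono[OF P.cut_dn cut dnE[OF that]] by (rule subset_trans)
  have "P.cadd (P.cneg (A (Suc k))) (P.cneg (P.cneg (A k))) \<subseteq> P.dn (x k, y k)" for k
    using dn[of k] by (simp add: P.cneg_cadd cut P.cut_cneg)
  from cadd_dn_step[of "\<lambda>k. P.cneg (A k)", OF P.cut_cneg[OF cut] this]
  have dn'0: "P.cneg (A n) \<subseteq> P.cadd (P.dn (E m)) (P.cneg (A m))" if "m \<le> n" for m n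
    using that P.cadd_mono[OF P.cut_dn P.cut_cneg[OF cut] dnE[OF that]] by blast
  have dn': "A m \<subseteq> P.cadd (P.dn (E m)) (A n)" if "m \<le> n" for m n
  proof -
    have "P.cadd (P.cneg (A n)) (P.cneg (P.cneg (A m))) \<subseteq> P.dn (E m)"
      using dn'0[OF that] P.cadd_cneg_subset_iff[OF P.cut_cneg[OF cut] P.cut_cneg[OF cut] P.cut_dn] by blast
    then have "P.cadd (A m) (P.cneg (A n)) \<subseteq> P.dn (E m)"
      by (simp only: P.cneg_cneg[OF cut] P.cadd_commute[of "P.cneg (A n)" "A m"])
    then show ?thesis using P.cadd_cneg_subset_iff[OF cut cut P.cut_dn] by blast
  qed
  \<comment> \<open>Lowering each cut by its tail gives approximations from below. All of them lie
    below every \<open>A m + E m\<close>, so their supremum \<open>W\<close> exists and stays within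
    \<open>E m\<close> of \<open>A m\<close>.\<close>
  define B where "B k = P.cadd (P.dn (- E k)) (A k)" for k
  have cB: "P.cut (B k)" for k unfolding B_def by (intro P.cut_cadd P.cut_dn cut)
  have shift: "P.cadd (P.dn e) (P.cadd (P.dn f) S) = P.cadd (P.dn (e + f)) S" if "P.cut S" for e f S
    using that by (simp add: P.cadd_assoc[symmetric] P.dn_add)
  have E0: "0 \<sqsubseteq> E m" for m unfolding E_def zero_prod_def using sx(2) sy(2) by (rule pair_le_componentwise)
  have mono_dn: "P.cadd (P.dn e) S \<subseteq> P.cadd (P.dn f) S" if "e \<sqsubseteq> f" "P.cut S" for e f S
    using that P.dn_subset_cut[OF P.cut_dn, of e f] by (intro P.cadd_mono P.cut_dn) (auto simp: P.dn_def)
  \<comment> \<open>For \<open>k <= m\<close> the tail subtracted from \<open>A k\<close> cancels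
    the possible excess over \<open>A m\<close>; for larger \<open>k\<close> it is dropped and the
    excess is at most \<open>E m\<close>.\<close>
  have BA: "B k \<subseteq> P.cadd (P.dn (E m)) (A m)" for k m
  proof (cases "k \<le> m")
    case True
    have "B k \<subseteq> P.cadd (P.dn (- E k)) (P.cadd (P.dn (E k)) (A m))"
      unfolding B_def using P.cadd_mono[OF P.cut_cadd[OF P.cut_dn cut] P.cut_dn dn'[OF True]]
      by (simp add: P.cadd_commute[of "P.dn (- E k)"])
    also have "\<dots> = P.cadd (P.dn 0) (A m)" using shift[OF cut] by simp
    also have "\<dots> \<subseteq> P.cadd (P.dn (E m)) (A m)" by (rule mono_dn[OF E0 cut])
    finally show ?thesis .
  next
    case False
    have "- E k \<sqsubseteq> 0" using E0[of k] P.le_minus_iff[of "E k" 0] by simp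
    then have "B k \<subseteq> P.cadd (P.dn 0) (A k)" unfolding B_def by (rule mono_dn[OF _ cut])
    also have "\<dots> = A k" by (rule P.cadd_zero[OF cut])
    also have "\<dots> \<subseteq> P.cadd (P.dn (E m)) (A m)" using False by (intro up') simp
    finally show ?thesis .
  qed
  define W where "W = P.cl (\<Union>(range B))"
  have W: "P.cut W"
    unfolding W_def using cB BA[of _ 0] by (intro P.cut_Sup[where E="P.cadd (P.dn (E 0)) (A 0)"] P.cut_cadd P.cut_dn cut) auto
  have WA: "W \<subseteq> P.cadd (P.dn (E m)) (A m)" for m
    unfolding W_def using BA by (subst P.cl_subset_cut) (auto intro: P.cut_cadd P.cut_dn cut)
  have "A m \<subseteq> P.cadd (P.dn (E m)) W" for m
  proof -
    have "B m \<subseteq> \<Union>(range B)" by blast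
    also have "\<dots> \<subseteq> W" unfolding W_def by (rule P.cl_increasing)
    finally have "B m \<subseteq> W" .
    then have "P.cadd (P.dn (E m)) (B m) \<subseteq> P.cadd (P.dn (E m)) W"
      using P.cadd_mono[OF W P.cut_dn, of "B m" "E m"] by (simp add: P.cadd_commute[of "P.dn (E m)"])
    then show ?thesis unfolding B_def shift[OF cut] using P.cadd_zero[OF cut] by simp
  qed
  then have 1: "P.cadd (A m) (P.cneg W) \<subseteq> P.dn (E m)" for m
    using P.cadd_cneg_subset_iff[OF cut W P.cut_dn] by blast
  have "P.cadd W (P.cneg (A m)) \<subseteq> P.dn (E m)" for m
    using WA P.cadd_cneg_subset_iff[OF W cut P.cut_dn] by blast
  then have 2: "P.cneg (P.cadd (A m) (P.cneg W)) \<subseteq> P.dn (E m)" for m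
    using P.cadd_commute[of W] by (simp add: P.cneg_cadd cut W P.cut_cneg P.cneg_cneg)
  have bound: "gauge (P.cadd (A m) (P.cneg W)) \<le> 2 * (nm1 (sx - (\<Sum>i<m. x i)) + nm2 (sy - (\<Sum>i<m. y i)))" for m
    using 1[of m] 2[of m] sx(2) sy(2) unfolding E_def by (intro gauge_pair P.cut_cadd P.cut_cneg cut W)
  have nn: "0 \<le> gauge (P.cadd (A m) (P.cneg W))" for m by (intro gauge_nonneg P.cut_cadd P.cut_cneg cut W)
  have "(\<lambda>m. 2 * (nm1 (sx - (\<Sum>i<m. x i)) + nm2 (sy - (\<Sum>i<m. y i)))) \<longlonglongrightarrow> 0"
    using tendsto_mult_right_zero[OF tendsto_add[OF sx(3) sy(3), simplified], of 2] by simp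
  then have "(\<lambda>k. gauge (P.cadd (A k) (P.cneg W))) \<longlonglongrightarrow> 0"
    by (rule Lim_null_comparison[rotated]) (use bound nn in auto)
  then show ?thesis using W by blast
qed

lemma gauge_complete:
  assumes cut: "\<And>k. P.cut (s k)"
    and cauchy: "\<And>e. 0 < e \<Longrightarrow> \<exists>M. \<forall>m\<ge>M. \<forall>n\<ge>M. gauge (P.cadd (s m) (P.cneg (s n))) < e"
  shows "\<exists>W. P.cut W \<and> (\<lambda>k. gauge (P.cadd (s k) (P.cneg W))) \<longlonglongrightarrow> 0"
proof -
  have "\<forall>k. \<exists>M. \<forall>m\<ge>M. \<forall>n\<ge>M. gauge (P.cadd (s m) (P.cneg (s n))) < (1/2) ^ k" using cauchy by simp
  then obtain M where M: "\<And>k m n. M k \<le> m \<Longrightarrow> M k \<le> n \<Longrightarrow> gauge (P.cadd (s m) (P.cneg (s n))) < (1/2) ^ k" by metis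
  \<comment> \<open>Summing the thresholds gives indices that are nondecreasing and still beyond
    each \<open>M k\<close>.\<close>
  define f where "f k = (\<Sum>i\<le>k. M i)" for k
  have Mf: "M k \<le> f k" for k unfolding f_def by (rule member_le_sum) auto
  have ff: "f k \<le> f (Suc k)" for k unfolding f_def by simp
  have "gauge (P.cadd (s (f (Suc k))) (P.cneg (s (f k)))) < (1/2) ^ k" for k
    using Mf[of k] ff[of k] by (intro M) auto
  then obtain W where W: "P.cut W" "(\<lambda>k. gauge (P.cadd (s (f k)) (P.cneg W))) \<longlonglongrightarrow> 0"
    using gauge_complete_fast[of "\<lambda>k. s (f k)"] cut by blast
  have "(\<lambda>k. gauge (P.cadd (s k) (P.cneg W))) \<longlonglongrightarrow> 0"
    unfolding LIMSEQ_def
  proof (intro allI impI)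
    fix e :: real assume e: "0 < e"
    have e2: "0 < e/2" using e by simp
    have "\<forall>\<^sub>F k in sequentially. gauge (P.cadd (s (f k)) (P.cneg W)) < e/2 \<and> (1/2::real) ^ k < e/2"
      using order_tendstoD(2)[OF W(2) e2] order_tendstoD(2)[OF LIMSEQ_power_zero[of "1/2::real"] e2]
      by (simp add: eventually_conj)
    then obtain k where k: "gauge (P.cadd (s (f k)) (P.cneg W)) < e/2" "(1/2::real) ^ k < e/2"
      using eventually_happens by force
    have "norm (gauge (P.cadd (s n) (P.cneg W)) - 0) < e" if n: "f k \<le> n" for n
    proof -
      have eq: "P.cadd (s n) (P.cneg W) = P.cadd (P.cadd (s n) (P.cneg (s (f k)))) (P.cadd (s (f k)) (P.cneg W))"
      proof -
        have "P.cadd (P.cneg (s (f k))) (P.cadd (s (f k)) (P.cneg W)) = P.cneg W"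
          by (intro P.cadd_left_cancel cut P.cut_cneg W)
        then show ?thesis using cut W by (simp add: P.cadd_assoc P.cut_cneg P.cut_cadd)
      qed
      have "gauge (P.cadd (s n) (P.cneg W)) \<le> gauge (P.cadd (s n) (P.cneg (s (f k)))) + gauge (P.cadd (s (f k)) (P.cneg W))"
        unfolding eq by (intro gauge_cadd P.cut_cadd P.cut_cneg cut W)
      also have "gauge (P.cadd (s n) (P.cneg (s (f k)))) < (1/2) ^ k" using Mf[of k] n by (intro M) auto
      finally have "gauge (P.cadd (s n) (P.cneg W)) < e" using k by simp
      moreover have "0 \<le> gauge (P.cadd (s n) (P.cneg W))" by (intro gauge_nonneg P.cut_cadd P.cut_cneg cut W)
      ultimately show ?thesis by simp
    qed
    then show "\<exists>no. \<forall>n\<ge>no. dist (gauge (P.cadd (s n) (P.cneg W))) 0 < e" by (auto simp: dist_norm)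
  qed
  then show ?thesis using W by blast
qed

section \<open>Finite families of bounded cuts and their p-sums\<close>

lemma scaled_bound:
  assumes "\<forall>u\<in>P.ub K. v \<sqsubseteq> c *\<^sub>R u" "0 \<in> K" "P.ub K \<noteq> {}" "0 \<le> c"
  shows "\<exists>w\<in>P.cl K. v \<sqsubseteq> c *\<^sub>R w"
proof (cases "c = 0")
  case True
  then have "v \<sqsubseteq> 0" using assms by auto
  moreover have "0 \<in> P.cl K" using assms(2) P.cl_increasing[of K] by blast
  ultimately show ?thesis using True by (intro bexI[of _ 0]) auto
next
  case False
  then have c: "0 < c" using assms by simp
  have "(1/c) *\<^sub>R v \<in> P.cl K"
    unfolding P.in_cl_iff
  proof
    fix u assume "u \<in> P.ub K"
    then have "v \<sqsubseteq> c *\<^sub>R u" using assms by blast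
    then show "(1/c) *\<^sub>R v \<sqsubseteq> u"
      by (rule P.le_cong_scaleR[where t="1/c"]) (use c in \<open>auto simp: algebra_simps\<close>)
  qed
  then show ?thesis using c by (intro bexI[of _ "(1/c) *\<^sub>R v"]) auto
qed

lemma cscal_bound:
  assumes A: "P.cut A" "A \<subseteq> P.cl G" "P.cneg A \<subseteq> P.cl G" and w: "w \<in> P.cscal d A" and u: "u \<in> P.ub G"
  shows "w \<sqsubseteq> \<bar>d\<bar> *\<^sub>R u"
proof -
  have pos: "w \<sqsubseteq> d *\<^sub>R u" if d: "0 < d" and B: "B \<subseteq> P.cl G" "w \<in> P.cscal d B" for d B
  proof -
    obtain v where v: "v \<in> P.cl G" "w = d *\<^sub>R v" using B d by (auto simp: P.cscal_pos)
    then have "v \<sqsubseteq> u" using u by (simp add: P.in_cl_iff)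
    then show ?thesis using d v by (auto intro: P.le_scaleR)
  qed
  consider "d = 0" | "0 < d" | "d < 0" by linarith
  then show ?thesis
  proof cases
    case 1 then show ?thesis using w by (simp add: P.dn_def)
  next
    case 2 then show ?thesis using pos[OF 2 A(2) w] by simp
  next
    case 3
    have "P.cscal d A = P.cscal (- d) (P.cneg A)"
      using P.cscal_minus[OF A(1), of "- d"] P.cneg_cscal[OF A(1), of "- d"] by simp
    then show ?thesis using pos[of "- d" "P.cneg A"] 3 A(3) w by simp
  qed
qed

lemma cl_subset_if_dominated:
  assumes "\<And>x. x \<in> G \<Longrightarrow> \<exists>k\<in>K. x \<sqsubseteq> k" shows "P.cl G \<subseteq> P.cl K"
proof -
  have "P.ub K \<subseteq> P.ub G" unfolding P.ub_def using assms P.le_trans by blast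
  then show ?thesis unfolding P.cl_def P.lb_def by blast
qed

text \<open>A p-sum is a supremum over all coefficients, so one family \<open>K\<close> must
  dominate uniformly in \<open>a\<close>. The dual exponent uses the last clause; for upper
  p-estimates the domination of each single \<open>A k\<close> is what will be combined with
  disjointness.\<close>

lemma has_bound_family:
  assumes "\<And>k. k < n \<Longrightarrow> P.cut (A k)" "\<And>k. k < n \<Longrightarrow> has_bound (t k) (A k)"
  shows "\<exists>K. bounded_family ((\<Sum>k<n. t k powr p) powr (1/p)) K \<and> (\<forall>k<n. A k \<subseteq> P.cl K \<and> P.cneg (A k) \<subseteq> P.cl K) \<and>
    (\<forall>a. \<forall>v\<in>P.csum (\<lambda>k. P.cscal (a k) (A k)) n. \<forall>u\<in>P.ub K. v \<sqsubseteq> (\<Sum>k<n. \<bar>a k\<bar> powr r) powr (1/r) *\<^sub>R u)"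
  using assms
proof (induction n)
  case 0
  have "bounded_family 0 (gen 0 0)" using p by (intro bounded_family.gen) auto
  then show ?case by (intro exI[of _ "gen 0 0"]) (auto simp: P.dn_def)
next
  case (Suc n)
  let ?T = "(\<Sum>k<n. t k powr p) powr (1/p)" and ?T' = "(\<Sum>k<Suc n. t k powr p) powr (1/p)"
  obtain K where K: "bounded_family ?T K" "\<And>k. k < n \<Longrightarrow> A k \<subseteq> P.cl K \<and> P.cneg (A k) \<subseteq> P.cl K"
      "\<And>a v u. v \<in> P.csum (\<lambda>k. P.cscal (a k) (A k)) n \<Longrightarrow> u \<in> P.ub K \<Longrightarrow> v \<sqsubseteq> (\<Sum>k<n. \<bar>a k\<bar> powr r) powr (1/r) *\<^sub>R u"
  proof -
    have "\<exists>K. bounded_family ?T K \<and> (\<forall>k<n. A k \<subseteq> P.cl K \<and> P.cneg (A k) \<subseteq> P.cl K) \<and>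
      (\<forall>a. \<forall>v\<in>P.csum (\<lambda>k. P.cscal (a k) (A k)) n. \<forall>u\<in>P.ub K. v \<sqsubseteq> (\<Sum>k<n. \<bar>a k\<bar> powr r) powr (1/r) *\<^sub>R u)"
      using Suc.prems by (intro Suc.IH) simp_all
    then show thesis by (elim exE conjE) (rule that, assumption, blast+)
  qed
  have An: "P.cut (A n)" "has_bound (t n) (A n)" using Suc.prems by auto
  obtain G where G: "bounded_family (t n) G" "A n \<subseteq> P.cl G" "P.cneg (A n) \<subseteq> P.cl G" using An(2) by (auto simp: has_bound_def)
  \<comment> \<open>Binary p-norms associate, so repeated use of
    \<open>bounded_family_combination\<close> accumulates no constant.\<close>
  have T': "(?T powr p + t n powr p) powr (1/p) = ?T'"
    using p sum_nonneg[of "{..<n}" "\<lambda>k. t k powr p"] by (simp add: powr_powr)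
  obtain K' where K': "bounded_family ?T' K'"
      "\<And>a b c d. a \<in> K \<Longrightarrow> b \<in> G \<Longrightarrow> 0 \<le> c \<Longrightarrow> 0 \<le> d \<Longrightarrow> c powr r + d powr r \<le> 1 \<Longrightarrow> \<exists>k\<in>K'. c *\<^sub>R a + d *\<^sub>R b \<sqsubseteq> k"
    using bounded_family_combination[OF K(1) G(1)] unfolding T' by (elim exE conjE) (rule that, assumption, blast)
  note zK = bounded_family_zero_mem[OF K(1)] and zG = bounded_family_zero_mem[OF G(1)]
  have "P.cl K \<subseteq> P.cl K'"
    using K'(2)[OF _ zG, of _ 1 0] r by (intro cl_subset_if_dominated) auto
  moreover have "P.cl G \<subseteq> P.cl K'"
    using K'(2)[OF zK, of _ 0 1] r by (intro cl_subset_if_dominated) auto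
  ultimately have mem: "A k \<subseteq> P.cl K' \<and> P.cneg (A k) \<subseteq> P.cl K'" if "k < Suc n" for k
    using K(2)[of k] G that by (cases "k = n") (auto simp: less_Suc_eq)
  have bound: "v \<sqsubseteq> (\<Sum>k<Suc n. \<bar>a k\<bar> powr r) powr (1/r) *\<^sub>R u"
    if v: "v \<in> P.csum (\<lambda>k. P.cscal (a k) (A k)) (Suc n)" and u: "u \<in> P.ub K'" for a v u
  proof -
    define c where "c = (\<Sum>k<n. \<bar>a k\<bar> powr r) powr (1/r)"
    define d where "d = \<bar>a n\<bar>"
    define e where "e = (\<Sum>k<Suc n. \<bar>a k\<bar> powr r) powr (1/r)"
    have s0: "0 \<le> (\<Sum>k<n. \<bar>a k\<bar> powr r)" by (intro sum_nonneg) auto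
    have cd: "0 \<le> c" "0 \<le> d" by (auto simp: c_def d_def)
    have cr: "c powr r = (\<Sum>k<n. \<bar>a k\<bar> powr r)" using r s0 by (simp add: c_def powr_powr)
    have er: "e powr r = c powr r + d powr r" using r s0 unfolding cr by (simp add: e_def powr_powr d_def)
    have e0: "0 \<le> e" by (simp add: e_def)
    have "x + y \<sqsubseteq> e *\<^sub>R u" if x: "x \<in> P.csum (\<lambda>k. P.cscal (a k) (A k)) n" and y: "y \<in> P.cscal (a n) (A n)" for x y
    proof -
      have "\<exists>x0\<in>P.cl K. x \<sqsubseteq> c *\<^sub>R x0"
        using K(3)[OF x] cd cut_cl_bounded_family[OF K(1)] by (intro scaled_bound zK) (auto simp: c_def P.cut_def)
      then obtain x0 where x0: "x0 \<in> P.cl K" "x \<sqsubseteq> c *\<^sub>R x0" by blast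
      have "\<exists>y0\<in>P.cl G. y \<sqsubseteq> d *\<^sub>R y0"
        using cscal_bound[OF An(1) G(2,3) y] cd cut_cl_bounded_family[OF G(1)] by (intro scaled_bound zG) (auto simp: d_def P.cut_def)
      then obtain y0 where y0: "y0 \<in> P.cl G" "y \<sqsubseteq> d *\<^sub>R y0" by blast
      have "c *\<^sub>R x0 + d *\<^sub>R y0 \<sqsubseteq> e *\<^sub>R u"
      proof (cases "e = 0")
        case True
        then have "c powr r + d powr r = 0" using er r by simp
        then have "c = 0" "d = 0" using powr_ge_zero[of c r] powr_ge_zero[of d r]
          by (metis add_nonneg_eq_0_iff powr_eq_0_iff)+
        then show ?thesis using True by simp
      next
        case False
        then have e: "0 < e" using e0 by simp
        \<comment> \<open>After division by the r-norm \<open>e\<close> the coefficients are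
          admissible and \<open>K'\<close> dominates members of \<open>K\<close> and
          \<open>G\<close>; the bound then passes to their closures.\<close>
        have "(c/e) powr r + (d/e) powr r = 1"
          using e by (simp add: powr_divide add_divide_distrib[symmetric] er[symmetric])
        then have "(c/e) *\<^sub>R g + (d/e) *\<^sub>R h \<sqsubseteq> u" if "g \<in> K" "h \<in> G" for g h
          using K'(2)[OF that, of "c/e" "d/e"] cd e u P.le_trans unfolding P.ub_def by fastforce
        then have "(c/e) *\<^sub>R x0 + (d/e) *\<^sub>R y0 \<sqsubseteq> u"
          using cd e zK zG by (intro P.cl_combination[OF x0(1) y0(1)]) auto
        then show ?thesis
          by (rule P.le_cong_scaleR[where t=e]) (use e in \<open>auto simp: algebra_simps\<close>)
      qed
      then show ?thesis using P.le_add[OF x0(2) y0(2)] P.le_trans by blast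
    qed
    then have "e *\<^sub>R u \<in> P.ub {x + y |x y. x \<in> P.csum (\<lambda>k. P.cscal (a k) (A k)) n \<and> y \<in> P.cscal (a n) (A n)}"
      unfolding P.ub_def by blast
    then show ?thesis using v unfolding e_def by (auto simp: P.cadd_def P.in_cl_iff)
  qed
  show ?case using K'(1) mem bound by blast
qed

end

section \<open>The amalgamated Banach lattice\<close>

context preordered_space
begin

lemma dn_cong: "v \<sqsubseteq> w \<Longrightarrow> w \<sqsubseteq> v \<Longrightarrow> dn v = dn w"
  unfolding dn_def using le_trans by blast

lemma cscal_dn: "cscal c (dn v) = dn (c *\<^sub>R v)"
proof -
  consider "c = 0" | "0 < c" | "c < 0" by linarith
  then show ?thesis
  proof cases
    case 2
    then have "(1/c) *\<^sub>R w \<sqsubseteq> v \<longleftrightarrow> w \<sqsubseteq> c *\<^sub>R v" for w using le_scaleR_iff[OF 2, of "(1/c) *\<^sub>R w" v] by simp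
    then show ?thesis using 2 by (simp add: cscal_def dn_def)
  next
    case 3
    then have "v \<sqsubseteq> (1/c) *\<^sub>R w \<longleftrightarrow> w \<sqsubseteq> c *\<^sub>R v" for w
      using le_scaleR_iff[of "- c" v "(1/c) *\<^sub>R w"] le_minus_iff[of "c *\<^sub>R v" w] by simp
    then show ?thesis using 3 unfolding cscal_def ub_dn by (simp add: dn_def)
  qed simp
qed

end

lemma bl_sum_cong: "(\<And>k. k < n \<Longrightarrow> f k = g k) \<Longrightarrow> bl_sum X f n = bl_sum X g n"
  by (induction n) auto

text \<open>The push-out is tested only against lattices on one prescribed type, so the cuts must be
  coded there. Pairs with the same code lie below each other, by \<open>code_le\<close> used in both
  directions, so a cut, being a lower set, is recovered from its image although
  \<open>\<kappa>\<close> need not be injective.\<close>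

locale coded_amalgam = amalgam +
  fixes \<kappa> :: "'a \<times> 'b \<Rightarrow> 'w"
  assumes code_le: "\<kappa> v = \<kappa> w \<Longrightarrow> v \<sqsubseteq> w"
begin

definition completion :: "'w set blat" where
  "completion = \<lparr>bl_carrier = {\<kappa> ` A | A. P.cut A}, bl_zero = \<kappa> ` P.dn 0,
    bl_add = (\<lambda>S T. \<kappa> ` P.cadd (\<kappa> -` S) (\<kappa> -` T)), bl_scal = (\<lambda>c S. \<kappa> ` P.cscal c (\<kappa> -` S)),
    bl_leq = (\<subseteq>), bl_nrm = (\<lambda>S. gauge (\<kappa> -` S))\<rparr>"

lemma decode_code [simp]: "P.cut A \<Longrightarrow> \<kappa> -` (\<kappa> ` A) = A"
  using code_le P.cut_down by (auto 0 3)

lemma completion_carrier: "S \<in> bl_carrier completion \<longleftrightarrow> (\<exists>A. P.cut A \<and> S = \<kappa> ` A)" by (auto simp: completion_def)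
lemma completion_mem [simp]: "P.cut A \<Longrightarrow> \<kappa> ` A \<in> bl_carrier completion" by (auto simp: completion_carrier)
lemma completion_zero: "bl_zero completion = \<kappa> ` P.dn 0" by (simp add: completion_def)
lemma completion_add: "P.cut A \<Longrightarrow> P.cut B \<Longrightarrow> bl_add completion (\<kappa> ` A) (\<kappa> ` B) = \<kappa> ` P.cadd A B" by (simp add: completion_def)
lemma completion_scal: "P.cut A \<Longrightarrow> bl_scal completion c (\<kappa> ` A) = \<kappa> ` P.cscal c A" by (simp add: completion_def)
lemma completion_leq: "bl_leq completion S T \<longleftrightarrow> S \<subseteq> T" by (simp add: completion_def)
lemma completion_nrm: "P.cut A \<Longrightarrow> bl_nrm completion (\<kappa> ` A) = gauge A" by (simp add: completion_def)
lemma code_subset: "P.cut B \<Longrightarrow> \<kappa> ` A \<subseteq> \<kappa> ` B \<longleftrightarrow> A \<subseteq> B"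
  using decode_code[of B] by blast
lemma code_eq: "P.cut A \<Longrightarrow> P.cut B \<Longrightarrow> \<kappa> ` A = \<kappa> ` B \<longleftrightarrow> A = B"
  using decode_code by metis
lemma completion_neg: "P.cut A \<Longrightarrow> bl_neg completion (\<kappa> ` A) = \<kappa> ` P.cneg A"
  using P.cscal_minus[of A 1] by (simp add: bl_neg_def completion_scal)
lemma completion_diff: "P.cut A \<Longrightarrow> P.cut B \<Longrightarrow> bl_diff completion (\<kappa> ` A) (\<kappa> ` B) = \<kappa> ` P.cadd A (P.cneg B)"
  by (simp add: bl_diff_def completion_neg completion_add P.cut_cneg)

lemma completion_lub_the: "bl_lub completion S z \<Longrightarrow> (THE z. bl_lub completion S z) = z"
  unfolding bl_lub_def completion_leq by (rule the_equality) auto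

lemma completion_glb_the: "bl_glb completion S z \<Longrightarrow> (THE z. bl_glb completion S z) = z"
  unfolding bl_glb_def completion_leq by (rule the_equality) (blast, meson subset_antisym)

lemma completion_lub:
  assumes "\<And>A. A \<in> \<A> \<Longrightarrow> P.cut A" "\<A> \<noteq> {}" "P.cut E" "\<And>A. A \<in> \<A> \<Longrightarrow> A \<subseteq> E"
  shows "bl_lub completion ((`) \<kappa> ` \<A>) (\<kappa> ` P.cl (\<Union>\<A>))"
  unfolding bl_lub_def completion_leq
proof (intro conjI ballI impI)
  show "\<kappa> ` P.cl (\<Union>\<A>) \<in> bl_carrier completion" using P.cut_Sup[OF assms] by simp
  show "s \<subseteq> \<kappa> ` P.cl (\<Union>\<A>)" if s: "s \<in> (`) \<kappa> ` \<A>" for s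
  proof -
    obtain A where "A \<in> \<A>" "s = \<kappa> ` A" using s by blast
    moreover have "A \<subseteq> P.cl (\<Union>\<A>)"
      using Union_upper[OF \<open>A \<in> \<A>\<close>] P.cl_increasing by (rule subset_trans)
    ultimately show ?thesis by (simp add: image_mono)
  qed
  fix w assume "w \<in> bl_carrier completion" and up: "\<forall>s\<in>(`) \<kappa> ` \<A>. s \<subseteq> w"
  then obtain B where B: "P.cut B" "w = \<kappa> ` B" by (auto simp: completion_carrier)
  have "A \<subseteq> B" if "A \<in> \<A>" for A
    using bspec[OF up imageI[OF that]] unfolding B(2) code_subset[OF B(1)] .
  then have "\<Union>\<A> \<subseteq> B" by (rule Union_least)
  then show "\<kappa> ` P.cl (\<Union>\<A>) \<subseteq> w" unfolding B(2) code_subset[OF B(1)] P.cl_subset_cut[OF B(1)] .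
qed

lemma completion_lub_pair: assumes A: "P.cut A" and B: "P.cut B"
  shows "bl_lub completion {\<kappa> ` A, \<kappa> ` B} (\<kappa> ` P.cl (A \<union> B))"
proof -
  have "A \<subseteq> P.cl (A \<union> B)" "B \<subseteq> P.cl (A \<union> B)" using P.cl_increasing[of "A \<union> B"] by auto
  then have "bl_lub completion ((`) \<kappa> ` {A, B}) (\<kappa> ` P.cl (\<Union>{A, B}))"
    using P.cut_join[OF A B] A B by (intro completion_lub[where E="P.cl (A \<union> B)"]) auto
  then show ?thesis by simp
qed

lemma completion_sup: "P.cut A \<Longrightarrow> P.cut B \<Longrightarrow> bl_sup completion (\<kappa> ` A) (\<kappa> ` B) = \<kappa> ` P.cl (A \<union> B)"
  unfolding bl_sup_def by (intro completion_lub_the completion_lub_pair)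

lemma completion_abs: "P.cut A \<Longrightarrow> bl_abs completion (\<kappa> ` A) = \<kappa> ` P.cabs A"
  by (simp add: bl_abs_def completion_neg completion_sup P.cut_cneg P.cabs_def)

lemma completion_inf: assumes A: "P.cut A" and B: "P.cut B" shows "bl_inf completion (\<kappa> ` A) (\<kappa> ` B) = \<kappa> ` (A \<inter> B)"
proof -
  note AB = P.cut_Int[OF A B]
  have "bl_glb completion {\<kappa> ` A, \<kappa> ` B} (\<kappa> ` (A \<inter> B))"
    unfolding bl_glb_def completion_leq
  proof (intro conjI ballI impI)
    fix w assume "w \<in> bl_carrier completion" and lo: "\<forall>s\<in>{\<kappa> ` A, \<kappa> ` B}. w \<subseteq> s"
    then obtain E where "w = \<kappa> ` E" by (auto simp: completion_carrier)
    moreover from this have "E \<subseteq> A" "E \<subseteq> B" using lo code_subset[OF A] code_subset[OF B] by simp_all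
    ultimately show "w \<subseteq> \<kappa> ` (A \<inter> B)" by (simp add: image_mono)
  qed (use AB in auto)
  then show ?thesis unfolding bl_inf_def by (rule completion_glb_the)
qed

lemma completion_banach: "banach_lattice completion"
  unfolding banach_lattice_def Let_def
proof (intro conjI ballI allI impI)
  note [simp] = completion_add completion_scal completion_zero completion_nrm completion_diff P.cut_cadd P.cut_cscal P.cut_cneg
  fix x y w assume x: "x \<in> bl_carrier completion" and y: "y \<in> bl_carrier completion" and w: "w \<in> bl_carrier completion"
  obtain A B C where A: "P.cut A" "x = \<kappa> ` A" and B: "P.cut B" "y = \<kappa> ` B" and C: "P.cut C" "w = \<kappa> ` C"
    using x y w by (auto simp: completion_carrier)
  show "bl_add completion (bl_add completion x y) w = bl_add completion x (bl_add completion y w)" using A B C by (simp add: P.cadd_assoc)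
  show "bl_leq completion x w" if "bl_leq completion x y \<and> bl_leq completion y w" using that by (auto simp: completion_leq)
  show "bl_leq completion (bl_add completion x w) (bl_add completion y w)" if "bl_leq completion x y"
    using that A B C P.cadd_mono[of B C A] by (simp add: completion_leq code_subset)
next
  note [simp] = completion_add completion_scal completion_zero completion_nrm completion_diff P.cut_cadd P.cut_cscal P.cut_cneg
  fix x y a assume x: "x \<in> bl_carrier completion" and y: "y \<in> bl_carrier completion"
  obtain A B where A: "P.cut A" "x = \<kappa> ` A" and B: "P.cut B" "y = \<kappa> ` B" using x y by (auto simp: completion_carrier)
  show "bl_add completion x y \<in> bl_carrier completion" using A B by simp
  show "bl_add completion x y = bl_add completion y x" using A B P.cadd_commute[of A B] by simp
  show "bl_scal completion a (bl_add completion x y) = bl_add completion (bl_scal completion a x) (bl_scal completion a y)" using A B by (simp add: P.cscal_add)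
  show "x = y" if "bl_leq completion x y \<and> bl_leq completion y x" using that by (auto simp: completion_leq)
  show "bl_leq completion (bl_scal completion a x) (bl_scal completion a y)" if "bl_leq completion x y \<and> 0 \<le> a"
    using that A B P.cscal_mono[of a A B] by (simp add: completion_leq code_subset)
  show "\<exists>w. bl_lub completion {x, y} w" using A B completion_lub_pair by blast
  show "bl_nrm completion (bl_add completion x y) \<le> bl_nrm completion x + bl_nrm completion y" using A B by (simp add: gauge_cadd)
  show "bl_nrm completion x \<le> bl_nrm completion y" if "bl_leq completion (bl_abs completion x) (bl_abs completion y)"
    using that A B by (simp add: completion_abs completion_leq code_subset P.cut_cabs gauge_mono)
next
  note [simp] = completion_add completion_scal completion_zero completion_nrm completion_diff P.cut_cadd P.cut_cscal P.cut_cneg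
  fix x a b assume x: "x \<in> bl_carrier completion"
  obtain A where A: "P.cut A" "x = \<kappa> ` A" using x by (auto simp: completion_carrier)
  show "bl_scal completion a x \<in> bl_carrier completion" using A by simp
  show "bl_add completion (bl_zero completion) x = x" using A by (simp add: P.cadd_zero)
  show "bl_add completion x (bl_scal completion (- 1) x) = bl_zero completion"
    using A P.cscal_minus[OF A(1), of 1] by (simp add: P.cadd_cneg)
  show "bl_scal completion (a + b) x = bl_add completion (bl_scal completion a x) (bl_scal completion b x)" using A by (simp add: P.cscal_plus)
  show "bl_scal completion a (bl_scal completion b x) = bl_scal completion (a * b) x" using A by (simp add: P.cscal_cscal)
  show "bl_scal completion 1 x = x" using A by simp
  show "bl_leq completion x x" by (simp add: completion_leq)
  show "(bl_nrm completion x = 0) = (x = bl_zero completion)" using A gauge_eq_0[OF A(1)] gauge_dn_0 by (auto simp: code_eq)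
  show "bl_nrm completion (bl_scal completion a x) = \<bar>a\<bar> * bl_nrm completion x" using A by (simp add: gauge_cscal)
next
  show "bl_zero completion \<in> bl_carrier completion" by (simp add: completion_zero)
next
  fix s :: "nat \<Rightarrow> 'w set" assume "(\<forall>n. s n \<in> bl_carrier completion) \<and> (\<forall>e>0. \<exists>N. \<forall>m\<ge>N. \<forall>n\<ge>N. bl_nrm completion (bl_diff completion (s m) (s n)) < e)"
  then have s: "\<And>n. s n \<in> bl_carrier completion"
    and cauchy: "\<And>e. 0 < e \<Longrightarrow> \<exists>N. \<forall>m\<ge>N. \<forall>n\<ge>N. bl_nrm completion (bl_diff completion (s m) (s n)) < e" by auto
  obtain A where A: "\<And>n. P.cut (A n)" "\<And>n. s n = \<kappa> ` A n" using s unfolding completion_carrier by metis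
  have diff: "bl_nrm completion (bl_diff completion (\<kappa> ` A n) (\<kappa> ` B)) = gauge (P.cadd (A n) (P.cneg B))" if "P.cut B" for n B
    using A that by (simp add: completion_diff completion_nrm P.cut_cadd P.cut_cneg)
  have "\<exists>W. P.cut W \<and> (\<lambda>k. gauge (P.cadd (A k) (P.cneg W))) \<longlonglongrightarrow> 0"
    using cauchy A(1) unfolding A(2) diff[OF A(1)] by (rule gauge_complete[rotated])
  then obtain W where W: "P.cut W" "(\<lambda>k. gauge (P.cadd (A k) (P.cneg W))) \<longlonglongrightarrow> 0" by blast
  then show "\<exists>x\<in>bl_carrier completion. (\<lambda>n. bl_nrm completion (bl_diff completion (s n) x)) \<longlonglongrightarrow> 0"
    unfolding A(2) using diff[OF W(1)] by (intro bexI[of _ "\<kappa> ` W"]) auto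
qed

lemma completion_sum: "(\<And>k. k < n \<Longrightarrow> P.cut (f k)) \<Longrightarrow> bl_sum completion (\<lambda>k. \<kappa> ` f k) n = \<kappa> ` P.csum f n"
  by (induction n) (auto simp: completion_zero completion_add P.cut_csum)

text \<open>One common bound \<open>K\<close> makes the supremum behind \<open>p_sum\<close> exist
  and at the same time bounds its gauge. The slack \<open>e\<close> is there because a cut is known
  to have bounds only above its gauge; it tends to 0 at the end.\<close>

lemma completion_p_sum:
  assumes x: "\<And>k. k < n \<Longrightarrow> P.cut (A k) \<and> x k = \<kappa> ` A k"
    and bound: "\<And>e. 0 < e \<Longrightarrow> \<exists>K. bounded_family ((\<Sum>k<n. (gauge (A k) + e) powr p) powr (1/p)) K \<and>
      (\<forall>a. (\<Sum>k<n. \<bar>a k\<bar> powr (p / (p - 1))) \<le> 1 \<longrightarrow> P.csum (\<lambda>k. P.cscal (a k) (A k)) n \<subseteq> P.cl K)"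
  shows "bl_nrm completion (p_sum completion p x n) \<le> (\<Sum>k<n. bl_nrm completion (x k) powr p) powr (1/p)"
proof -
  define \<A> where "\<A> = {P.csum (\<lambda>k. P.cscal (a k) (A k)) n | a. (\<Sum>k<n. \<bar>a k\<bar> powr (p / (p - 1))) \<le> 1}"
  have cutA: "P.cut B" if "B \<in> \<A>" for B
    using that x unfolding \<A>_def by (auto intro!: P.cut_csum P.cut_cscal)
  have "(\<Sum>k<n. \<bar>0\<bar> powr (p / (p - 1))) \<le> (1::real)" by simp
  then have zA: "P.csum (\<lambda>k. P.cscal 0 (A k)) n \<in> \<A>" unfolding \<A>_def by (intro CollectI exI[of _ "\<lambda>_. 0"]) simp
  have z0: "P.csum (\<lambda>k. P.cscal 0 (A k)) m = P.dn 0" for m by (induction m) (auto simp: P.cadd_zero)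
  define S where "S = P.cl (\<Union>\<A>)"
  have S0: "P.dn 0 \<subseteq> S" unfolding S_def using zA z0 P.cl_increasing[of "\<Union>\<A>"] by auto
  have set_eq: "{bl_sum completion (\<lambda>k. bl_scal completion (a k) (x k)) n | a. (\<Sum>k<n. \<bar>a k\<bar> powr (p / (p - 1))) \<le> 1} = (`) \<kappa> ` \<A>"
  proof -
    have "bl_sum completion (\<lambda>k. bl_scal completion (a k) (x k)) n = \<kappa> ` P.csum (\<lambda>k. P.cscal (a k) (A k)) n" for a
    proof -
      have "bl_sum completion (\<lambda>k. bl_scal completion (a k) (x k)) n = bl_sum completion (\<lambda>k. \<kappa> ` P.cscal (a k) (A k)) n"
        using x by (intro bl_sum_cong) (simp add: completion_scal)
      then show ?thesis using x by (simp add: completion_sum P.cut_cscal)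
    qed
    then show ?thesis unfolding \<A>_def by auto
  qed
  have sub: "\<exists>K. bounded_family ((\<Sum>k<n. (gauge (A k) + e) powr p) powr (1/p)) K \<and> (\<forall>B\<in>\<A>. B \<subseteq> P.cl K)" if "0 < e" for e
    using bound[OF that] unfolding \<A>_def by blast
  obtain K where K: "bounded_family ((\<Sum>k<n. (gauge (A k) + 1) powr p) powr (1/p)) K" "\<forall>B\<in>\<A>. B \<subseteq> P.cl K" using sub[of 1] by auto
  have cutS: "P.cut S"
    unfolding S_def using cutA zA K by (intro P.cut_Sup[where E="P.cl K"] cut_cl_bounded_family) auto
  have "bl_lub completion ((`) \<kappa> ` \<A>) (\<kappa> ` S)"
    unfolding S_def using cutA zA K by (intro completion_lub[where E="P.cl K"] cut_cl_bounded_family) auto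
  then have "p_sum completion p x n = \<kappa> ` S" unfolding p_sum_def set_eq by (rule completion_lub_the)
  then have nS: "bl_nrm completion (p_sum completion p x n) = gauge S" using cutS by (simp add: completion_nrm)
  have le: "gauge S \<le> (\<Sum>k<n. (gauge (A k) + e) powr p) powr (1/p)" if e: "0 < e" for e
  proof (rule gauge_le)
    obtain K where K: "bounded_family ((\<Sum>k<n. (gauge (A k) + e) powr p) powr (1/p)) K" "\<forall>B\<in>\<A>. B \<subseteq> P.cl K" using sub[OF e] by auto
    have "S \<subseteq> P.cl K" unfolding S_def using K cut_cl_bounded_family P.cl_subset_cut by (metis Union_least)
    \<comment> \<open>Zero coefficients are allowed, so the supremum is positive and its negative
      needs no estimate of its own.\<close>
    moreover have "P.cneg S \<subseteq> P.dn 0" using P.cneg_antimono[OF S0] by (simp add: P.cneg_dn)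
    then have "P.cneg S \<subseteq> P.cl K" using P.cl_dn_0[OF bounded_family_zero_mem[OF K(1)]] by blast
    ultimately show "has_bound ((\<Sum>k<n. (gauge (A k) + e) powr p) powr (1/p)) S" unfolding has_bound_def using K by blast
  qed
  have N0: "0 \<le> gauge (A k)" if "k < n" for k using x[OF that] gauge_nonneg by blast
  have inv: "(\<lambda>m. 1 / real (Suc m)) \<longlonglongrightarrow> 0" using LIMSEQ_inverse_real_of_nat by (simp add: inverse_eq_divide)
  have "(\<lambda>m. (\<Sum>k<n. (gauge (A k) + 1 / real (Suc m)) powr p) powr (1/p)) \<longlonglongrightarrow> (\<Sum>k<n. (gauge (A k) + 0) powr p) powr (1/p)"
    using p inv N0
    by (intro tendsto_powr' tendsto_sum tendsto_add tendsto_const) (auto intro!: always_eventually sum_nonneg add_nonneg_nonneg)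
  then have "gauge S \<le> (\<Sum>k<n. (gauge (A k) + 0) powr p) powr (1/p)"
    using le by (intro LIMSEQ_le_const[where X="\<lambda>m. (\<Sum>k<n. (gauge (A k) + 1 / real (Suc m)) powr p) powr (1/p)"]) auto
  moreover have "(\<Sum>k<n. bl_nrm completion (x k) powr p) = (\<Sum>k<n. gauge (A k) powr p)"
    using x by (intro sum.cong) (auto simp: completion_nrm)
  ultimately show ?thesis using nS by simp
qed

text \<open>For p-convexity \<open>r\<close> is the exponent in the definition of the p-sum, so
  \<open>K\<close> dominates all admissible combinations directly; for upper p-estimates
  disjointness takes over this role.\<close>

lemma completion_in_class: assumes rc: "r = coefficient_exponent c p" shows "in_class c p completion"
proof -
  have main: "bl_nrm completion (p_sum completion p x n) \<le> (\<Sum>k<n. bl_nrm completion (x k) powr p) powr (1/p)"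
    if x: "\<forall>k<n. x k \<in> bl_carrier completion" and d: "c = Cp_inf \<Longrightarrow> pairwise_disjoint completion x n" for n x
  proof -
    obtain A where A: "\<And>k. k < n \<Longrightarrow> P.cut (A k) \<and> x k = \<kappa> ` A k" using x unfolding completion_carrier by metis
    show ?thesis
    proof (rule completion_p_sum[OF A])
      fix e :: real assume e: "0 < e"
      have "has_bound (gauge (A k) + e) (A k)" if "k < n" for k using A[OF that] e by (intro gauge_less) auto
      then obtain K where K: "bounded_family ((\<Sum>k<n. (gauge (A k) + e) powr p) powr (1/p)) K"
          "\<forall>k<n. A k \<subseteq> P.cl K \<and> P.cneg (A k) \<subseteq> P.cl K"
          "\<forall>a. \<forall>v\<in>P.csum (\<lambda>k. P.cscal (a k) (A k)) n. \<forall>u\<in>P.ub K. v \<sqsubseteq> (\<Sum>k<n. \<bar>a k\<bar> powr r) powr (1/r) *\<^sub>R u"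
        using has_bound_family[of n A "\<lambda>k. gauge (A k) + e"] A by auto
      note cK = cut_cl_bounded_family[OF K(1)] and zK = bounded_family_zero_mem[OF K(1)]
      have "P.csum (\<lambda>k. P.cscal (a k) (A k)) n \<subseteq> P.cl K" if a: "(\<Sum>k<n. \<bar>a k\<bar> powr (p / (p - 1))) \<le> 1" for a
      proof (cases c)
        case Cp
        then have rq: "r = p / (p - 1)" using rc by simp
        show ?thesis
        proof
          fix v assume v: "v \<in> P.csum (\<lambda>k. P.cscal (a k) (A k)) n"
          show "v \<in> P.cl K"
            unfolding P.in_cl_iff
          proof
            fix u assume u: "u \<in> P.ub K"
            let ?t = "(\<Sum>k<n. \<bar>a k\<bar> powr r) powr (1/r)"
            have "?t \<le> 1 powr (1/r)" using a r p unfolding rq by (intro powr_mono2) (auto intro: sum_nonneg)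
            then have t: "?t \<le> 1" by simp
            have "0 \<sqsubseteq> u" using u zK by (auto simp: P.ub_def)
            then have "?t *\<^sub>R u \<sqsubseteq> u"
              by (rule P.le_cong_scaleR[where t="1 - ?t"]) (use t in \<open>auto simp: algebra_simps\<close>)
            then show "v \<sqsubseteq> u" using K(3) v u P.le_trans by blast
          qed
        qed
      next
        case Cp_inf
        \<comment> \<open>Admissible coefficients have modulus at most 1, so each combination is
          below the sum of the absolute values. By disjointness that sum is below every common
          positive bound of its terms, and \<open>cl K\<close> is one.\<close>
        have B: "P.cut (P.cabs (A k))" "P.dn 0 \<subseteq> P.cabs (A k)" if "k < n" for k
          using A[OF that] by (auto intro: P.cut_cabs dest: P.cabs_nonneg)
        have "P.cabs (A i) \<inter> P.cabs (A j) \<subseteq> P.dn 0" if ij: "i < n" "j < n" "i \<noteq> j" for i j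
        proof -
          have "bl_inf completion (bl_abs completion (x i)) (bl_abs completion (x j)) = bl_zero completion"
            using d[OF Cp_inf] ij by (auto simp: pairwise_disjoint_def)
          then have "\<kappa> ` (P.cabs (A i) \<inter> P.cabs (A j)) = \<kappa> ` P.dn 0"
            using A ij B by (simp add: completion_abs completion_inf completion_zero)
          then show ?thesis using B ij by (simp add: code_eq P.cut_Int)
        qed
        moreover have "P.cabs (A k) \<subseteq> P.cl K" if "k < n" for k using K(2) that by (intro P.cabs_least cK) auto
        ultimately have "P.csum (\<lambda>k. P.cabs (A k)) n \<subseteq> P.cl K"
          using B P.cl_dn_0[OF zK] by (intro P.disjoint_csum_subset cK) auto
        moreover have "P.csum (\<lambda>k. P.cscal (a k) (A k)) n \<subseteq> P.csum (\<lambda>k. P.cabs (A k)) n"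
        proof (rule P.csum_mono)
          fix k assume k: "k < n"
          have "\<bar>a k\<bar> powr (p / (p - 1)) \<le> (\<Sum>k<n. \<bar>a k\<bar> powr (p / (p - 1)))"
            using k by (intro member_le_sum) auto
          then have "\<bar>a k\<bar> \<le> 1" using a p by (intro abs_le_1_if_powr_le_1[of _ "p / (p - 1)"]) auto
          then show "P.cscal (a k) (A k) \<subseteq> P.cabs (A k)" using A[OF k] by (intro P.cscal_subset_cabs) auto
        qed (use B in auto)
        ultimately show ?thesis by blast
      qed
      then show "\<exists>K. bounded_family ((\<Sum>k<n. (gauge (A k) + e) powr p) powr (1/p)) K \<and>
          (\<forall>a. (\<Sum>k<n. \<bar>a k\<bar> powr (p / (p - 1))) \<le> 1 \<longrightarrow> P.csum (\<lambda>k. P.cscal (a k) (A k)) n \<subseteq> P.cl K)"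
        using K(1) by blast
    qed
  qed
  show ?thesis
    using completion_banach main by (cases c) (auto simp: p_convex1_def upper_p_est1_def)
qed

text \<open>Because joins in \<open>X1\<close> remain suprema, a family dominates \<open>x\<close>
  and \<open>- x\<close> exactly when it dominates the absolute value. Equality reduces both norm
  estimates for \<open>R1\<close> to positive vectors; for \<open>R2\<close> the upper one
  suffices.\<close>

lemma gauge_ab1: "gauge (P.dn (x, 0)) = gauge (P.dn (L1.ab x, 0))"
proof -
  have "has_bound t (P.dn (x, 0)) \<longleftrightarrow> has_bound t (P.dn (L1.ab x, 0))" for t
  proof -
    have "(x, 0) \<in> P.cl G \<and> - (x, 0) \<in> P.cl G \<longleftrightarrow> (L1.ab x, 0) \<in> P.cl G \<and> - (L1.ab x, 0) \<in> P.cl G" for G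
    proof safe
      assume m: "(x, 0) \<in> P.cl G" "- (x, 0) \<in> P.cl G"
      then show "(L1.ab x, 0) \<in> P.cl G" by (auto simp: P.in_cl_iff intro: pair_le_join1)
      have "- (L1.ab x, 0::'b) \<sqsubseteq> (x, 0)" using L1.neg_ab_le[of x] by (auto intro: pair_le_componentwise)
      then show "- (L1.ab x, 0) \<in> P.cl G" using m P.cl_down by blast
    next
      assume m: "(L1.ab x, 0) \<in> P.cl G"
      have "(x, 0::'b) \<sqsubseteq> (L1.ab x, 0)" "- (x, 0::'b) \<sqsubseteq> (L1.ab x, 0)"
        using L1.jn_ub1[of x "- x"] L1.jn_ub2[of "- x" x] by (auto intro: pair_le_componentwise)
      then show "(x, 0) \<in> P.cl G" "- (x, 0) \<in> P.cl G" using m P.cl_down by blast+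
    qed
    then show ?thesis
      unfolding has_bound_def P.cneg_dn using P.dn_subset_cut[OF cut_cl_bounded_family] by blast
  qed
  then show ?thesis unfolding gauge_def by simp
qed

lemma gauge_ab2: "gauge (P.dn (0, y)) \<le> gauge (P.dn (0, L2.ab y))"
proof -
  have "(0::'a, y) \<sqsubseteq> (0, L2.ab y)" "- (0::'a, y) \<sqsubseteq> (0, L2.ab y)"
    using L2.jn_ub1[of y "- y"] L2.jn_ub2[of "- y" y] by (auto intro: pair_le_componentwise)
  then have "P.dn (0, y) \<subseteq> P.dn (0, L2.ab y)" "P.dn (- (0, y)) \<subseteq> P.dn (0, L2.ab y)"
    using P.dn_subset_cut[OF P.cut_dn] by (auto simp: P.dn_def)
  then have "P.cabs (P.dn (0, y)) \<subseteq> P.cabs (P.dn (0, L2.ab y))"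
    using P.cabs_ge(1)[of "P.dn (0, L2.ab y)"] by (intro P.cabs_least P.cut_cabs P.cut_dn) (auto simp: P.cneg_dn)
  then show ?thesis by (intro gauge_mono P.cut_dn)
qed

definition R1 :: "'a \<Rightarrow> 'w set" where "R1 x = \<kappa> ` P.dn (x, 0)"
definition R2 :: "'b \<Rightarrow> 'w set" where "R2 y = \<kappa> ` P.dn (0, y)"

lemma R1_add: "bl_add completion (R1 x) (R1 x') = R1 (x + x')" by (simp add: R1_def completion_add P.dn_add)
lemma R2_add: "bl_add completion (R2 x) (R2 x') = R2 (x + x')" by (simp add: R2_def completion_add P.dn_add)
lemma R1_scal: "bl_scal completion c (R1 x) = R1 (c *\<^sub>R x)" by (simp add: R1_def completion_scal P.cscal_dn)
lemma R2_scal: "bl_scal completion c (R2 x) = R2 (c *\<^sub>R x)" by (simp add: R2_def completion_scal P.cscal_dn)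
lemma R_mem: "R1 x \<in> bl_carrier completion" "R2 y \<in> bl_carrier completion" by (simp_all add: R1_def R2_def)
lemma R1_cong: "le1 x x' \<Longrightarrow> le1 x' x \<Longrightarrow> R1 x = R1 x'"
  unfolding R1_def by (intro arg_cong[of _ _ "(`) \<kappa>"] P.dn_cong pair_le_componentwise) auto
lemma R2_cong: "le2 x x' \<Longrightarrow> le2 x' x \<Longrightarrow> R2 x = R2 x'"
  unfolding R2_def by (intro arg_cong[of _ _ "(`) \<kappa>"] P.dn_cong pair_le_componentwise) auto

lemma R1_sup: "bl_sup completion (R1 x) (R1 x') = R1 (jn1 x x')"
proof -
  have "P.cl (P.dn (x, 0) \<union> P.dn (x', 0)) = P.dn (jn1 x x', 0)"
  proof
    have "(x, 0::'b) \<sqsubseteq> (jn1 x x', 0)" "(x', 0::'b) \<sqsubseteq> (jn1 x x', 0)" by (auto intro: pair_le_componentwise L1.jn_ub1 L1.jn_ub2)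
    then show "P.cl (P.dn (x, 0) \<union> P.dn (x', 0)) \<subseteq> P.dn (jn1 x x', 0)"
      unfolding P.cl_subset_cut[OF P.cut_dn] using P.dn_subset_cut[OF P.cut_dn] by (auto simp: P.dn_def)
    have "(jn1 x x', 0) \<in> P.cl (P.dn (x, 0) \<union> P.dn (x', 0))"
      unfolding P.in_cl_iff P.ub_def by (auto intro!: pair_le_join1)
    then show "P.dn (jn1 x x', 0) \<subseteq> P.cl (P.dn (x, 0) \<union> P.dn (x', 0))"
      unfolding P.dn_subset_cut[OF P.cut_join[OF P.cut_dn P.cut_dn]] .
  qed
  then show ?thesis by (simp add: R1_def completion_sup)
qed

lemma R2_sup: "bl_sup completion (R2 x) (R2 x') = R2 (jn2 x x')"
proof -
  have "P.cl (P.dn (0, x) \<union> P.dn (0, x')) = P.dn (0, jn2 x x')"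
  proof
    have "(0::'a, x) \<sqsubseteq> (0, jn2 x x')" "(0::'a, x') \<sqsubseteq> (0, jn2 x x')" by (auto intro: pair_le_componentwise L2.jn_ub1 L2.jn_ub2)
    then show "P.cl (P.dn (0, x) \<union> P.dn (0, x')) \<subseteq> P.dn (0, jn2 x x')"
      unfolding P.cl_subset_cut[OF P.cut_dn] using P.dn_subset_cut[OF P.cut_dn] by (auto simp: P.dn_def)
    have "(0, jn2 x x') \<in> P.cl (P.dn (0, x) \<union> P.dn (0, x'))"
      unfolding P.in_cl_iff P.ub_def by (auto intro!: pair_le_join2)
    then show "P.dn (0, jn2 x x') \<subseteq> P.cl (P.dn (0, x) \<union> P.dn (0, x'))"
      unfolding P.dn_subset_cut[OF P.cut_join[OF P.cut_dn P.cut_dn]] .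
  qed
  then show ?thesis by (simp add: R2_def completion_sup)
qed

lemma R1_nrm_le: "bl_nrm completion (R1 x) \<le> nm1 x"
  using gauge_le_norm1[OF L1.ab_pos[of x]] by (simp add: R1_def completion_nrm gauge_ab1[of x] L1.nm_ab)
lemma R2_nrm_le: "bl_nrm completion (R2 y) \<le> nm2 y"
  using order_trans[OF gauge_ab2 gauge_le_norm2[OF L2.ab_pos[of y]]] by (simp add: R2_def completion_nrm L2.nm_ab)
lemma R1_nrm_ge: "nm1 x \<le> 2 powr (1 - 1/p) * bl_nrm completion (R1 x)"
  using gauge_lower[OF L1.ab_pos[of x]] by (simp add: R1_def completion_nrm gauge_ab1[of x] L1.nm_ab)

text \<open>The two links make \<open>(a, 0)\<close> and \<open>(0, b)\<close> comparable both ways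
  with error 0; this is the commutation of the square over \<open>X0\<close>.\<close>

lemma R1_eq_R2: "link a b \<Longrightarrow> link (- a) (- b) \<Longrightarrow> R1 a = R2 b"
proof -
  assume link: "link a b" "link (- a) (- b)"
  have "(a, 0) \<sqsubseteq> (0, b)" "(0, b) \<sqsubseteq> (a, 0)" unfolding pair_le_def using link by (auto intro!: exI[of _ 0])
  then show ?thesis unfolding R1_def R2_def using P.dn_cong by metis
qed

end

section \<open>Push-outs\<close>

text \<open>\<open>op_norm\<close> is a supremum of reals and bounds its set only if that set is
  bounded above; the constant contained in \<open>lattice_hom\<close> ensures this.\<close>

lemma op_norm_contraction:
  assumes X: "banach_lattice X" and Y: "banach_lattice Y" and T: "lattice_hom X Y T" "op_norm X Y T \<le> 1"
    and x: "x \<in> bl_carrier X"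
  shows "bl_nrm Y (T x) \<le> bl_nrm X x"
proof -
  interpret X: blattice X by unfold_locales fact
  interpret Y: blattice Y by unfold_locales fact
  have Tm: "\<And>x. x \<in> bl_carrier X \<Longrightarrow> T x \<in> bl_carrier Y"
    and Ts: "\<And>a x. x \<in> bl_carrier X \<Longrightarrow> T (bl_scal X a x) = bl_scal Y a (T x)"
    using T(1) by (auto simp: lattice_hom_def)
  obtain c where c: "\<And>x. x \<in> bl_carrier X \<Longrightarrow> bl_nrm Y (T x) \<le> c * bl_nrm X x"
    using T(1) unfolding lattice_hom_def by blast
  have nn: "0 \<le> bl_nrm X x" using X.nm_nonneg[of "X.emb x"] x by simp
  show ?thesis
  proof (cases "bl_nrm X x = 0")
    case True
    then show ?thesis using c[OF x] by simp
  next
    case False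
    then have n: "0 < bl_nrm X x" using nn by simp
    let ?y = "bl_scal X (1 / bl_nrm X x) x"
    have y: "?y \<in> bl_carrier X" "bl_nrm X ?y \<le> 1" using x n by (auto simp: X.nrm_scal)
    have bdd: "bdd_above {bl_nrm Y (T x) | x. x \<in> bl_carrier X \<and> bl_nrm X x \<le> 1}"
    proof (rule bdd_aboveI)
      fix z assume "z \<in> {bl_nrm Y (T x) | x. x \<in> bl_carrier X \<and> bl_nrm X x \<le> 1}"
      then obtain x where x: "x \<in> bl_carrier X" "bl_nrm X x \<le> 1" "z = bl_nrm Y (T x)" by blast
      have "0 \<le> bl_nrm X x" using X.nm_nonneg[of "X.emb x"] x by simp
      then have "c * bl_nrm X x \<le> \<bar>c\<bar> * 1" using x by (intro mult_mono) auto
      then show "z \<le> \<bar>c\<bar>" using c[OF x(1)] x(3) by simp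
    qed
    have "bl_nrm Y (T ?y) \<le> op_norm X Y T"
      unfolding op_norm_def using y by (intro cSup_upper bdd) auto
    also have "bl_nrm Y (T ?y) = bl_nrm Y (T x) / bl_nrm X x"
      using n x by (simp add: Ts Y.nrm_scal Tm)
    finally have "bl_nrm Y (T x) / bl_nrm X x \<le> 1" using T(2) by linarith
    then show ?thesis using n by (simp add: field_simps)
  qed
qed

lemma op_norm_le_1:
  assumes X: "banach_lattice X" and T: "\<And>x. x \<in> bl_carrier X \<Longrightarrow> bl_nrm Y (T x) \<le> bl_nrm X x"
  shows "op_norm X Y T \<le> 1"
proof -
  interpret X: blattice X by unfold_locales fact
  have "bl_nrm X (bl_zero X) \<le> 1" using X.nrm_zero_iff[of "bl_zero X"] by simp
  then show ?thesis unfolding op_norm_def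
    using X.zero_mem by (intro cSup_least) (auto intro: order_trans[OF T])
qed

locale blattice_hom = X: blattice X + Y: blattice Y for X :: "'x blat" and Y :: "'y blat" +
  fixes T :: "'x \<Rightarrow> 'y"
  assumes hom: "lattice_hom X Y T"
begin

text \<open>Each value is represented by a single basis vector, so \<open>lift\<close> respects the
  operations only after evaluation. The order and the norm see nothing else.\<close>

definition lift :: "('x \<Rightarrow>\<^sub>0 real) \<Rightarrow> ('y \<Rightarrow>\<^sub>0 real)" where "lift v = Y.emb (T (X.val v))"

lemma T_mem: "x \<in> bl_carrier X \<Longrightarrow> T x \<in> bl_carrier Y" using hom by (auto simp: lattice_hom_def)
lemma val_lift: "Y.val (lift v) = T (X.val v)" by (simp add: lift_def T_mem)
lemma lift_add: "Y.val (lift (v + w)) = Y.val (lift v + lift w)"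
  using hom by (simp add: val_lift X.val_add Y.val_add lattice_hom_def)
lemma lift_scaleR: "Y.val (lift (c *\<^sub>R v)) = Y.val (c *\<^sub>R lift v)"
  using hom by (simp add: val_lift X.val_scaleR Y.val_scaleR lattice_hom_def)
lemma lift_minus: "Y.val (lift (- v)) = Y.val (- lift v)" using lift_scaleR[of "-1" v] by simp
lemma lift_zero: "Y.val (lift 0) = Y.val 0" using lift_scaleR[of 0 0] by simp
lemma lift_join: "Y.val (lift (X.emb (bl_sup X (X.val v) (X.val w)))) = bl_sup Y (Y.val (lift v)) (Y.val (lift w))"
  using hom by (simp add: val_lift lattice_hom_def)
lemma lift_mono: assumes "bl_leq X (X.val v) (X.val w)" shows "bl_leq Y (Y.val (lift v)) (Y.val (lift w))"
proof -
  have "bl_sup X (X.val v) (X.val w) = X.val w"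
    using assms by (intro X.sup_eqI) (auto simp: bl_lub_def X.ble_refl)
  then have "Y.val (lift w) = bl_sup Y (Y.val (lift v)) (Y.val (lift w))" using lift_join[of v w] by (simp add: val_lift)
  then show ?thesis using Y.jn_ub1[of "lift v" "lift w"] by simp
qed

end

theorem mainTheorem16:
  fixes c :: lattice_class and p :: real
    and X0 :: "'x0 blat" and X1 :: "'x1 blat" and X2 :: "'x2 blat" and PO :: "'po blat"
    and T1 :: "'x0 \<Rightarrow> 'x1" and T2 :: "'x0 \<Rightarrow> 'x2"
    and S1 :: "'x1 \<Rightarrow> 'po" and S2 :: "'x2 \<Rightarrow> 'po"
  assumes "1 < p"
    and "in_class c p X0" and "in_class c p X1" and "in_class c p X2"
    and "lattice_hom X0 X1 T1" and "op_norm X0 X1 T1 \<le> 1"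
    and "lattice_isometric_embedding X0 X2 T2"
    and "isometric_pushout c p X0 X1 X2 T1 T2 PO S1 S2
           TYPE((nat \<Rightarrow> real \<times> ('x1 + 'x2) list) set)"
  shows "\<forall>x\<in>bl_carrier X1.
           bl_nrm X1 x / K_const c p \<le> bl_nrm PO (S1 x) \<and> bl_nrm PO (S1 x) \<le> bl_nrm X1 x"
proof -
  note p = \<open>1 < p\<close>
  have banach: "banach_lattice X" if "in_class c p X" for X :: "'t blat" using that by (cases c) auto
  note push = assms(8)[unfolded isometric_pushout_def]
  have po: "in_class c p PO" "lattice_hom X1 PO S1" "op_norm X1 PO S1 \<le> 1" using push by simp_all
  have univ: "\<exists>g. lattice_hom PO Z g \<and> (\<forall>x\<in>bl_carrier X1. g (S1 x) = R1 x) \<and>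
             op_norm PO Z g \<le> max (op_norm X1 Z R1) (op_norm X2 Z R2)"
    if "in_class c p Z" "lattice_hom X1 Z R1" "lattice_hom X2 Z R2" "\<forall>x\<in>bl_carrier X0. R1 (T1 x) = R2 (T2 x)"
    for Z :: "(nat \<Rightarrow> real \<times> ('x1 + 'x2) list) set blat" and R1 R2
  proof -
    have "in_class c p Z \<and> lattice_hom X1 Z R1 \<and> lattice_hom X2 Z R2 \<and> (\<forall>x\<in>bl_carrier X0. R1 (T1 x) = R2 (T2 x))"
      using that by (intro conjI)
    from mp[OF spec[OF spec[OF spec[OF push[THEN conjunct2, THEN conjunct2, THEN conjunct2, THEN conjunct2,
      THEN conjunct2, THEN conjunct2]]]] this]
    show ?thesis by (elim exE conjE) (intro exI conjI, assumption+)
  qed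
  interpret X0: blattice X0 using banach assms(2) by unfold_locales
  interpret X1: blattice X1 using banach assms(3) by unfold_locales
  interpret X2: blattice X2 using banach assms(4) by unfold_locales
  have T2: "lattice_hom X0 X2 T2" "\<And>x. x \<in> bl_carrier X0 \<Longrightarrow> bl_nrm X2 (T2 x) = bl_nrm X0 x"
    using assms(7) by (auto simp: lattice_isometric_embedding_def)
  interpret T1: blattice_hom X0 X1 T1 by unfold_locales fact
  interpret T2: blattice_hom X0 X2 T2 by unfold_locales fact
  have T1_contr: "bl_nrm X1 (T1 x) \<le> bl_nrm X0 x" if "x \<in> bl_carrier X0" for x
    using op_norm_contraction[OF X0.banach X1.banach assms(5,6) that] .
  let ?le1 = "\<lambda>v w. bl_leq X1 (X1.val v) (X1.val w)" and ?le2 = "\<lambda>v w. bl_leq X2 (X2.val v) (X2.val w)"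
  let ?jn1 = "\<lambda>v w. X1.emb (bl_sup X1 (X1.val v) (X1.val w))" and ?jn2 = "\<lambda>v w. X2.emb (bl_sup X2 (X2.val v) (X2.val w))"
  let ?jn0 = "\<lambda>v w. X0.emb (bl_sup X0 (X0.val v) (X0.val w))"
  define link where "link a b \<longleftrightarrow> (\<exists>w. ?le1 a (T1.lift w) \<and> ?le2 (T2.lift w) b)" for a b
  have join: "link (?jn1 a a') (?jn2 b b')" if link: "link a b" "link a' b'" for a b a' b'
  proof -
    obtain w w' where w: "?le1 a (T1.lift w)" "?le2 (T2.lift w) b" "?le1 a' (T1.lift w')" "?le2 (T2.lift w') b'"
      using link unfolding link_def by blast
    have "?le1 (?jn1 a a') (?jn1 (T1.lift w) (T1.lift w'))"
      by (rule X1.jn_least) (rule X1.le_trans[OF w(1) X1.jn_ub1], rule X1.le_trans[OF w(3) X1.jn_ub2])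
    moreover have "?le2 (?jn2 (T2.lift w) (T2.lift w')) (?jn2 b b')"
      by (rule X2.jn_least) (rule X2.le_trans[OF w(2) X2.jn_ub1], rule X2.le_trans[OF w(4) X2.jn_ub2])
    ultimately show ?thesis
      unfolding link_def by (intro exI[of _ "?jn0 w w'"]) (simp add: T1.lift_join T2.lift_join)
  qed
  have meet: "link (- ?jn1 (- a) (- a')) (- ?jn2 (- b) (- b'))" if link: "link a b" "link a' b'" for a b a' b'
  proof -
    obtain w w' where w: "?le1 a (T1.lift w)" "?le2 (T2.lift w) b" "?le1 a' (T1.lift w')" "?le2 (T2.lift w') b'"
      using link unfolding link_def by blast
    \<comment> \<open>The infimum of the two witnesses in \<open>X0\<close>, written as a negated
      join.\<close>
    let ?z = "- ?jn0 (- w) (- w')"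
    have z1: "X1.val (T1.lift ?z) = X1.val (- ?jn1 (- T1.lift w) (- T1.lift w'))"
      by (simp only: T1.lift_minus X1.val_minus[of "T1.lift (?jn0 (- w) (- w'))"]
        X1.val_minus[of "?jn1 (- T1.lift w) (- T1.lift w')"] T1.lift_join X1.val_emb X1.sup_mem X1.val_mem)
    have z2: "X2.val (T2.lift ?z) = X2.val (- ?jn2 (- T2.lift w) (- T2.lift w'))"
      by (simp only: T2.lift_minus X2.val_minus[of "T2.lift (?jn0 (- w) (- w'))"]
        X2.val_minus[of "?jn2 (- T2.lift w) (- T2.lift w')"] T2.lift_join X2.val_emb X2.sup_mem X2.val_mem)
    have n1: "?le1 (- T1.lift w) (- a)" "?le1 (- T1.lift w') (- a')" using w by (simp_all only: X1.le_minus_iff)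
    have n2: "?le2 (- b) (- T2.lift w)" "?le2 (- b') (- T2.lift w')" using w by (simp_all only: X2.le_minus_iff)
    have "?le1 (?jn1 (- T1.lift w) (- T1.lift w')) (?jn1 (- a) (- a'))"
      by (rule X1.jn_least) (rule X1.le_trans[OF n1(1) X1.jn_ub1], rule X1.le_trans[OF n1(2) X1.jn_ub2])
    then have 1: "?le1 (- ?jn1 (- a) (- a')) (T1.lift ?z)" unfolding z1 by (simp only: X1.le_minus_iff)
    have "?le2 (?jn2 (- b) (- b')) (?jn2 (- T2.lift w) (- T2.lift w'))"
      by (rule X2.jn_least) (rule X2.le_trans[OF n2(1) X2.jn_ub1], rule X2.le_trans[OF n2(2) X2.jn_ub2])
    then have 2: "?le2 (T2.lift ?z) (- ?jn2 (- b) (- b'))" unfolding z2 by (simp only: X2.le_minus_iff)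
    show ?thesis unfolding link_def using 1 2 by blast
  qed
  have norm: "bl_nrm X1 (X1.val a) \<le> bl_nrm X2 (X2.val b)" if link: "link a b" and a: "?le1 0 a" and b: "?le2 0 b" for a b
  proof -
    obtain w where w: "?le1 a (T1.lift w)" "?le2 (T2.lift w) b" using link unfolding link_def by blast
    \<comment> \<open>The witness need not be positive, but its positive part is also a witness
      because \<open>b\<close> is positive and both maps preserve joins. Norms can then be compared
      along the chain from \<open>a\<close> through \<open>X0\<close> to \<open>b\<close>.\<close>
    let ?w = "?jn0 w 0"
    have 1: "?le1 a (T1.lift ?w)" using w(1) T1.lift_mono[OF X0.jn_ub1] by (rule X1.le_trans)
    have 2: "?le2 (T2.lift ?w) b"
      unfolding T2.lift_join T2.lift_zero using X2.jn_least[OF w(2) b] by simp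
    have "?le2 (T2.lift 0) (T2.lift ?w)" by (rule T2.lift_mono[OF X0.jn_ub2])
    then have 3: "?le2 0 (T2.lift ?w)" unfolding T2.lift_zero .
    have "bl_nrm X1 (X1.val a) \<le> bl_nrm X1 (X1.val (T1.lift ?w))" using a 1 by (rule X1.nm_mono_pos)
    also have "\<dots> \<le> bl_nrm X0 (X0.val ?w)" unfolding T1.val_lift by (rule T1_contr) simp
    also have "\<dots> = bl_nrm X2 (X2.val (T2.lift ?w))" unfolding T2.val_lift by (rule T2(2)[symmetric]) simp
    also have "\<dots> \<le> bl_nrm X2 (X2.val b)" using 3 2 by (rule X2.nm_mono_pos)
    finally show ?thesis .
  qed
  define r where "r = coefficient_exponent c p"
  \<comment> \<open>A constant sequence whose entry lists the two values of the pair; the real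
    number 0 is only a filler to reach the prescribed type.\<close>
  define \<kappa> :: "('x1 \<Rightarrow>\<^sub>0 real) \<times> ('x2 \<Rightarrow>\<^sub>0 real) \<Rightarrow> nat \<Rightarrow> real \<times> ('x1 + 'x2) list"
    where "\<kappa> v = (\<lambda>_. (0, [Inl (X1.val (fst v)), Inr (X2.val (snd v))]))" for v
  have am: "amalgam ?le1 ?jn1 (\<lambda>v. bl_nrm X1 (X1.val v)) ?le2 ?jn2 (\<lambda>v. bl_nrm X2 (X2.val v)) link p r"
  proof unfold_locales
    show "link 0 0" unfolding link_def by (intro exI[of _ 0]) (simp add: T1.lift_zero T2.lift_zero X1.ble_refl X2.ble_refl)
    show "link (a + a') (b + b')" if "link a b" "link a' b'" for a b a' b'
    proof -
      obtain w w' where w: "?le1 a (T1.lift w)" "?le2 (T2.lift w) b" "?le1 a' (T1.lift w')" "?le2 (T2.lift w') b'"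
        using \<open>link a b\<close> \<open>link a' b'\<close> unfolding link_def by blast
      show ?thesis unfolding link_def
        by (rule exI[of _ "w + w'"]) (use X1.le_add[OF w(1,3)] X2.le_add[OF w(2,4)] in \<open>simp add: T1.lift_add T2.lift_add\<close>)
    qed
    show "link (d *\<^sub>R a) (d *\<^sub>R b)" if "0 \<le> d" "link a b" for d a b
    proof -
      obtain w where w: "?le1 a (T1.lift w)" "?le2 (T2.lift w) b" using \<open>link a b\<close> unfolding link_def by blast
      show ?thesis unfolding link_def
        by (rule exI[of _ "d *\<^sub>R w"]) (use X1.le_scaleR[OF \<open>0 \<le> d\<close> w(1)] X2.le_scaleR[OF \<open>0 \<le> d\<close> w(2)] in \<open>simp add: T1.lift_scaleR T2.lift_scaleR\<close>)
    qed
    show "link a' b'" if "link a b" "?le1 a' a" "?le2 b b'" for a b a' b'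
      using that X1.le_trans X2.le_trans unfolding link_def by blast
    show "1 \<le> r" using p unfolding r_def by (cases c) (auto simp: field_simps)
    show "\<exists>z. bl_nrm X1 (X1.val z) powr p \<le> bl_nrm X1 (X1.val x) powr p + bl_nrm X1 (X1.val x') powr p \<and>
        (\<forall>a b. 0 \<le> a \<longrightarrow> 0 \<le> b \<longrightarrow> a powr r + b powr r \<le> 1 \<longrightarrow> ?le1 (a *\<^sub>R x + b *\<^sub>R x') z)"
      if "?le1 0 x" "?le1 0 x'" for x x' unfolding r_def by (rule X1.class_combination[OF p assms(3) that])
    show "\<exists>z. bl_nrm X2 (X2.val z) powr p \<le> bl_nrm X2 (X2.val x) powr p + bl_nrm X2 (X2.val x') powr p \<and>
        (\<forall>a b. 0 \<le> a \<longrightarrow> 0 \<le> b \<longrightarrow> a powr r + b powr r \<le> 1 \<longrightarrow> ?le2 (a *\<^sub>R x + b *\<^sub>R x') z)"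
      if "?le2 0 x" "?le2 0 x'" for x x' unfolding r_def by (rule X2.class_combination[OF p assms(4) that])
  qed (fact join meet norm p)+
  interpret A: amalgam ?le1 ?jn1 "\<lambda>v. bl_nrm X1 (X1.val v)" ?le2 ?jn2 "\<lambda>v. bl_nrm X2 (X2.val v)" link p r by (rule am)
  interpret A: coded_amalgam ?le1 ?jn1 "\<lambda>v. bl_nrm X1 (X1.val v)" ?le2 ?jn2 "\<lambda>v. bl_nrm X2 (X2.val v)" link p r \<kappa>
  proof
    fix v w assume "\<kappa> v = \<kappa> w"
    then have "X1.val (fst v) = X1.val (fst w)" "X2.val (snd v) = X2.val (snd w)" by (auto simp: \<kappa>_def fun_eq_iff)
    then show "A.pair_le v w" by (intro A.pair_le_I) (simp_all add: X1.ble_refl X2.ble_refl)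
  qed
  define R1 where "R1 x = A.R1 (X1.emb x)" for x
  define R2 where "R2 y = A.R2 (X2.emb y)" for y
  have R1_val: "R1 (X1.val v) = A.R1 v" for v
    unfolding R1_def by (rule A.R1_cong) (simp_all add: X1.ble_refl)
  have R2_val: "R2 (X2.val v) = A.R2 v" for v
    unfolding R2_def by (rule A.R2_cong) (simp_all add: X2.ble_refl)
  have R1_le: "bl_nrm A.completion (R1 x) \<le> bl_nrm X1 x" if "x \<in> bl_carrier X1" for x
    using A.R1_nrm_le[of "X1.emb x"] that by (simp add: R1_def)
  have R2_le: "bl_nrm A.completion (R2 x) \<le> bl_nrm X2 x" if "x \<in> bl_carrier X2" for x
    using A.R2_nrm_le[of "X2.emb x"] that by (simp add: R2_def)
  have hom1: "lattice_hom X1 A.completion R1"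
    unfolding lattice_hom_def
  proof (intro conjI ballI allI)
    fix x y a assume x: "x \<in> bl_carrier X1" and y: "y \<in> bl_carrier X1"
    show "R1 (bl_add X1 x y) = bl_add A.completion (R1 x) (R1 y)"
      using R1_val[of "X1.emb x + X1.emb y"] x y by (simp add: X1.val_add R1_def A.R1_add)
    show "R1 (bl_sup X1 x y) = bl_sup A.completion (R1 x) (R1 y)" using x y by (simp add: R1_def A.R1_sup)
  next
    fix x a assume x: "x \<in> bl_carrier X1"
    show "R1 x \<in> bl_carrier A.completion" by (simp add: R1_def A.R_mem)
    show "R1 (bl_scal X1 a x) = bl_scal A.completion a (R1 x)"
      using R1_val[of "a *\<^sub>R X1.emb x"] x by (simp add: X1.val_scaleR R1_def A.R1_scal)
  next
    show "\<exists>c. \<forall>x\<in>bl_carrier X1. bl_nrm A.completion (R1 x) \<le> c * bl_nrm X1 x" using R1_le by (intro exI[of _ 1]) simp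
  qed
  have hom2: "lattice_hom X2 A.completion R2"
    unfolding lattice_hom_def
  proof (intro conjI ballI allI)
    fix x y a assume x: "x \<in> bl_carrier X2" and y: "y \<in> bl_carrier X2"
    show "R2 (bl_add X2 x y) = bl_add A.completion (R2 x) (R2 y)"
      using R2_val[of "X2.emb x + X2.emb y"] x y by (simp add: X2.val_add R2_def A.R2_add)
    show "R2 (bl_sup X2 x y) = bl_sup A.completion (R2 x) (R2 y)" using x y by (simp add: R2_def A.R2_sup)
  next
    fix x a assume x: "x \<in> bl_carrier X2"
    show "R2 x \<in> bl_carrier A.completion" by (simp add: R2_def A.R_mem)
    show "R2 (bl_scal X2 a x) = bl_scal A.completion a (R2 x)"
      using R2_val[of "a *\<^sub>R X2.emb x"] x by (simp add: X2.val_scaleR R2_def A.R2_scal)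
  next
    show "\<exists>c. \<forall>x\<in>bl_carrier X2. bl_nrm A.completion (R2 x) \<le> c * bl_nrm X2 x" using R2_le by (intro exI[of _ 1]) simp
  qed
  have comm: "R1 (T1 x) = R2 (T2 x)" if x: "x \<in> bl_carrier X0" for x
  proof -
    let ?w = "X0.emb x"
    have "link (T1.lift ?w) (T2.lift ?w)" unfolding link_def by (intro exI[of _ ?w]) (simp add: X1.ble_refl X2.ble_refl)
    moreover have "link (- T1.lift ?w) (- T2.lift ?w)" unfolding link_def
      by (intro exI[of _ "- ?w"]) (simp add: T1.lift_minus T2.lift_minus X1.ble_refl X2.ble_refl)
    ultimately have "A.R1 (T1.lift ?w) = A.R2 (T2.lift ?w)" by (rule A.R1_eq_R2)
    then show ?thesis using x by (simp add: R1_def R2_def T1.lift_def T2.lift_def)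
  qed
  have Zc: "in_class c p A.completion" by (rule A.completion_in_class[OF r_def])
  obtain g where g: "lattice_hom PO A.completion g" "\<forall>x\<in>bl_carrier X1. g (S1 x) = R1 x"
      "op_norm PO A.completion g \<le> max (op_norm X1 A.completion R1) (op_norm X2 A.completion R2)"
    using univ[OF Zc hom1 hom2] comm by blast
  have "op_norm X1 A.completion R1 \<le> 1" "op_norm X2 A.completion R2 \<le> 1"
    using op_norm_le_1[OF X1.banach R1_le] op_norm_le_1[OF X2.banach R2_le] by auto
  then have g1: "op_norm PO A.completion g \<le> 1" using g(3) by simp
  have PO: "banach_lattice PO" by (rule banach[OF po(1)])
  have K: "2 powr (1 - 1/p) \<le> K_const c p"
  proof (cases c)
    case Cp_inf
    \<comment> \<open>\<open>gamma_p p\<close> is rewritten with the base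
      \<open>1 / (1 - 1/p)\<close>, which is at least 1, and a positive exponent.\<close>
    have "1 \<le> (1 / (1 - 1/p)) powr (1 - 1/p)" using p by (intro ge_one_powr_ge_zero) (auto simp: field_simps)
    also have "\<dots> = gamma_p p" using p by (simp add: gamma_p_def powr_divide powr_minus_divide[symmetric])
    finally have "2 powr (1 - 1/p) * 1 \<le> 2 powr (1 - 1/p) * gamma_p p" by (intro mult_left_mono) auto
    then show ?thesis using Cp_inf by simp
  qed simp
  show ?thesis
  proof
    fix x assume x: "x \<in> bl_carrier X1"
    have Sx: "S1 x \<in> bl_carrier PO" using po(2) x by (auto simp: lattice_hom_def)
    have k0: "0 < 2 powr (1 - 1/p)" by simp
    have nn: "0 \<le> bl_nrm X1 x" using X1.nm_nonneg[of "X1.emb x"] x by simp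
    have "bl_nrm X1 x / K_const c p \<le> bl_nrm X1 x / 2 powr (1 - 1/p)"
      using K nn k0 by (intro divide_left_mono) (auto intro: mult_pos_pos less_le_trans[OF k0 K])
    also have "\<dots> \<le> bl_nrm A.completion (R1 x)"
      using A.R1_nrm_ge[of "X1.emb x"] x k0 by (simp add: R1_def field_simps)
    also have "\<dots> = bl_nrm A.completion (g (S1 x))" using g(2) x by simp
    also have "\<dots> \<le> bl_nrm PO (S1 x)"
      by (rule op_norm_contraction[OF PO A.completion_banach g(1) g1 Sx])
    finally show "bl_nrm X1 x / K_const c p \<le> bl_nrm PO (S1 x) \<and> bl_nrm PO (S1 x) \<le> bl_nrm X1 x"
      using op_norm_contraction[OF X1.banach PO po(2,3) x] by blast
  qed
qed

end
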